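(* Suppose that $X$ is complete, and let $1\le q<\infty$ with conjugate exponent $q'$ ($1/q+1/q'=1$). Then the pairing $$\langle f,g\rangle=\iint_D f(y,t)\overline{g(y,t)}\,d\gamma(y)\frac{dt}{t},\qquad f\in\mathfrak{t}^{1,q}(\gamma),\quad g\in\mathfrak{t}^{\infty,q'}(\gamma),$$ realises $\mathfrak{t}^{\infty,q'}(\gamma)$ as the dual of $\mathfrak{t}^{1,q}(\gamma)$; that is, every $g\in\mathfrak{t}^{\infty,q'}(\gamma)$ defines a bounded linear functional $f\mapsto\langle f,g\rangle$ on $\mathfrak{t}^{1,q}(\gamma)$, every bounded linear functional on $\mathfrak{t}^{1,q}(\gamma)$ arises in this way from some $g\in\mathfrak{t}^{\infty,q'}(\gamma)$, and the norm of the functional is equivalent to $\|g\|_{\mathfrak{t}^{\infty,q'}(\gamma)}$.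
   Context: $(X,d,\mu)$ is a metric measure space: a metric space $(X,d)$ with a Borel measure $\mu$. Every ball $B \subset X$ is understood to come with a given centre $c_B$ and radius $r_B>0$ ($B = B(c_B,r_B)$, with $B(x,r)=\{y : d(x,y)<r\}$), and $\mu(B)$ is finite and nonzero. For $\lambda\ge 1$, $\lambda B := B(c_B,\lambda r_B)$. $(X,d)$ is geometrically doubling: there is a natural number $N\ge 1$ such that for every ball $B$ of radius $r_B$ there exist at most $N$ mutually disjoint balls of radius $r_B/2$ contained in $B$. $\varphi$ is a measurable real-valued function on $X$ and $d\gamma(x) := e^{-\varphi(x)}\,d\mu(x)$. A function $m : X \to (0,\infty)$ (the admissibility function) is fixed. For $\alpha>0$ the family of $\alpha$-admissible balls is $\mathcal{B}_\alpha := \{ B\subset X : 0<r_B\le \alpha m(c_B)\}$. Standing assumption: for every $\alpha>0$ there is a constant $C_\alpha\ge 1$ such that $\gamma(2B)\le C_\alpha\gamma(B)$ for all $B\in\mathcal{B}_\alpha$. Let $D=\{(y,t)\in X\times(0,\infty) : t<m(y)\}$ and $\Gamma(x)=\{(y,t)\in D : d(x,y)<t\}$. For a measurable function $f$ on $D$ put $$\mathcal{A}_q f(x)=\Big(\iint_{\Gamma(x)}|f(y,t)|^q\,\frac{d\gamma(y)}{\gamma(B(y,t))}\frac{dt}{t}\Big)^{1/q}.$$ The local tent space $\mathfrak{t}^{1,q}(\gamma)$ consists of all measurable $f$ on $D$ with $\|f\|_{\mathfrak{t}^{1,q}(\gamma)}:=\|\mathcal{A}_qf\|_{L^1(\gamma)}<\infty$.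 For an open set $O\subset X$, the admissible tent over $O$ is $T(O):=D\setminus\bigcup_{x\in X\setminus O}\Gamma(x)$. The space $\mathfrak{t}^{\infty,q'}(\gamma)$ consists of those functions $g$ on $D$ for which $$\|g\|_{\mathfrak{t}^{\infty,q'}(\gamma)}=\sup_{B\in\mathcal{B}_5}\Big(\frac{1}{\gamma(B)}\iint_{T(B)}|g(y,t)|^{q'}\,d\gamma(y)\frac{dt}{t}\Big)^{1/q'}$$ is finite (for $q'=\infty$ the expression in the supremum is replaced by the essential supremum of $|g|$ over $T(B)$).
   Formalization: The admissibility function m is assumed Borel measurable (otherwise D is not measurable and the integrals over D are undefined), and every ball is assumed to have finite γ-measure (otherwise all balls have γ(B)=∞, every norm on t^{1,q}(γ) is 0 and the claim fails). *)

theory Defs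
  imports "HOL-Analysis.Analysis" "HOL-Probability.Essential_Supremum"
begin

text \<open>
  Balls are represented by their centre and radius. Disjoint balls have different centres, so a
  family of mutually disjoint balls of radius \<open>r / 2\<close> is given by its set of centres.
\<close>

definition geometrically_doubling :: "'a::metric_space itself \<Rightarrow> bool" where
  "geometrically_doubling _ \<longleftrightarrow>
     (\<exists>N::nat. N \<ge> 1 \<and>
        (\<forall>(x::'a) r C. 0 < r \<longrightarrow> (\<forall>c\<in>C. ball c (r / 2) \<subseteq> ball x r) \<longrightarrow>
           disjoint_family_on (\<lambda>c. ball c (r / 2)) C \<longrightarrow> finite C \<and> card C \<le> N))"

definition weighted_measure :: "'a measure \<Rightarrow> ('a \<Rightarrow> real) \<Rightarrow> 'a measure" where
  "weighted_measure \<mu> \<phi> = density \<mu> (\<lambda>x. ennreal (exp (- \<phi> x)))"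

definition admissible_balls :: "('a \<Rightarrow> real) \<Rightarrow> real \<Rightarrow> ('a \<times> real) set" where
  "admissible_balls m \<alpha> = {(c, r). 0 < r \<and> r \<le> \<alpha> * m c}"

definition locally_doubling :: "'a::metric_space measure \<Rightarrow> ('a \<Rightarrow> real) \<Rightarrow> bool" where
  "locally_doubling \<gamma> m \<longleftrightarrow>
     (\<forall>\<alpha>>0. \<exists>C::real. C \<ge> 1 \<and>
        (\<forall>(c, r)\<in>admissible_balls m \<alpha>.
           emeasure \<gamma> (ball c (2 * r)) \<le> ennreal C * emeasure \<gamma> (ball c r)))"

definition admissible_region :: "('a \<Rightarrow> real) \<Rightarrow> ('a \<times> real) set" where
  "admissible_region m = {(y, t). 0 < t \<and> t < m y}"

definition admissible_cone :: "('a::metric_space \<Rightarrow> real) \<Rightarrow> 'a \<Rightarrow> ('a \<times> real) set" where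
  "admissible_cone m x = {(y, t). (y, t) \<in> admissible_region m \<and> dist x y < t}"

definition admissible_tent :: "('a::metric_space \<Rightarrow> real) \<Rightarrow> 'a set \<Rightarrow> ('a \<times> real) set" where
  "admissible_tent m O' = admissible_region m - (\<Union>x\<in>- O'. admissible_cone m x)"

text \<open>
  The measure \<open>d\<gamma>(y) dt/t\<close> on the admissible region. Since \<open>ennreal\<close> sends nonpositive reals to
  \<open>0\<close>, the density \<open>1 / t\<close> vanishes for \<open>t \<le> 0\<close>.
\<close>

definition region_measure :: "'a measure \<Rightarrow> ('a \<Rightarrow> real) \<Rightarrow> ('a \<times> real) measure" where
  "region_measure \<gamma> m =
     restrict_space (\<gamma> \<Otimes>\<^sub>M density lborel (\<lambda>t. ennreal (1 / t))) (admissible_region m)"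

definition ennreal_powr :: "ennreal \<Rightarrow> real \<Rightarrow> ennreal" where
  "ennreal_powr a p = (if a = \<infinity> then \<infinity> else ennreal (enn2real a powr p))"
  \<comment> \<open>only used for positive exponents \<open>p\<close>\<close>

definition area_functional ::
  "'a::metric_space measure \<Rightarrow> ('a \<Rightarrow> real) \<Rightarrow> real \<Rightarrow> ('a \<times> real \<Rightarrow> complex) \<Rightarrow> 'a \<Rightarrow> ennreal" where
  "area_functional \<gamma> m q f x =
     ennreal_powr
       (\<integral>\<^sup>+p\<in>admissible_cone m x.
          (ennreal (cmod (f p) powr q) / emeasure \<gamma> (ball (fst p) (snd p))) \<partial>region_measure \<gamma> m)
       (1 / q)"

definition tent_norm_1 ::
  "'a::metric_space measure \<Rightarrow> ('a \<Rightarrow> real) \<Rightarrow> real \<Rightarrow> ('a \<times> real \<Rightarrow> complex) \<Rightarrow> ennreal" where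
  "tent_norm_1 \<gamma> m q f = (\<integral>\<^sup>+x. area_functional \<gamma> m q f x \<partial>\<gamma>)"

text \<open>
  Elements of the tent spaces are functions on the admissible region, not equivalence classes; they
  are represented by total functions whose values outside the region are irrelevant.
\<close>

definition tent_space_1 ::
  "'a::metric_space measure \<Rightarrow> ('a \<Rightarrow> real) \<Rightarrow> real \<Rightarrow> ('a \<times> real \<Rightarrow> complex) set" where
  "tent_space_1 \<gamma> m q =
     {f \<in> borel_measurable (region_measure \<gamma> m). tent_norm_1 \<gamma> m q f < \<infinity>}"

definition tent_norm_inf ::
  "'a::metric_space measure \<Rightarrow> ('a \<Rightarrow> real) \<Rightarrow> ennreal \<Rightarrow> ('a \<times> real \<Rightarrow> complex) \<Rightarrow> ennreal" where
  "tent_norm_inf \<gamma> m s g =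
     (SUP (c, r)\<in>admissible_balls m 5.
        if s = \<infinity> then
          esssup (restrict_space (region_measure \<gamma> m) (admissible_tent m (ball c r)))
            (\<lambda>p. ennreal (cmod (g p)))
        else
          ennreal_powr
            (1 / emeasure \<gamma> (ball c r) *
              (\<integral>\<^sup>+p\<in>admissible_tent m (ball c r).
                 ennreal (cmod (g p) powr enn2real s) \<partial>region_measure \<gamma> m))
            (1 / enn2real s))"

definition tent_space_inf ::
  "'a::metric_space measure \<Rightarrow> ('a \<Rightarrow> real) \<Rightarrow> ennreal \<Rightarrow> ('a \<times> real \<Rightarrow> complex) set" where
  "tent_space_inf \<gamma> m s =
     {g \<in> borel_measurable (region_measure \<gamma> m). tent_norm_inf \<gamma> m s g < \<infinity>}"

definition tent_pairing ::
  "'a measure \<Rightarrow> ('a \<Rightarrow> real) \<Rightarrow> ('a \<times> real \<Rightarrow> complex) \<Rightarrow> ('a \<times> real \<Rightarrow> complex) \<Rightarrow> complex" where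
  "tent_pairing \<gamma> m f g = (\<integral>p. f p * cnj (g p) \<partial>region_measure \<gamma> m)"

definition tent_functional ::
  "'a::metric_space measure \<Rightarrow> ('a \<Rightarrow> real) \<Rightarrow> real \<Rightarrow> (('a \<times> real \<Rightarrow> complex) \<Rightarrow> complex) \<Rightarrow> bool" where
  "tent_functional \<gamma> m q l \<longleftrightarrow>
     (\<forall>f\<in>tent_space_1 \<gamma> m q. \<forall>h\<in>tent_space_1 \<gamma> m q. l (\<lambda>p. f p + h p) = l f + l h) \<and>
     (\<forall>a. \<forall>f\<in>tent_space_1 \<gamma> m q. l (\<lambda>p. a * f p) = a * l f) \<and>
     (\<exists>C::real. \<forall>f\<in>tent_space_1 \<gamma> m q. ennreal (cmod (l f)) \<le> ennreal C * tent_norm_1 \<gamma> m q f)"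

definition tent_functional_norm ::
  "'a::metric_space measure \<Rightarrow> ('a \<Rightarrow> real) \<Rightarrow> real \<Rightarrow> (('a \<times> real \<Rightarrow> complex) \<Rightarrow> complex) \<Rightarrow> ennreal" where
  "tent_functional_norm \<gamma> m q l =
     (SUP f\<in>{f \<in> tent_space_1 \<gamma> m q. tent_norm_1 \<gamma> m q f \<le> 1}. ennreal (cmod (l f)))"

end

theory Submission
  imports Defs
begin

text \<open>
  Write \<open>vol p = \<gamma> (B(y,t))\<close> for \<open>p = (y,t)\<close>, and \<open>R\<close> for the measure \<open>d\<gamma>(y) dt/t\<close> on the region \<open>D\<close>.
  By Tonelli, integrating \<open>F / vol\<close> first over the cone \<open>\<Gamma>(x)\<close> and then over \<open>x\<close> gives the integral
  of \<open>F\<close> over \<open>D\<close> (\<open>nn_integral_cone_int\<close>): a point \<open>p\<close> is seen exactly from the vertices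
  \<open>x \<in> B(y,t)\<close>. The three parts of the duality all come from this identity.

  \<^emph>\<open>Every \<open>g\<close> acts boundedly\<close> (\<open>duality_inequality\<close>). For \<open>q = 1\<close> the norm of \<open>f\<close> is its \<open>L\<^sup>1\<close>
  norm and \<open>g\<close> is essentially bounded, because countably many admissible tents cover \<open>D\<close>. For \<open>q > 1\<close>
  the proof is a stopping-time argument in the style of Coifman, Meyer and Stein. Truncate the cone
  integral of \<open>|g|\<^sup>s\<close> (\<open>s\<close> the conjugate exponent) at height \<open>t\<close>.
  Averaged over \<open>x \<in> B(y,t)\<close>, it only involves points whose balls lie in \<open>B(y,3t)\<close>, that is, the tent
  over \<open>B(y,3t)\<close>. Since \<open>t < m(y)\<close>, this ball is admissible with parameter \<open>5\<close>, so the tent condition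
  on \<open>g\<close> and doubling bound the average. Hence for at least half of the \<open>x \<in> B(y,t)\<close> the truncated
  integral at height \<open>t\<close> is below a fixed constant. Keeping only these \<open>x\<close> costs a factor \<open>2\<close>, and
  inside \<open>\<Gamma>(x)\<close> what remains of \<open>|g|\<^sup>s\<close> has bounded integral (\<open>trunc_int_sublevel\<close>), so Young's
  inequality in the cone bounds the pairing by the area functional of \<open>f\<close>.

  \<^emph>\<open>The norm of \<open>g\<close> is controlled by that of the functional\<close>
  (\<open>tent_norm_inf_le_of_pairing_bound\<close>). A function supported in the tent over \<open>B\<close> has its area
  functional supported in \<open>B\<close>, so its tent norm is controlled by its \<open>L\<^sup>q\<close> norm and \<open>\<gamma>(B)\<close>. Testing the
  functional on truncations of \<open>|g|\<^bsup>s-2\<^esup> g\<close> in the tent gives the tent condition.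

  \<^emph>\<open>Every functional comes from some \<open>g\<close>\<close> (\<open>tent_functional_representation\<close>). The space
  \<open>t\<^bsup>1,q\<^esup>\<close> is an order ideal with an order continuous norm, since dominated convergence applies to
  both integrals, and it contains a strictly positive function \<open>w\<close>. On such an ideal a bounded real
  functional is the difference of two positive ones. A positive functional \<open>P\<close> yields a finite measure
  \<open>A \<mapsto> P(w 1\<^sub>A)\<close>, whose Radon-Nikodym density divided by \<open>w\<close> represents \<open>P\<close> on the whole ideal.
\<close>

section \<open>Functionals on ideals of functions with order continuous norm\<close>

text \<open>
  An order ideal \<open>T\<close> of functions with an order continuous gauge \<open>N\<close> that will dominate functionals on
  \<open>T\<close>; for tent spaces \<open>N\<close> is a multiple of the norm, which is finite on \<open>T\<close>. Multiplication by the
  strictly positive \<open>w\<close> turns indicators into elements of \<open>T\<close>.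
\<close>

locale order_continuous_ideal = sigma_finite_measure M for M :: "'b measure" +
  fixes T :: "('b \<Rightarrow> real) set" and N :: "('b \<Rightarrow> real) \<Rightarrow> real" and w :: "'b \<Rightarrow> real"
  assumes T_measurable: "f \<in> T \<Longrightarrow> f \<in> borel_measurable M"
    and T_add: "f \<in> T \<Longrightarrow> g \<in> T \<Longrightarrow> (\<lambda>x. f x + g x) \<in> T"
    and T_scale: "f \<in> T \<Longrightarrow> (\<lambda>x. c * f x) \<in> T"
    and T_ideal: "g \<in> T \<Longrightarrow> f \<in> borel_measurable M \<Longrightarrow>
                    (\<And>x. x \<in> space M \<Longrightarrow> \<bar>f x\<bar> \<le> \<bar>g x\<bar>) \<Longrightarrow> f \<in> T"
    and N_mono: "g \<in> T \<Longrightarrow> f \<in> borel_measurable M \<Longrightarrow>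
                    (\<And>x. x \<in> space M \<Longrightarrow> \<bar>f x\<bar> \<le> \<bar>g x\<bar>) \<Longrightarrow> N f \<le> N g"
    and N_null: "f \<in> borel_measurable M \<Longrightarrow> (AE x in M. f x = 0) \<Longrightarrow> N f = 0"
    and N_continuous: "g \<in> T \<Longrightarrow> (\<And>n. u n \<in> borel_measurable M) \<Longrightarrow>
                    (\<And>n x. x \<in> space M \<Longrightarrow> \<bar>u n x\<bar> \<le> \<bar>g x\<bar>) \<Longrightarrow>
                    (\<And>x. x \<in> space M \<Longrightarrow> (\<lambda>n. u n x) \<longlonglongrightarrow> 0) \<Longrightarrow> (\<lambda>n. N (u n)) \<longlonglongrightarrow> 0"
    and w_in_T: "w \<in> T"
    and w_pos: "x \<in> space M \<Longrightarrow> 0 < w x"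
begin

definition T_pos :: "('b \<Rightarrow> real) set" where
  "T_pos = {f \<in> T. \<forall>x\<in>space M. 0 \<le> f x}"

lemma T_posI: "f \<in> T \<Longrightarrow> (\<And>x. x \<in> space M \<Longrightarrow> 0 \<le> f x) \<Longrightarrow> f \<in> T_pos"
  and T_posD: "f \<in> T_pos \<Longrightarrow> f \<in> T" "f \<in> T_pos \<Longrightarrow> x \<in> space M \<Longrightarrow> 0 \<le> f x"
  by (auto simp: T_pos_def)

lemma T_pos_ideal:
  assumes "g \<in> T_pos" "f \<in> borel_measurable M"
    and "\<And>x. x \<in> space M \<Longrightarrow> 0 \<le> f x" "\<And>x. x \<in> space M \<Longrightarrow> f x \<le> g x"
  shows "f \<in> T_pos"
  by (rule T_posI, rule T_ideal[of g]) (use assms in \<open>auto simp: T_pos_def\<close>)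

lemma T_pos_add: "f \<in> T_pos \<Longrightarrow> g \<in> T_pos \<Longrightarrow> (\<lambda>x. f x + g x) \<in> T_pos"
  by (auto simp: T_pos_def intro: T_add)

lemma T_pos_scale: "f \<in> T_pos \<Longrightarrow> 0 \<le> c \<Longrightarrow> (\<lambda>x. c * f x) \<in> T_pos"
  by (auto simp: T_pos_def intro: T_scale)

lemma T_diff: "f \<in> T \<Longrightarrow> g \<in> T \<Longrightarrow> (\<lambda>x. f x - g x) \<in> T"
  using T_add[of f "\<lambda>x. -1 * g x"] T_scale[of g "-1"] by simp

lemma w_in_T_pos: "w \<in> T_pos"
  using w_in_T w_pos by (auto simp: T_pos_def intro: less_imp_le)

text \<open>
  Order continuity makes \<open>A \<mapsto> P(w 1\<^sub>A)\<close> countably additive, and domination by \<open>N\<close> makes it vanish on null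
  sets. Its density represents \<open>P\<close> on multiples of \<open>w\<close> by indicators, hence on all \<open>u w\<close> by monotone
  approximation of \<open>u\<close>; every \<open>f\<close> has this form with \<open>u = f / w\<close>.
\<close>

lemma positive_functional_integral:
  fixes P :: "('b \<Rightarrow> real) \<Rightarrow> real"
  assumes add: "\<And>f g. f \<in> T_pos \<Longrightarrow> g \<in> T_pos \<Longrightarrow> P (\<lambda>x. f x + g x) = P f + P g"
    and scale: "\<And>f c. f \<in> T_pos \<Longrightarrow> 0 \<le> c \<Longrightarrow> P (\<lambda>x. c * f x) = c * P f"
    and nonneg: "\<And>f. f \<in> T_pos \<Longrightarrow> 0 \<le> P f"
    and bounded: "\<And>f. f \<in> T_pos \<Longrightarrow> P f \<le> B * N f"
    and cong: "\<And>f g. f \<in> T_pos \<Longrightarrow> (\<And>x. x \<in> space M \<Longrightarrow> f x = g x) \<Longrightarrow> P f = P g"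
  obtains d where "d \<in> borel_measurable M" "\<And>x. 0 \<le> d x"
    "\<And>f. f \<in> T_pos \<Longrightarrow> (\<integral>\<^sup>+x. ennreal (f x * d x) \<partial>M) = ennreal (P f)"
proof -
  have w_meas [measurable]: "w \<in> borel_measurable M"
    using w_in_T T_measurable by blast
  have restr: "(\<lambda>x. indicator A x * w x) \<in> T_pos" if "A \<in> sets M" for A
    by (rule T_pos_ideal[OF w_in_T_pos]) (use that w_pos in \<open>auto simp: indicator_def less_imp_le\<close>)
  have zero: "P f = 0" if "f \<in> T_pos" "AE x in M. f x = 0" for f
    using bounded[OF that(1)] nonneg[OF that(1)] N_null[of f] that T_posD T_measurable by auto
  define \<nu> where "\<nu> A = ennreal (P (\<lambda>x. indicator A x * w x))" for A
  have pos: "positive (sets M) \<nu>"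
    unfolding positive_def \<nu>_def using zero[OF restr[of "{}"]] by simp
  have additive: "additive (sets M) \<nu>"
    unfolding additive_def
  proof (intro ballI impI)
    fix A C assume AC: "A \<in> sets M" "C \<in> sets M" "A \<inter> C = {}"
    have "P (\<lambda>x. indicator (A \<union> C) x * w x) = P (\<lambda>x. indicator A x * w x + indicator C x * w x)"
      by (rule cong[OF restr]) (use AC in \<open>auto simp: indicator_def\<close>)
    also have "\<dots> = P (\<lambda>x. indicator A x * w x) + P (\<lambda>x. indicator C x * w x)"
      by (rule add) (use AC restr in auto)
    finally show "\<nu> (A \<union> C) = \<nu> A + \<nu> C"
      unfolding \<nu>_def using AC restr by (simp add: nonneg)
  qed
  have "countably_additive (sets M) \<nu>"
  proof (rule sets.empty_continuous_imp_countably_additive[OF pos additive])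
    fix A :: "nat \<Rightarrow> 'b set" assume A: "range A \<subseteq> sets M" "decseq A" "(\<Inter>i. A i) = {}"
    have pt: "(\<lambda>n. indicator (A n) x * w x) \<longlonglongrightarrow> 0" if "x \<in> space M" for x
    proof -
      obtain k where k: "x \<notin> A k" using A(3) by auto
      have "indicator (A n) x * w x = 0" if "n \<ge> k" for n
        using k decseqD[OF A(2) that] by (auto simp: indicator_def)
      then show ?thesis
        by (intro tendsto_eventually) (auto simp: eventually_sequentially)
    qed
    have "(\<lambda>n. N (\<lambda>x. indicator (A n) x * w x)) \<longlonglongrightarrow> 0"
      by (rule N_continuous[OF w_in_T])
        (use A pt T_posD(1)[OF restr] T_measurable in \<open>auto simp: indicator_def image_subset_iff\<close>)
    then have "(\<lambda>n. B * N (\<lambda>x. indicator (A n) x * w x)) \<longlonglongrightarrow> 0"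
      using tendsto_mult_left[of _ 0 sequentially B] by fastforce
    then have "(\<lambda>n. P (\<lambda>x. indicator (A n) x * w x)) \<longlonglongrightarrow> 0"
      by (rule tendsto_sandwich[OF _ _ tendsto_const, rotated 2])
        (use A restr bounded nonneg in \<open>auto simp: image_subset_iff\<close>)
    then show "(\<lambda>i. \<nu> (A i)) \<longlonglongrightarrow> 0"
      unfolding \<nu>_def using tendsto_ennrealI by fastforce
  qed (auto simp: \<nu>_def)
  then have \<nu>_measure: "measure_space (space M) (sets M) \<nu>"
    using pos by (simp add: measure_space_def sets.sigma_algebra_axioms)
  define NU where "NU = measure_of (space M) (sets M) \<nu>"
  have NU: "emeasure NU A = \<nu> A" if "A \<in> sets M" for A
    unfolding NU_def using \<nu>_measure that
    by (intro emeasure_measure_of_sigma) (auto simp: measure_space_def)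
  have sets_NU [measurable_cong]: "sets NU = sets M"
    by (simp add: NU_def)
  have space_NU: "space NU = space M"
    by (simp add: NU_def)
  have "absolutely_continuous M NU"
    unfolding absolutely_continuous_def
  proof
    fix A assume "A \<in> null_sets M"
    then have A: "A \<in> sets M" "AE x in M. x \<notin> A"
      by (auto intro: AE_not_in)
    have "\<nu> A = 0"
    proof -
      have "AE x in M. indicator A x * w x = 0"
        using A(2) by eventually_elim simp
      then show ?thesis unfolding \<nu>_def using zero[OF restr[OF A(1)]] by simp
    qed
    then show "A \<in> null_sets NU"
      using A NU by (auto simp: null_sets_def sets_NU)
  qed
  then obtain D where D [measurable]: "D \<in> borel_measurable M" and density: "density M D = NU"
    using Radon_Nikodym sets_NU by blast
  have "finite_measure NU"
    by (rule finite_measureI) (simp add: space_NU NU \<nu>_def)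
  then have D_finite: "AE x in M. D x \<noteq> \<infinity>"
    using finite_measure.axioms(1) sigma_finite_iff_density_finite[OF D] density by metis
  have main: "(\<integral>\<^sup>+x. ennreal (u x) \<partial>NU) = ennreal (P (\<lambda>x. u x * w x))"
    if "u \<in> borel_measurable M" "\<And>x. 0 \<le> u x" "(\<lambda>x. u x * w x) \<in> T_pos" for u
    using that
  proof (induction u rule: borel_measurable_induct_real)
    case (set A)
    then have "(\<integral>\<^sup>+x. ennreal (indicator A x) \<partial>NU) = \<nu> A"
      by (simp add: ennreal_indicator sets_NU NU)
    then show ?case by (simp add: \<nu>_def)
  next
    case (mult u c)
    show ?case
    proof (cases "c = 0")
      case True
      then show ?thesis using zero[OF mult(5)] by simp
    next
      case False
      have "(\<lambda>x. (1 / c) * (c * u x * w x)) \<in> T_pos"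
        using mult by (intro T_pos_scale) auto
      then have u: "(\<lambda>x. u x * w x) \<in> T_pos" using False by simp
      have "(\<integral>\<^sup>+x. ennreal (c * u x) \<partial>NU) = ennreal c * (\<integral>\<^sup>+x. ennreal (u x) \<partial>NU)"
        using mult by (subst nn_integral_cmult[symmetric]) (auto simp: ennreal_mult)
      also have "\<dots> = ennreal (c * P (\<lambda>x. u x * w x))"
        using mult u nonneg by (simp add: ennreal_mult)
      also have "\<dots> = ennreal (P (\<lambda>x. c * u x * w x))"
        using scale[OF u mult(1)] by (simp add: mult.assoc)
      finally show ?thesis .
    qed
  next
    case (add u v)
    have [measurable]: "u \<in> borel_measurable M" "v \<in> borel_measurable M" using add by auto
    have u: "(\<lambda>x. u x * w x) \<in> T_pos"
      by (rule T_pos_ideal[OF add.prems]) (use add w_pos in \<open>auto simp: less_imp_le algebra_simps\<close>)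
    have v: "(\<lambda>x. v x * w x) \<in> T_pos"
      by (rule T_pos_ideal[OF add.prems]) (use add w_pos in \<open>auto simp: less_imp_le algebra_simps\<close>)
    have "(\<integral>\<^sup>+x. ennreal (v x + u x) \<partial>NU) = (\<integral>\<^sup>+x. ennreal (v x) \<partial>NU) + (\<integral>\<^sup>+x. ennreal (u x) \<partial>NU)"
      using add by (subst nn_integral_add[symmetric]) auto
    also have "\<dots> = ennreal (P (\<lambda>x. v x * w x) + P (\<lambda>x. u x * w x))"
      using add u v nonneg by simp
    also have "\<dots> = ennreal (P (\<lambda>x. (v x + u x) * w x))"
      using assms(1)[OF v u] by (simp add: algebra_simps)
    finally show ?case .
  next
    case (seq U)
    note [measurable] = seq.hyps(1)
    have u_meas: "u \<in> borel_measurable M"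
      using seq by (intro borel_measurable_LIMSEQ_metric[of U M u]) auto
    have le: "U i x \<le> u x" if "x \<in> space M" for i x
      using seq.hyps(3) seq.hyps(4)[OF that] by (intro incseq_le) (auto simp: incseq_def le_fun_def)
    have U: "(\<lambda>x. U i x * w x) \<in> T_pos" for i
      by (rule T_pos_ideal[OF seq.prems])
        (use seq.hyps(2) w_pos le in \<open>auto simp: less_imp_le intro!: mult_right_mono mult_nonneg_nonneg\<close>)
    have on_space: "(\<integral>\<^sup>+x. h x * indicator (space M) x \<partial>NU) = (\<integral>\<^sup>+x. h x \<partial>NU)" for h
      by (intro nn_integral_cong) (simp add: space_NU)
    have "(\<lambda>i. \<integral>\<^sup>+x. ennreal (U i x) * indicator (space M) x \<partial>NU)
            \<longlonglongrightarrow> (\<integral>\<^sup>+x. ennreal (u x) * indicator (space M) x \<partial>NU)"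
    proof (rule nn_integral_LIMSEQ)
      show "incseq (\<lambda>i x. ennreal (U i x) * indicator (space M) x)"
        using seq.hyps(3) by (auto simp: incseq_def le_fun_def intro!: ennreal_leI mult_right_mono)
      show "(\<lambda>n. ennreal (U n x) * indicator (space M) x) \<longlonglongrightarrow> ennreal (u x) * indicator (space M) x" for x
        using seq.hyps(4)[of x] by (cases "x \<in> space M") auto
    qed (auto simp: space_NU[symmetric])
    then have "(\<lambda>i. \<integral>\<^sup>+x. ennreal (U i x) \<partial>NU) \<longlonglongrightarrow> (\<integral>\<^sup>+x. ennreal (u x) \<partial>NU)"
      by (simp only: on_space)
    moreover have "(\<lambda>i. P (\<lambda>x. U i x * w x)) \<longlonglongrightarrow> P (\<lambda>x. u x * w x)"
    proof -
      have d: "(\<lambda>x. (u x - U i x) * w x) \<in> T_pos" for i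
        by (rule T_pos_ideal[OF seq.prems])
          (use seq.hyps(2) w_pos le u_meas in \<open>auto simp: less_imp_le intro!: mult_right_mono mult_nonneg_nonneg\<close>)
      have eq: "P (\<lambda>x. u x * w x) = P (\<lambda>x. U i x * w x) + P (\<lambda>x. (u x - U i x) * w x)" for i
        using assms(1)[OF U d, of i i] by (simp add: algebra_simps)
      have "(\<lambda>i. N (\<lambda>x. (u x - U i x) * w x)) \<longlonglongrightarrow> 0"
      proof (rule N_continuous[OF T_posD(1)[OF seq.prems]])
        show "(\<lambda>x. (u x - U n x) * w x) \<in> borel_measurable M" for n
          using u_meas by measurable
        show "\<bar>(u x - U n x) * w x\<bar> \<le> \<bar>u x * w x\<bar>" if "x \<in> space M" for n x
          using le[OF that, of n] seq.hyps(2)[of n x] by (simp add: abs_mult mult_right_mono)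
        show "(\<lambda>n. (u x - U n x) * w x) \<longlonglongrightarrow> 0" if "x \<in> space M" for x
          by (rule tendsto_eq_intros seq.hyps(4)[OF that] refl | simp)+
      qed
      then have "(\<lambda>i. B * N (\<lambda>x. (u x - U i x) * w x)) \<longlonglongrightarrow> 0"
        using tendsto_mult_left[of _ 0 sequentially B] by fastforce
      then have "(\<lambda>i. P (\<lambda>x. (u x - U i x) * w x)) \<longlonglongrightarrow> 0"
        by (rule tendsto_sandwich[OF _ _ tendsto_const, rotated 2])
          (use d bounded nonneg in auto)
      then have "(\<lambda>i. P (\<lambda>x. u x * w x) - P (\<lambda>x. (u x - U i x) * w x)) \<longlonglongrightarrow> P (\<lambda>x. u x * w x) - 0"
        by (intro tendsto_intros)
      moreover have "P (\<lambda>x. U i x * w x) = P (\<lambda>x. u x * w x) - P (\<lambda>x. (u x - U i x) * w x)" for i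
        using eq[of i] by simp
      ultimately show ?thesis by simp
    qed
    then have "(\<lambda>i. ennreal (P (\<lambda>x. U i x * w x))) \<longlonglongrightarrow> ennreal (P (\<lambda>x. u x * w x))"
      by (intro tendsto_ennrealI)
    ultimately show ?case
      using seq.IH[OF U] by (simp add: LIMSEQ_unique)
  qed
  \<comment> \<open>The measure represents the functional on functions \<open>u w\<close>, so the density must be divided by \<open>w\<close>.\<close>
  define d where "d x = (if x \<in> space M then enn2real (D x) / w x else 0)" for x
  show thesis
  proof
    show d_meas: "d \<in> borel_measurable M"
      unfolding d_def by (rule measurable_cong[THEN iffD1, of M "\<lambda>x. enn2real (D x) / w x"]) auto
    show "0 \<le> d x" for x
      unfolding d_def using w_pos[of x] by (auto intro!: divide_nonneg_nonneg simp: less_imp_le)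
    fix f assume f: "f \<in> T_pos"
    have [measurable]: "f \<in> borel_measurable M" using f T_posD T_measurable by blast
    define u where "u x = max 0 (f x / w x)" for x
    have u_meas [measurable]: "u \<in> borel_measurable M"
      unfolding u_def by measurable
    have uw: "u x * w x = f x" if "x \<in> space M" for x
      using T_posD(2)[OF f that] w_pos[OF that] by (simp add: u_def)
    have "(\<lambda>x. u x * w x) \<in> T_pos"
      by (rule T_pos_ideal[OF f]) (use T_posD(2)[OF f] uw in auto)
    then have "(\<integral>\<^sup>+x. ennreal (u x) \<partial>NU) = ennreal (P (\<lambda>x. u x * w x))"
      by (intro main) (auto simp: u_def)
    also have "P (\<lambda>x. u x * w x) = P f"
      using cong[OF f, of "\<lambda>x. u x * w x"] uw by simp
    also have "(\<integral>\<^sup>+x. ennreal (u x) \<partial>NU) = (\<integral>\<^sup>+x. D x * ennreal (u x) \<partial>M)"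
      unfolding density[symmetric] by (simp add: nn_integral_density)
    also have "\<dots> = (\<integral>\<^sup>+x. ennreal (f x * d x) \<partial>M)"
    proof (rule nn_integral_cong_AE, use D_finite AE_space in eventually_elim)
      fix x assume x: "D x \<noteq> \<infinity>" "x \<in> space M"
      then have "D x = ennreal (enn2real (D x))" by (simp add: top.not_eq_extremum)
      then have "D x * ennreal (u x) = ennreal (enn2real (D x) * u x)"
        by (metis ennreal_mult' enn2real_nonneg)
      also have "enn2real (D x) * u x = f x * d x"
        using w_pos[OF x(2)] uw[OF x(2)] x(2) by (simp add: d_def field_simps)
      finally show "D x * ennreal (u x) = ennreal (f x * d x)" .
    qed
    finally show "(\<integral>\<^sup>+x. ennreal (f x * d x) \<partial>M) = ennreal (P f)" .
  qed
qed

text \<open>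
  The Riesz decomposition: \<open>P f = sup {L h | 0 \<le> h \<le> f}\<close> is additive because an \<open>h \<le> f + g\<close> splits as
  \<open>min h f\<close> plus a remainder below \<open>g\<close>. Both \<open>P\<close> and \<open>P - L\<close> are then positive functionals, to which
  the preceding lemma applies.
\<close>

lemma functional_integral:
  fixes L :: "('b \<Rightarrow> real) \<Rightarrow> real"
  assumes L_add: "\<And>f g. f \<in> T \<Longrightarrow> g \<in> T \<Longrightarrow> L (\<lambda>x. f x + g x) = L f + L g"
    and L_scale: "\<And>f c. f \<in> T \<Longrightarrow> L (\<lambda>x. c * f x) = c * L f"
    and L_bounded: "\<And>f. f \<in> T \<Longrightarrow> \<bar>L f\<bar> \<le> N f"
  obtains G where "G \<in> borel_measurable M"
    "\<And>f. f \<in> T \<Longrightarrow> integrable M (\<lambda>x. f x * G x) \<and> L f = (\<integral>x. f x * G x \<partial>M)"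
proof -
  have L_cong: "L f = L g" if "f \<in> T" "g \<in> T" "\<And>x. x \<in> space M \<Longrightarrow> f x = g x" for f g
  proof -
    have "L (\<lambda>x. f x - g x) = 0"
      using L_bounded[OF T_diff[OF that(1,2)]] N_null[of "\<lambda>x. f x - g x"] T_measurable that by force
    moreover have "L (\<lambda>x. f x - g x) = L f - L g"
      using L_add[of f "\<lambda>x. -1 * g x"] L_scale[of g "-1"] T_scale[of g "-1"] that by simp
    ultimately show ?thesis by simp
  qed
  have T_cong: "g \<in> T" if "f \<in> T" "\<And>x. x \<in> space M \<Longrightarrow> f x = g x" for f g
    using that measurable_cong[of M f g] T_measurable by (intro T_ideal[OF that(1)]) auto
  define S where "S f = {L h | h. h \<in> T_pos \<and> (\<forall>x\<in>space M. h x \<le> f x)}" for f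
  define P where "P f = Sup (S f)" for f
  have S_bd: "L h \<le> N f" if "f \<in> T_pos" "h \<in> T_pos" "\<forall>x\<in>space M. h x \<le> f x" for f h
  proof -
    have "N h \<le> N f"
      by (rule N_mono) (use that T_posD T_measurable in auto)
    then show ?thesis using L_bounded[of h] T_posD(1)[OF that(2)] by force
  qed
  have bdd: "bdd_above (S f)" if "f \<in> T_pos" for f
    unfolding bdd_above_def S_def using S_bd[OF that] by blast
  have le_P: "L h \<le> P f" if "f \<in> T_pos" "h \<in> T_pos" "\<And>x. x \<in> space M \<Longrightarrow> h x \<le> f x" for f h
    unfolding P_def by (rule cSup_upper[OF _ bdd[OF that(1)]]) (use that in \<open>auto simp: S_def\<close>)
  have P_le: "P f \<le> z" if "f \<in> T_pos"
    "\<And>h. h \<in> T_pos \<Longrightarrow> (\<And>x. x \<in> space M \<Longrightarrow> h x \<le> f x) \<Longrightarrow> L h \<le> z" for f z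
    unfolding P_def by (rule cSup_least) (use that in \<open>auto simp: S_def\<close>)
  have P_cong: "P f = P g" if "\<And>x. x \<in> space M \<Longrightarrow> f x = g x" for f g
    using that by (simp add: P_def S_def)
  have zero: "(\<lambda>x. 0) \<in> T_pos"
    using T_scale[OF w_in_T, of 0] by (simp add: T_pos_def)
  have L0: "L (\<lambda>x. 0) = 0" using L_scale[OF w_in_T, of 0] by simp
  have P_nonneg: "0 \<le> P f" if "f \<in> T_pos" for f
    using le_P[OF that zero] L0 T_posD(2)[OF that] by simp
  have P_bounded: "P f \<le> N f" if "f \<in> T_pos" for f
    using P_le[OF that] S_bd[OF that] by blast
  have P_add: "P (\<lambda>x. f x + g x) = P f + P g" if f: "f \<in> T_pos" and g: "g \<in> T_pos" for f g
  proof (rule antisym)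
    show "P (\<lambda>x. f x + g x) \<le> P f + P g"
    proof (rule P_le[OF T_pos_add[OF f g]])
      fix h assume h: "h \<in> T_pos" "\<And>x. x \<in> space M \<Longrightarrow> h x \<le> f x + g x"
      have [measurable]: "f \<in> borel_measurable M" "h \<in> borel_measurable M"
        using f h T_posD T_measurable by auto
      define h1 h2 where "h1 = (\<lambda>x. min (h x) (f x))" and "h2 = (\<lambda>x. h x - min (h x) (f x))"
      have h1: "h1 \<in> T_pos"
        by (rule T_pos_ideal[OF h(1)]) (use f h T_posD in \<open>auto simp: h1_def\<close>)
      have h2: "h2 \<in> T_pos"
        by (rule T_pos_ideal[OF h(1)]) (use f h T_posD in \<open>auto simp: h2_def min_def\<close>)
      have "L h = L h1 + L h2"
        using L_add[OF T_posD(1)[OF h1] T_posD(1)[OF h2]] by (simp add: h1_def h2_def)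
      also have "\<dots> \<le> P f + P g"
      proof (rule add_mono)
        show "L h1 \<le> P f" by (rule le_P[OF f h1]) (auto simp: h1_def)
        show "L h2 \<le> P g"
          by (rule le_P[OF g h2]) (use h(2) T_posD(2)[OF g] in \<open>force simp: h2_def min_def\<close>)
      qed
      finally show "L h \<le> P f + P g" .
    qed
    have "P f \<le> P (\<lambda>x. f x + g x) - P g"
    proof (rule P_le[OF f])
      fix h1 assume h1: "h1 \<in> T_pos" "\<And>x. x \<in> space M \<Longrightarrow> h1 x \<le> f x"
      have "P g \<le> P (\<lambda>x. f x + g x) - L h1"
      proof (rule P_le[OF g])
        fix h2 assume h2: "h2 \<in> T_pos" "\<And>x. x \<in> space M \<Longrightarrow> h2 x \<le> g x"
        have "L (\<lambda>x. h1 x + h2 x) \<le> P (\<lambda>x. f x + g x)"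
          by (rule le_P) (use h1 h2 f g T_pos_add in \<open>auto intro: add_mono\<close>)
        then show "L h2 \<le> P (\<lambda>x. f x + g x) - L h1"
          using L_add[OF T_posD(1)[OF h1(1)] T_posD(1)[OF h2(1)]] by simp
      qed
      then show "L h1 \<le> P (\<lambda>x. f x + g x) - P g" by simp
    qed
    then show "P f + P g \<le> P (\<lambda>x. f x + g x)" by simp
  qed
  have P_scale_le: "c * P f \<le> P (\<lambda>x. c * f x)" if f: "f \<in> T_pos" and c: "0 < c" for f c
  proof -
    have "P f \<le> P (\<lambda>x. c * f x) / c"
    proof (rule P_le[OF f])
      fix h assume h: "h \<in> T_pos" "\<And>x. x \<in> space M \<Longrightarrow> h x \<le> f x"
      have "L (\<lambda>x. c * h x) \<le> P (\<lambda>x. c * f x)"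
        by (rule le_P) (use h f c T_pos_scale in auto)
      then show "L h \<le> P (\<lambda>x. c * f x) / c"
        using L_scale[OF T_posD(1)[OF h(1)], of c] c by (simp add: field_simps)
    qed
    then show ?thesis using c by (simp add: field_simps)
  qed
  have P_scale: "P (\<lambda>x. c * f x) = c * P f" if f: "f \<in> T_pos" and c: "0 \<le> c" for f c
  proof (cases "c = 0")
    case True
    have "P (\<lambda>x. 0) = 0"
      using P_bounded[OF zero] P_nonneg[OF zero] N_null[of "\<lambda>x. 0"] by simp
    with True show ?thesis by simp
  next
    case False
    then have c': "0 < c" using c by simp
    have "(1/c) * P (\<lambda>x. c * f x) \<le> P (\<lambda>x. (1/c) * (c * f x))"
      by (rule P_scale_le[OF T_pos_scale[OF f c]]) (use c' in simp)
    then have "P (\<lambda>x. c * f x) \<le> c * P f"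
      using c' by (simp add: field_simps)
    with P_scale_le[OF f c'] show ?thesis by simp
  qed
  obtain d1 where d1 [measurable]: "d1 \<in> borel_measurable M" "\<And>x. 0 \<le> d1 x"
    "\<And>f. f \<in> T_pos \<Longrightarrow> (\<integral>\<^sup>+x. ennreal (f x * d1 x) \<partial>M) = ennreal (P f)"
  proof (rule positive_functional_integral[of P 1])
    show "P f = P g" if "f \<in> T_pos" "\<And>x. x \<in> space M \<Longrightarrow> f x = g x" for f g
      by (rule P_cong) (rule that(2))
  qed (simp_all add: P_add P_scale P_nonneg P_bounded)
  define Q where "Q f = P f - L f" for f
  have Q_bounded: "Q f \<le> 2 * N f" if "f \<in> T_pos" for f
    using P_bounded[OF that] L_bounded[OF T_posD(1)[OF that]] by (simp add: Q_def)
  have Q_nonneg: "0 \<le> Q f" if "f \<in> T_pos" for f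
    using le_P[OF that that] by (simp add: Q_def)
  obtain d2 where d2 [measurable]: "d2 \<in> borel_measurable M" "\<And>x. 0 \<le> d2 x"
    "\<And>f. f \<in> T_pos \<Longrightarrow> (\<integral>\<^sup>+x. ennreal (f x * d2 x) \<partial>M) = ennreal (Q f)"
  proof (rule positive_functional_integral[of Q 2])
    show "Q (\<lambda>x. f x + g x) = Q f + Q g" if "f \<in> T_pos" "g \<in> T_pos" for f g
      using P_add[OF that] L_add[of f g] that T_posD by (simp add: Q_def)
    show "Q (\<lambda>x. c * f x) = c * Q f" if "f \<in> T_pos" "0 \<le> c" for f c
      using P_scale[OF that] L_scale[of f c] that T_posD by (simp add: Q_def algebra_simps)
    show "Q f = Q g" if "f \<in> T_pos" "\<And>x. x \<in> space M \<Longrightarrow> f x = g x" for f g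
      using P_cong[of f g] L_cong[of f g] T_cong[of f g] that T_posD by (simp add: Q_def)
  qed (simp_all add: Q_bounded Q_nonneg)
  define G where "G x = d1 x - d2 x" for x
  have pos: "integrable M (\<lambda>x. f x * G x) \<and> L f = (\<integral>x. f x * G x \<partial>M)" if f: "f \<in> T_pos" for f
  proof -
    have [measurable]: "f \<in> borel_measurable M" using f T_posD T_measurable by blast
    have "has_bochner_integral M (\<lambda>x. f x * d1 x) (P f)"
      by (rule has_bochner_integral_nn_integral)
        (use d1 f P_nonneg T_posD in auto)
    moreover have "has_bochner_integral M (\<lambda>x. f x * d2 x) (Q f)"
      by (rule has_bochner_integral_nn_integral)
        (use d2 f Q_nonneg T_posD in auto)
    ultimately have "has_bochner_integral M (\<lambda>x. f x * d1 x - f x * d2 x) (P f - Q f)"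
      by (rule has_bochner_integral_diff)
    then have "has_bochner_integral M (\<lambda>x. f x * G x) (L f)"
      by (simp add: G_def Q_def algebra_simps)
    then show ?thesis by (auto simp: has_bochner_integral_iff)
  qed
  show thesis
  proof
    show "G \<in> borel_measurable M" unfolding G_def by measurable
    fix f assume f: "f \<in> T"
    have [measurable]: "f \<in> borel_measurable M" using f T_measurable by blast
    define f1 f2 where "f1 = (\<lambda>x. max 0 (f x))" and "f2 = (\<lambda>x. max 0 (- f x))"
    have f1: "f1 \<in> T_pos"
      by (rule T_posI, rule T_ideal[OF f]) (auto simp: f1_def)
    have f2: "f2 \<in> T_pos"
      by (rule T_posI, rule T_ideal[OF f]) (auto simp: f2_def)
    have eq: "f x = f1 x + (-1) * f2 x" for x by (auto simp: f1_def f2_def)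
    have "L f = L (\<lambda>x. f1 x + (-1) * f2 x)" using eq by presburger
    also have "\<dots> = L f1 + L (\<lambda>x. (-1) * f2 x)"
      by (rule L_add) (use f1 f2 T_posD T_scale in blast)+
    also have "\<dots> = L f1 - L f2" using L_scale[of f2 "-1"] f2 T_posD by simp
    finally have Lf: "L f = L f1 - L f2" .
    have "has_bochner_integral M (\<lambda>x. f1 x * G x - f2 x * G x) (L f)"
      unfolding Lf using pos[OF f1] pos[OF f2]
      by (intro has_bochner_integral_diff) (auto simp: has_bochner_integral_iff)
    moreover have "f1 x * G x - f2 x * G x = f x * G x" for x
      by (simp add: eq algebra_simps)
    ultimately show "integrable M (\<lambda>x. f x * G x) \<and> L f = (\<integral>x. f x * G x \<partial>M)"
      by (simp add: has_bochner_integral_iff)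
  qed
qed

end

section \<open>Powers, conjugate exponents and cofinal sequences\<close>

lemma ennreal_powr_ennreal: "0 \<le> a \<Longrightarrow> ennreal_powr (ennreal a) p = ennreal (a powr p)"
  by (simp add: ennreal_powr_def)

lemma ennreal_powr_top [simp]: "ennreal_powr top p = top"
  by (simp add: ennreal_powr_def)

lemma ennreal_powr_0 [simp]: "ennreal_powr 0 p = 0"
  by (simp add: ennreal_powr_def)

lemma ennreal_powr_1 [simp]: "ennreal_powr a 1 = a"
  by (cases a) (auto simp: ennreal_powr_ennreal)

lemma measurable_ennreal_powr [measurable]:
  assumes [measurable]: "f \<in> borel_measurable M"
  shows "(\<lambda>x. ennreal_powr (f x) p) \<in> borel_measurable M"
proof -
  have [measurable]: "{x \<in> space M. f x = \<infinity>} \<in> sets M"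
    by (rule borel_measurable_eq) auto
  show ?thesis unfolding ennreal_powr_def by measurable
qed

lemma ennreal_powr_mono:
  assumes "a \<le> b" "0 \<le> p"
  shows "ennreal_powr a p \<le> ennreal_powr b p"
  using assms by (cases a; cases b) (auto simp: ennreal_powr_ennreal top_unique intro!: ennreal_leI powr_mono2)

lemma ennreal_powr_eq_top_iff: "ennreal_powr a p = top \<longleftrightarrow> a = top"
  by (simp add: ennreal_powr_def)

lemma ennreal_powr_le_iff:
  assumes "0 < p" "0 \<le> c"
  shows "ennreal_powr a (1 / p) \<le> ennreal c \<longleftrightarrow> a \<le> ennreal (c powr p)"
proof (cases a)
  case (real r)
  have "r powr (1 / p) \<le> c \<longleftrightarrow> r \<le> c powr p"
    using powr_mono2[of p "r powr (1/p)" c] powr_mono2[of "1/p" r "c powr p"] assms real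
    by (auto simp: powr_powr)
  then have "ennreal (r powr (1 / p)) \<le> ennreal c \<longleftrightarrow> ennreal r \<le> ennreal (c powr p)"
    using assms by (simp add: ennreal_le_iff)
  with real show ?thesis by (simp only: ennreal_powr_ennreal)
qed (simp add: top_unique)

lemma ennreal_powr_cmult:
  assumes "0 \<le> c"
  shows "ennreal_powr (ennreal c * a) p = ennreal (c powr p) * ennreal_powr a p"
proof (cases a)
  case (real r)
  with assms show ?thesis
    by (simp add: ennreal_powr_ennreal powr_mult flip: ennreal_mult)
next
  case top
  with assms show ?thesis
    by (cases "c = 0") (auto simp: ennreal_mult_top)
qed

lemma ennreal_powr_add_le:
  assumes "0 \<le> p" "p \<le> 1"
  shows "ennreal_powr (a + b) p \<le> 2 * (ennreal_powr a p + ennreal_powr b p)"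
proof -
  have *: "ennreal_powr (a + b) p \<le> 2 * ennreal_powr (max a b) p"
  proof -
    have "a + b \<le> max a b + max a b"
      by (intro add_mono) auto
    also have "\<dots> = ennreal 2 * max a b"
      by (simp add: mult_2)
    finally have "ennreal_powr (a + b) p \<le> ennreal (2 powr p) * ennreal_powr (max a b) p"
      using ennreal_powr_mono[of "a + b" "ennreal 2 * max a b" p] assms
      by (simp only: ennreal_powr_cmult)
    also have "ennreal (2 powr p) \<le> 2"
      using powr_mono[of p 1 2] assms by (simp add: ennreal_le_iff2 flip: ennreal_numeral)
    finally show ?thesis by (simp add: mult_right_mono)
  qed
  also have "ennreal_powr (max a b) p \<le> ennreal_powr a p + ennreal_powr b p"
    by (simp add: max_def)
  finally show ?thesis by (simp add: mult_left_mono)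
qed

text \<open>
  A substitute for Hoelder's inequality when integrating \<open>a\<^bsup>1/q\<^esup>\<close>: the bound is linear in \<open>a\<close>, so it can be
  integrated by Tonelli, and the weight \<open>v\<close> is free to be chosen afterwards. It distinguishes
  \<open>a \<le> v\<^sup>q\<close> from \<open>a > v\<^sup>q\<close>.
\<close>

lemma ennreal_powr_le_linear:
  assumes q: "1 \<le> q" and v: "0 \<le> v" "v = 0 \<Longrightarrow> a = 0"
  shows "ennreal_powr a (1 / q) \<le> ennreal v + a * ennreal (v powr (1 - q))"
proof (cases a)
  case (real r)
  show ?thesis
  proof (cases "r powr (1 / q) \<le> v")
    case True
    then have "ennreal_powr a (1 / q) \<le> ennreal v"
      using real by (simp add: ennreal_powr_ennreal ennreal_leI)
    then show ?thesis by (simp add: add_increasing2)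
  next
    case False
    with v real have v': "0 < v" by (cases "v = 0") auto
    with False real have r: "0 < r" by (cases "r = 0") auto
    define z where "z = r powr (1 / q)"
    have z: "0 < z" "v \<le> z" using r False by (auto simp: z_def)
    have rz: "r = z powr q" using r q by (simp add: z_def powr_powr)
    have "z = r * z powr (1 - q)"
      unfolding rz using z by (simp flip: powr_add)
    also have "\<dots> \<le> r * v powr (1 - q)"
      using r q z v' by (intro mult_left_mono powr_mono2') auto
    finally have "ennreal z \<le> ennreal r * ennreal (v powr (1 - q))"
      using r by (simp add: ennreal_leI flip: ennreal_mult)
    then show ?thesis
      using real by (simp add: ennreal_powr_ennreal z_def add_increasing)
  qed
next
  case top
  with v have "0 < v" by (cases "v = 0") auto
  then show ?thesis using top by (simp add: ennreal_top_mult)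
qed

lemma conjugate_exponent_cases:
  assumes q: "1 \<le> q" and conj: "1 / ennreal q + 1 / q' = 1"
  obtains "q = 1" "q' = \<infinity>" | s where "1 < q" "s = q / (q - 1)" "q' = ennreal s"
proof -
  have q1: "1 / ennreal q = ennreal (1 / q)" using divide_ennreal[of 1 q] q by simp
  show thesis
  proof (cases q')
    case top
    with conj q1 have "ennreal (1 / q) = 1" by simp
    then have "q = 1" by simp
    with top show thesis by (intro that(1)) auto
  next
    case (real s)
    have "s \<noteq> 0"
    proof
      assume "s = 0"
      then have "1 / q' = top" using real by (simp add: ennreal_divide_eq_top_iff)
      with conj show False by simp
    qed
    with real have s: "0 < s" by simp
    then have "1 / q' = ennreal (1 / s)" using divide_ennreal[of 1 s] real by simp
    with conj q1 have "ennreal (1 / q) + ennreal (1 / s) = 1" by simp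
    then have "ennreal (1 / q + 1 / s) = 1"
      using q s by (subst ennreal_plus) auto
    then have "1 / q + 1 / s = 1" by (simp only: ennreal_eq_1)
    then have *: "q + s = q * s" using q s by (simp add: field_simps)
    have "q \<noteq> 1" using * by auto
    with q have "1 < q" by simp
    moreover have "s = q / (q - 1)" using * \<open>1 < q\<close> by (simp add: field_simps)
    ultimately show thesis using real by (intro that(2)) auto
  qed
qed

text \<open>
  This lets monotone convergence run along a countable subset of an arbitrary set of heights.
\<close>

lemma exists_cofinal_sequence:
  fixes T :: "real set"
  assumes "T \<noteq> {}"
  obtains t :: "nat \<Rightarrow> real" where "incseq t" "\<And>n. t n \<in> T" "\<And>s. s \<in> T \<Longrightarrow> \<exists>n. s \<le> t n"
proof (cases "\<exists>u\<in>T. \<forall>s\<in>T. s \<le> u")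
  case True
  then obtain u where "u \<in> T" "\<forall>s\<in>T. s \<le> u" by blast
  then show thesis by (intro that[of "\<lambda>_. u"]) auto
next
  case False
  obtain f :: "nat \<Rightarrow> ereal" where f: "incseq f" "range f \<subseteq> ereal ` T" "Sup (ereal ` T) = (SUP i. f i)"
    using Sup_countable_SUP[of "ereal ` T"] assms by auto
  then have "\<forall>n. \<exists>t\<in>T. f n = ereal t" by auto
  then obtain t where t: "\<And>n. t n \<in> T" "\<And>n. f n = ereal (t n)" by metis
  show thesis
  proof
    show "incseq t" using f(1) t(2) by (auto simp: incseq_def)
    show "t n \<in> T" for n by (rule t)
    \<comment> \<open>As \<open>T\<close> has no greatest element, every element lies strictly below the supremum.\<close>
    fix s assume "s \<in> T"
    with False obtain s' where s': "s' \<in> T" "s < s'" by force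
    then have "ereal s' \<le> (SUP i. f i)" unfolding f(3)[symmetric] by (intro Sup_upper) auto
    with s'(2) have "ereal s < (SUP i. f i)" by (meson ereal_less_eq(3) less_le_trans less_ereal.simps(1))
    then obtain n where "ereal s < f n" by (auto simp: less_SUP_iff)
    then show "\<exists>n. s \<le> t n" using t(2) by (intro exI[of _ n]) auto
  qed
qed

section \<open>Measurability and integration over cones\<close>

text \<open>
  The weight has been absorbed into \<open>\<gamma>\<close>. Local doubling enters later, as a hypothesis of the duality
  inequality.
\<close>

locale local_tent_setting =
  fixes \<gamma> :: "'a::metric_space measure" and m :: "'a \<Rightarrow> real"
  assumes sets_\<gamma> [measurable_cong]: "sets \<gamma> = sets borel"
    and ball_pos: "0 < r \<Longrightarrow> 0 < emeasure \<gamma> (ball x r)"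
    and ball_finite: "0 < r \<Longrightarrow> emeasure \<gamma> (ball x r) < \<infinity>"
    and m_measurable [measurable]: "m \<in> borel_measurable borel"
    and m_pos: "0 < m x"
begin

lemma space_\<gamma> [simp]: "space \<gamma> = UNIV"
  using sets_eq_imp_space_eq[OF sets_\<gamma>] by simp

text \<open>
  A maximal \<open>e\<close>-separated set is a net. It is countable because the balls of radius \<open>e/2\<close> about its
  points are disjoint and have positive measure: only finitely many of them that lie in a
  given ball of finite measure can have measure above a given threshold.
\<close>

lemma exists_countable_net:
  fixes E :: "'a set"
  assumes e: "0 < e"
  shows "\<exists>S\<subseteq>E. countable S \<and> (\<forall>x\<in>E. \<exists>c\<in>S. dist x c < e)"
proof -
  define sep where "sep = {S. S \<subseteq> E \<and> (\<forall>x\<in>S. \<forall>y\<in>S. x \<noteq> y \<longrightarrow> e \<le> dist x y)}"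
  have "\<exists>S\<in>sep. \<forall>X\<in>sep. S \<subseteq> X \<longrightarrow> X = S"
  proof (rule Zorn_Lemma, rule ballI)
    fix C assume C: "C \<in> chains sep"
    show "\<Union>C \<in> sep"
      unfolding sep_def
    proof (intro CollectI conjI ballI impI)
      show "\<Union>C \<subseteq> E" using C by (auto simp: chains_def sep_def)
      fix x y assume xy: "x \<in> \<Union>C" "y \<in> \<Union>C" "x \<noteq> y"
      then obtain X where "X \<in> C" "x \<in> X" "y \<in> X"
        using C unfolding chains_def chain_subset_def by blast
      then show "e \<le> dist x y" using C xy by (auto simp: chains_def sep_def)
    qed
  qed
  then obtain S where S: "S \<in> sep" and maximal: "\<And>X. X \<in> sep \<Longrightarrow> S \<subseteq> X \<Longrightarrow> X = S" by blast
  have net: "\<exists>c\<in>S. dist x c < e" if "x \<in> E" for x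
  proof (rule ccontr)
    assume "\<not> ?thesis"
    then have far: "\<And>c. c \<in> S \<Longrightarrow> e \<le> dist x c" by force
    then have "insert x S \<in> sep" using S that by (auto simp: sep_def dist_commute)
    then have "x \<in> S" using maximal by blast
    then show False using far e by fastforce
  qed
  have fin: "finite {c \<in> S. dist x0 c < real n \<and> 1 / real (Suc k) < measure \<gamma> (ball c (e/2))}" (is "finite ?F")
    for x0 n k
  proof (rule ccontr)
    assume inf: "infinite ?F"
    define V where "V = measure \<gamma> (ball x0 (real n + e))"
    have fin_big: "emeasure \<gamma> (ball x0 (real n + e)) < \<infinity>"
      using e by (intro ball_finite) simp
    obtain B where B: "finite B" "card B = nat \<lceil>V * real (Suc k)\<rceil> + 1" "B \<subseteq> ?F"
      using infinite_arbitrarily_large[OF inf] by blast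
    have "real (card B) * (1 / real (Suc k)) \<le> (\<Sum>c\<in>B. measure \<gamma> (ball c (e/2)))"
      using B(3) by (intro sum_bounded_below) (auto intro: less_imp_le)
    also have "\<dots> = measure \<gamma> (\<Union>c\<in>B. ball c (e/2))"
    proof (rule measure_finite_Union[symmetric])
      show "disjoint_family_on (\<lambda>c. ball c (e / 2)) B"
        unfolding disjoint_family_on_def
      proof (intro ballI impI)
        fix c d assume "c \<in> B" "d \<in> B" "c \<noteq> d"
        then have "e \<le> dist c d" using B(3) S by (auto simp: sep_def)
        then show "ball c (e / 2) \<inter> ball d (e / 2) = {}"
          by (intro disjoint_ballI) simp
      qed
      show "emeasure \<gamma> (ball i (e / 2)) \<noteq> \<infinity>" for i
        using ball_finite[of "e/2" i] e by simp
    qed (use B sets_\<gamma> in auto)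
    also have "\<dots> \<le> V"
      unfolding V_def
    proof (rule measure_mono_fmeasurable)
      show "(\<Union>c\<in>B. ball c (e / 2)) \<subseteq> ball x0 (real n + e)"
      proof (rule UN_least, rule subsetI)
        fix c y assume "c \<in> B" "y \<in> ball c (e/2)"
        then have "dist x0 c < real n" "dist c y < e/2" using B(3) by auto
        then show "y \<in> ball x0 (real n + e)"
          using dist_triangle[of x0 y c] e by simp
      qed
    qed (use B sets_\<gamma> fin_big in \<open>auto simp: fmeasurable_def\<close>)
    finally have "real (card B) \<le> V * real (Suc k)" by (simp add: field_simps)
    moreover have "V * real (Suc k) < real (card B)" using B(2) by linarith
    ultimately show False by simp
  qed
  have "countable S"
  proof (cases "S = {}")
    case False
    then obtain x0 where "x0 \<in> S" by blast
    have "S \<subseteq> (\<Union>n k. {c \<in> S. dist x0 c < real n \<and> 1 / real (Suc k) < measure \<gamma> (ball c (e/2))})"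
    proof
      fix c assume "c \<in> S"
      have "0 < measure \<gamma> (ball c (e/2))"
        using ball_pos[of "e/2" c] ball_finite[of "e/2" c] e
        by (auto simp: measure_def enn2real_positive_iff)
      then obtain k where "1 / real (Suc k) < measure \<gamma> (ball c (e/2))"
        using nat_approx_posE by blast
      moreover obtain n where "dist x0 c < real n" using reals_Archimedean2 by blast
      ultimately show "c \<in> (\<Union>n k. {c \<in> S. dist x0 c < real n \<and> 1 / real (Suc k) < measure \<gamma> (ball c (e/2))})"
        using \<open>c \<in> S\<close> by blast
    qed
    then show ?thesis
      by (rule countable_subset) (use countable_finite[OF fin] in blast)
  qed auto
  with net S show ?thesis by (auto simp: sep_def)
qed

lemma exists_countable_dense:
  obtains S :: "'a set" where "countable S" "S \<noteq> {}" "\<And>x e. 0 < e \<Longrightarrow> \<exists>c\<in>S. dist x c < e"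
proof -
  have "\<exists>S. countable S \<and> (\<forall>x::'a. \<exists>c\<in>S. dist x c < 1 / real (Suc n))" for n
    using exists_countable_net[of "1 / real (Suc n)" UNIV] by auto
  then obtain S :: "nat \<Rightarrow> 'a set" where S: "\<And>n. countable (S n)"
    "\<And>n x. \<exists>c\<in>S n. dist x c < 1 / real (Suc n)" by metis
  show thesis
  proof
    show "countable (\<Union>n. S n)" using S(1) by blast
    show "(\<Union>n. S n) \<noteq> {}" using S(2) by blast
    fix x :: 'a and e :: real assume "0 < e"
    then obtain n where "1 / real (Suc n) < e" using nat_approx_posE by blast
    then show "\<exists>c\<in>\<Union>n. S n. dist x c < e"
      using S(2)[of n x] by (auto intro: less_trans)
  qed
qed

text \<open>
  The product of the Borel \<open>\<sigma>\<close>-algebras of two metric spaces need not contain all open sets, so continuity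
  of the distance does not suffice. Instead, by separability, the distance is a countable infimum of sums of functions of one variable.
\<close>

lemma measurable_dist_pair [measurable (raw)]:
  fixes f g :: "'b \<Rightarrow> 'a"
  assumes [measurable]: "f \<in> measurable M borel" "g \<in> measurable M borel"
  shows "(\<lambda>x. dist (f x) (g x)) \<in> borel_measurable M"
proof -
  obtain S :: "'a set" where S: "countable S" "S \<noteq> {}" "\<And>x e. 0 < e \<Longrightarrow> \<exists>c\<in>S. dist x c < e"
    using exists_countable_dense by blast
  have bdd: "bdd_below ((\<lambda>c. dist x c + dist c y) ` S)" for x y
    by (rule bdd_belowI2[of _ 0]) simp
  have eq: "dist x y = (INF c\<in>S. dist x c + dist c y)" for x y :: 'a
  proof (rule antisym)
    show "dist x y \<le> (INF c\<in>S. dist x c + dist c y)"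
      using S(2) by (rule cINF_greatest) (rule dist_triangle)
    show "(INF c\<in>S. dist x c + dist c y) \<le> dist x y"
    proof (rule field_le_epsilon)
      fix e :: real assume "0 < e"
      then obtain c where c: "c \<in> S" "dist x c < e / 2" using S(3)[of "e/2"] by auto
      have "(INF c\<in>S. dist x c + dist c y) \<le> dist x c + dist c y"
        using c(1) by (rule cINF_lower[OF bdd])
      also have "\<dots> \<le> dist x y + e"
        using dist_triangle[of c y x] c(2) by (simp add: dist_commute)
      finally show "(INF c\<in>S. dist x c + dist c y) \<le> dist x y + e" .
    qed
  qed
  have 1: "(\<lambda>x. dist (f x) c) \<in> borel_measurable M" for c
    by (rule measurable_compose[OF assms(1)]) (intro borel_measurable_continuous_onI continuous_intros)
  have 2: "(\<lambda>x. dist c (g x)) \<in> borel_measurable M" for c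
    by (rule measurable_compose[OF assms(2)]) (intro borel_measurable_continuous_onI continuous_intros)
  have "(\<lambda>x. dist (f x) (g x)) = (\<lambda>x. INF c\<in>S. dist (f x) c + dist c (g x))"
    by (rule ext) (rule eq)
  moreover have "\<dots> \<in> borel_measurable M"
    by (rule borel_measurable_cINF_real[OF S(1)]) (intro borel_measurable_add 1 2)
  ultimately show ?thesis by simp
qed

lemma sigma_finite_\<gamma>: "sigma_finite_measure \<gamma>"
proof
  fix x0 :: 'a
  show "\<exists>A. countable A \<and> A \<subseteq> sets \<gamma> \<and> \<Union> A = space \<gamma> \<and> (\<forall>a\<in>A. emeasure \<gamma> a \<noteq> \<infinity>)"
  proof (intro exI conjI)
    show "\<Union> (range (\<lambda>n. ball x0 (real (Suc n)))) = space \<gamma>"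
    proof -
      have "\<exists>n. dist x0 y < real (Suc n)" for y
      proof -
        obtain n where "dist x0 y < real n" using reals_Archimedean2 by blast
        then show ?thesis by (intro exI[of _ n]) simp
      qed
      then show ?thesis by (auto simp del: of_nat_Suc)
    qed
    show "\<forall>a\<in>range (\<lambda>n. ball x0 (real (Suc n))). emeasure \<gamma> a \<noteq> \<infinity>"
    proof
      fix a assume "a \<in> range (\<lambda>n. ball x0 (real (Suc n)))"
      then obtain n where "a = ball x0 (real (Suc n))" by blast
      then show "emeasure \<gamma> a \<noteq> \<infinity>" using ball_finite[of "real (Suc n)" x0] by simp
    qed
  qed (simp_all add: sets_\<gamma> image_subset_iff)
qed

abbreviation D :: "('a \<times> real) set" where "D \<equiv> admissible_region m"
abbreviation R :: "('a \<times> real) measure" where "R \<equiv> region_measure \<gamma> m"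

definition dt_over_t :: "real measure" where
  "dt_over_t = density lborel (\<lambda>t. ennreal (1 / t))"

lemma sets_dt_over_t [measurable_cong]: "sets dt_over_t = sets borel"
  by (simp add: dt_over_t_def)

lemma sigma_finite_dt_over_t: "sigma_finite_measure dt_over_t"
  unfolding dt_over_t_def by (subst sigma_finite_measure.sigma_finite_iff_density_finite[OF sigma_finite_lborel]) simp_all

lemma D_measurable [measurable]: "D \<in> sets (\<gamma> \<Otimes>\<^sub>M dt_over_t)"
proof -
  have "D = {p \<in> space (\<gamma> \<Otimes>\<^sub>M dt_over_t). 0 < snd p \<and> snd p < m (fst p)}"
    by (auto simp: admissible_region_def space_pair_measure dt_over_t_def)
  also have "\<dots> \<in> sets (\<gamma> \<Otimes>\<^sub>M dt_over_t)"
    by measurable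
  finally show ?thesis .
qed

lemma R_eq: "R = restrict_space (\<gamma> \<Otimes>\<^sub>M dt_over_t) D"
  by (simp add: region_measure_def dt_over_t_def)

lemma space_R [simp]: "space R = D"
  by (auto simp: R_eq space_restrict_space space_pair_measure dt_over_t_def)

lemma sigma_finite_R: "sigma_finite_measure R"
proof -
  interpret pair_sigma_finite \<gamma> dt_over_t
    by (intro pair_sigma_finite.intro sigma_finite_\<gamma> sigma_finite_dt_over_t)
  show ?thesis
    unfolding R_eq
    by (intro sigma_finite_measure_restrict_space D_measurable) unfold_locales
qed

lemma measurable_fst_R [measurable]: "fst \<in> measurable R borel"
proof -
  have "fst \<in> measurable (\<gamma> \<Otimes>\<^sub>M dt_over_t) borel" by measurable
  then show ?thesis unfolding R_eq by (rule measurable_restrict_space1)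
qed

lemma measurable_snd_R [measurable]: "snd \<in> measurable R borel"
proof -
  have "snd \<in> measurable (\<gamma> \<Otimes>\<^sub>M dt_over_t) borel" by measurable
  then show ?thesis unfolding R_eq by (rule measurable_restrict_space1)
qed

lemma D_iff: "p \<in> D \<longleftrightarrow> 0 < snd p \<and> snd p < m (fst p)"
  by (auto simp: admissible_region_def)

text \<open>
  The indicator of \<open>p \<in> \<Gamma>(x)\<close> for \<open>p \<in> D\<close>, written as a function that is jointly measurable and makes
  sense in \<open>x\<close> for every \<open>p\<close>.
\<close>

definition \<kappa> :: "'a \<Rightarrow> 'a \<times> real \<Rightarrow> ennreal" where
  "\<kappa> x p = (if dist x (fst p) < snd p then 1 else 0)"

lemma measurable_\<kappa> [measurable (raw)]:
  assumes [measurable]: "f \<in> measurable M borel" "g \<in> measurable M R"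
  shows "(\<lambda>z. \<kappa> (f z) (g z)) \<in> borel_measurable M"
  unfolding \<kappa>_def by measurable

lemma measurable_\<kappa>_centre [measurable]: "(\<lambda>x. \<kappa> x p) \<in> borel_measurable \<gamma>"
  unfolding \<kappa>_def by measurable

lemma cone_indicator: "p \<in> D \<Longrightarrow> indicator (admissible_cone m x) p = \<kappa> x p"
  by (cases p) (auto simp: admissible_cone_def \<kappa>_def)

definition vol :: "'a \<times> real \<Rightarrow> ennreal" where
  "vol p = emeasure \<gamma> (ball (fst p) (snd p))"

lemma nn_integral_\<kappa>: "(\<integral>\<^sup>+x. \<kappa> x p \<partial>\<gamma>) = vol p"
proof -
  have "(\<integral>\<^sup>+x. \<kappa> x p \<partial>\<gamma>) = (\<integral>\<^sup>+x. indicator (ball (fst p) (snd p)) x \<partial>\<gamma>)"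
    by (intro nn_integral_cong) (auto simp: \<kappa>_def dist_commute)
  also have "\<dots> = vol p"
    unfolding vol_def by (intro nn_integral_indicator) (simp add: sets_\<gamma>)
  finally show ?thesis .
qed

lemma vol_pos: "p \<in> D \<Longrightarrow> 0 < vol p"
  and vol_finite: "p \<in> D \<Longrightarrow> vol p < top"
  using ball_pos[of "snd p" "fst p"] ball_finite[of "snd p" "fst p"] by (auto simp: D_iff vol_def)

lemma vol_cancel: "p \<in> D \<Longrightarrow> a / vol p * vol p = a"
  using vol_pos[of p] vol_finite[of p]
  by (simp add: ennreal_divide_times ennreal_divide_self)

lemma measurable_vol [measurable]: "vol \<in> borel_measurable R"
proof -
  interpret sigma_finite_measure \<gamma> by (rule sigma_finite_\<gamma>)
  have "(\<lambda>p. \<integral>\<^sup>+x. \<kappa> x p \<partial>\<gamma>) \<in> borel_measurable R" by measurable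
  then show ?thesis by (simp add: nn_integral_\<kappa>)
qed

lemma tonelli_\<gamma>_R:
  assumes "(\<lambda>(x, p). F x p) \<in> borel_measurable (\<gamma> \<Otimes>\<^sub>M R)"
  shows "(\<integral>\<^sup>+x. \<integral>\<^sup>+p. F x p \<partial>R \<partial>\<gamma>) = (\<integral>\<^sup>+p. \<integral>\<^sup>+x. F x p \<partial>\<gamma> \<partial>R)"
proof -
  interpret pair_sigma_finite \<gamma> R
    by (intro pair_sigma_finite.intro sigma_finite_\<gamma> sigma_finite_R)
  show ?thesis using Fubini'[OF assms] by simp
qed

definition cone_int :: "('a \<times> real \<Rightarrow> ennreal) \<Rightarrow> 'a \<Rightarrow> ennreal" where
  "cone_int F x = (\<integral>\<^sup>+p. F p / vol p * \<kappa> x p \<partial>R)"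

lemma measurable_cone_int [measurable]:
  assumes [measurable]: "F \<in> borel_measurable R"
  shows "cone_int F \<in> borel_measurable \<gamma>"
proof -
  interpret sigma_finite_measure R by (rule sigma_finite_R)
  have "(\<lambda>x. \<integral>\<^sup>+p. F p / vol p * \<kappa> x p \<partial>R) \<in> borel_measurable \<gamma>" by measurable
  then show ?thesis by (simp add: cone_int_def[abs_def])
qed

lemma area_functional_eq:
  "area_functional \<gamma> m q f x = ennreal_powr (cone_int (\<lambda>p. ennreal (cmod (f p) powr q)) x) (1 / q)"
  unfolding area_functional_def cone_int_def
  by (intro arg_cong2[where f = ennreal_powr] nn_integral_cong refl)
    (simp add: cone_indicator vol_def)

lemma measurable_area_functional [measurable]:
  assumes [measurable]: "f \<in> borel_measurable R"
  shows "area_functional \<gamma> m q f \<in> borel_measurable \<gamma>"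
proof -
  have "(\<lambda>x. ennreal_powr (cone_int (\<lambda>p. ennreal (cmod (f p) powr q)) x) (1 / q)) \<in> borel_measurable \<gamma>"
    by measurable
  then show ?thesis by (simp add: area_functional_eq[abs_def])
qed

text \<open>
  The weight \<open>k\<close> may depend on both the vertex and the point; it will be an indicator selecting
  a part of each cone, or a function of the vertex alone.
\<close>

lemma nn_integral_cone_int_weighted:
  assumes [measurable]: "F \<in> borel_measurable R" "(\<lambda>(x, p). k x p) \<in> borel_measurable (\<gamma> \<Otimes>\<^sub>M R)"
  shows "(\<integral>\<^sup>+x. \<integral>\<^sup>+p. F p / vol p * \<kappa> x p * k x p \<partial>R \<partial>\<gamma>)
         = (\<integral>\<^sup>+p. F p / vol p * (\<integral>\<^sup>+x. \<kappa> x p * k x p \<partial>\<gamma>) \<partial>R)"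
proof -
  have "(\<integral>\<^sup>+x. \<integral>\<^sup>+p. F p / vol p * \<kappa> x p * k x p \<partial>R \<partial>\<gamma>)
        = (\<integral>\<^sup>+p. \<integral>\<^sup>+x. F p / vol p * \<kappa> x p * k x p \<partial>\<gamma> \<partial>R)"
    by (rule tonelli_\<gamma>_R) measurable
  also have "\<dots> = (\<integral>\<^sup>+p. F p / vol p * (\<integral>\<^sup>+x. \<kappa> x p * k x p \<partial>\<gamma>) \<partial>R)"
    by (intro nn_integral_cong) (simp add: mult.assoc nn_integral_cmult)
  finally show ?thesis .
qed

lemma nn_integral_cone_int:
  assumes [measurable]: "F \<in> borel_measurable R"
  shows "(\<integral>\<^sup>+x. cone_int F x \<partial>\<gamma>) = (\<integral>\<^sup>+p. F p \<partial>R)"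
proof -
  have "(\<integral>\<^sup>+x. cone_int F x \<partial>\<gamma>) = (\<integral>\<^sup>+p. F p / vol p * (\<integral>\<^sup>+x. \<kappa> x p * 1 \<partial>\<gamma>) \<partial>R)"
    unfolding cone_int_def
    by (subst nn_integral_cone_int_weighted[symmetric]) auto
  also have "\<dots> = (\<integral>\<^sup>+p. F p \<partial>R)"
    by (intro nn_integral_cong) (simp add: nn_integral_\<kappa> vol_cancel)
  finally show ?thesis .
qed

section \<open>The space of functions with integrable area functional\<close>

text \<open>
  The \<open>q\<close>-th power of the area functional.
\<close>

abbreviation area_power :: "real \<Rightarrow> ('a \<times> real \<Rightarrow> complex) \<Rightarrow> 'a \<Rightarrow> ennreal" where
  "area_power q f \<equiv> cone_int (\<lambda>p. ennreal (cmod (f p) powr q))"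

lemma cone_int_mono:
  assumes "\<And>p. p \<in> D \<Longrightarrow> F p \<le> G p"
  shows "cone_int F x \<le> cone_int G x"
  unfolding cone_int_def
  by (intro nn_integral_mono mult_right_mono divide_right_mono_ennreal) (use assms in auto)

lemma cone_int_cmult:
  assumes [measurable]: "F \<in> borel_measurable R"
  shows "cone_int (\<lambda>p. c * F p) x = c * cone_int F x"
  unfolding cone_int_def
  by (subst nn_integral_cmult[symmetric]) (auto simp: divide_ennreal_def mult_ac intro!: nn_integral_cong)

lemma cone_int_add:
  assumes [measurable]: "F \<in> borel_measurable R" "G \<in> borel_measurable R"
  shows "cone_int (\<lambda>p. F p + G p) x = cone_int F x + cone_int G x"
  unfolding cone_int_def
  by (subst nn_integral_add[symmetric]) (auto simp: divide_ennreal_def distrib_right)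

lemma tent_norm_1_mono:
  assumes "0 < q" "\<And>p. p \<in> D \<Longrightarrow> cmod (f p) \<le> cmod (h p)"
  shows "tent_norm_1 \<gamma> m q f \<le> tent_norm_1 \<gamma> m q h"
  unfolding tent_norm_1_def area_functional_eq using assms
  by (intro nn_integral_mono ennreal_powr_mono cone_int_mono ennreal_leI powr_mono2) auto

lemma tent_norm_1_AE_0:
  assumes [measurable]: "f \<in> borel_measurable R" and "AE p in R. f p = 0"
  shows "tent_norm_1 \<gamma> m q f = 0"
proof -
  have "area_power q f x = 0" for x
  proof -
    have "AE p in R. ennreal (cmod (f p) powr q) / vol p * \<kappa> x p = 0"
      using assms(2) by eventually_elim simp
    then show ?thesis
      unfolding cone_int_def by (subst nn_integral_0_iff_AE) auto
  qed
  then show ?thesis by (simp add: tent_norm_1_def area_functional_eq)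
qed

lemma tent_norm_1_cmult:
  assumes [measurable]: "f \<in> borel_measurable R" and q: "0 < q"
  shows "tent_norm_1 \<gamma> m q (\<lambda>p. a * f p) = ennreal (cmod a) * tent_norm_1 \<gamma> m q f"
proof -
  have "area_functional \<gamma> m q (\<lambda>p. a * f p) x = ennreal (cmod a) * area_functional \<gamma> m q f x" for x
  proof -
    have "area_power q (\<lambda>p. a * f p) x = ennreal (cmod a powr q) * area_power q f x"
      by (subst cone_int_cmult[symmetric]) (auto simp: norm_mult powr_mult ennreal_mult)
    then show ?thesis
      using q by (simp add: area_functional_eq ennreal_powr_cmult powr_powr)
  qed
  then have "tent_norm_1 \<gamma> m q (\<lambda>p. a * f p) = (\<integral>\<^sup>+x. ennreal (cmod a) * area_functional \<gamma> m q f x \<partial>\<gamma>)"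
    unfolding tent_norm_1_def by (intro nn_integral_cong)
  then show ?thesis by (simp add: tent_norm_1_def nn_integral_cmult)
qed

text \<open>
  Only finiteness of the left-hand side matters for \<open>t\<^bsup>1,q\<^esup>\<close> to be a vector space, so Minkowski's
  inequality is replaced by the cruder \<open>|f + h| \<le> 2 max(|f|, |h|)\<close>.
\<close>

lemma tent_norm_1_add:
  assumes [measurable]: "f \<in> borel_measurable R" "h \<in> borel_measurable R" and q: "1 \<le> q"
  shows "tent_norm_1 \<gamma> m q (\<lambda>p. f p + h p) \<le> 4 * (tent_norm_1 \<gamma> m q f + tent_norm_1 \<gamma> m q h)"
proof -
  have pt: "cmod (f p + h p) powr q \<le> 2 powr q * (cmod (f p) powr q + cmod (h p) powr q)" for p
  proof -
    have "cmod (f p + h p) \<le> 2 * max (cmod (f p)) (cmod (h p))"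
      using norm_triangle_ineq[of "f p" "h p"] by simp
    then have "cmod (f p + h p) powr q \<le> (2 * max (cmod (f p)) (cmod (h p))) powr q"
      using q by (intro powr_mono2) auto
    also have "\<dots> = 2 powr q * max (cmod (f p)) (cmod (h p)) powr q"
      by (simp add: powr_mult)
    also have "\<dots> \<le> 2 powr q * (cmod (f p) powr q + cmod (h p) powr q)"
      by (intro mult_left_mono) (auto simp: max_def)
    finally show ?thesis .
  qed
  have "area_functional \<gamma> m q (\<lambda>p. f p + h p) x
        \<le> 4 * (area_functional \<gamma> m q f x + area_functional \<gamma> m q h x)" for x
  proof -
    have "area_power q (\<lambda>p. f p + h p) x
          \<le> cone_int (\<lambda>p. ennreal (2 powr q) * (ennreal (cmod (f p) powr q) + ennreal (cmod (h p) powr q))) x"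
      using pt by (intro cone_int_mono) (simp add: ennreal_leI flip: ennreal_mult ennreal_plus)
    also have "\<dots> = ennreal (2 powr q) * (area_power q f x + area_power q h x)"
      by (simp add: cone_int_cmult cone_int_add)
    finally have "area_functional \<gamma> m q (\<lambda>p. f p + h p) x
        \<le> ennreal_powr (ennreal (2 powr q) * (area_power q f x + area_power q h x)) (1 / q)"
      unfolding area_functional_eq using q by (intro ennreal_powr_mono) auto
    also have "\<dots> = 2 * ennreal_powr (area_power q f x + area_power q h x) (1 / q)"
      using q by (subst ennreal_powr_cmult) (auto simp: powr_powr)
    also have "\<dots> \<le> 2 * (2 * (area_functional \<gamma> m q f x + area_functional \<gamma> m q h x))"
      unfolding area_functional_eq using q by (intro mult_left_mono ennreal_powr_add_le) auto
    finally show ?thesis by (simp flip: mult.assoc)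
  qed
  then have "tent_norm_1 \<gamma> m q (\<lambda>p. f p + h p)
      \<le> (\<integral>\<^sup>+x. 4 * (area_functional \<gamma> m q f x + area_functional \<gamma> m q h x) \<partial>\<gamma>)"
    unfolding tent_norm_1_def by (intro nn_integral_mono) auto
  also have "\<dots> = 4 * (tent_norm_1 \<gamma> m q f + tent_norm_1 \<gamma> m q h)"
    unfolding tent_norm_1_def by (simp add: nn_integral_cmult nn_integral_add)
  finally show ?thesis .
qed

lemma tent_space_1_add:
  assumes "1 \<le> q" "f \<in> tent_space_1 \<gamma> m q" "h \<in> tent_space_1 \<gamma> m q"
  shows "(\<lambda>p. f p + h p) \<in> tent_space_1 \<gamma> m q"
proof -
  have "4 * (tent_norm_1 \<gamma> m q f + tent_norm_1 \<gamma> m q h) < \<infinity>"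
    using assms by (auto simp: tent_space_1_def ennreal_mult_less_top)
  with tent_norm_1_add[of f h q] assms show ?thesis
    by (auto simp: tent_space_1_def intro: le_less_trans)
qed

lemma tent_space_1_cmult:
  assumes "1 \<le> q" "f \<in> tent_space_1 \<gamma> m q"
  shows "(\<lambda>p. a * f p) \<in> tent_space_1 \<gamma> m q"
  using assms by (auto simp: tent_space_1_def tent_norm_1_cmult ennreal_mult_less_top)

lemma tent_space_1_ideal:
  assumes "1 \<le> q" "h \<in> tent_space_1 \<gamma> m q" "f \<in> borel_measurable R"
    and "\<And>p. p \<in> D \<Longrightarrow> cmod (f p) \<le> cmod (h p)"
  shows "f \<in> tent_space_1 \<gamma> m q"
proof -
  have "tent_norm_1 \<gamma> m q f \<le> tent_norm_1 \<gamma> m q h"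
    by (rule tent_norm_1_mono) (use assms in auto)
  with assms show ?thesis by (auto simp: tent_space_1_def intro: le_less_trans)
qed

text \<open>
  Order continuity of the norm: dominated convergence in almost every cone, then over the vertices.
\<close>

lemma tent_norm_1_tendsto_0:
  assumes q: "1 \<le> q" and h: "h \<in> tent_space_1 \<gamma> m q"
    and [measurable]: "\<And>n. u n \<in> borel_measurable R"
    and dominated: "\<And>n p. p \<in> D \<Longrightarrow> cmod (u n p) \<le> cmod (h p)"
    and lim: "\<And>p. p \<in> D \<Longrightarrow> (\<lambda>n. u n p) \<longlonglongrightarrow> 0"
  shows "(\<lambda>n. tent_norm_1 \<gamma> m q (u n)) \<longlonglongrightarrow> 0"
proof -
  have [measurable]: "h \<in> borel_measurable R" and finite: "tent_norm_1 \<gamma> m q h < \<infinity>"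
    using h by (auto simp: tent_space_1_def)
  have "AE x in \<gamma>. area_functional \<gamma> m q h x \<noteq> \<infinity>"
    by (rule nn_integral_noteq_infinite) (use finite in \<open>auto simp: tent_norm_1_def\<close>)
  then have area_lim: "AE x in \<gamma>. (\<lambda>n. area_functional \<gamma> m q (u n) x) \<longlonglongrightarrow> 0"
  proof eventually_elim
    fix x assume "area_functional \<gamma> m q h x \<noteq> \<infinity>"
    then have power_finite: "area_power q h x < \<infinity>"
      by (simp add: area_functional_eq ennreal_powr_eq_top_iff top.not_eq_extremum)
    have power_le: "area_power q (u n) x \<le> area_power q h x" for n
      using dominated q by (intro cone_int_mono ennreal_leI powr_mono2) auto
    have "(\<lambda>n. area_power q (u n) x) \<longlonglongrightarrow> (\<integral>\<^sup>+p. 0 \<partial>R)"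
      unfolding cone_int_def
    proof (rule nn_integral_dominated_convergence[where w = "\<lambda>p. ennreal (cmod (h p) powr q) / vol p * \<kappa> x p"])
      show "AE p in R. ennreal (cmod (u j p) powr q) / vol p * \<kappa> x p
              \<le> ennreal (cmod (h p) powr q) / vol p * \<kappa> x p" for j
        using dominated q
        by (intro AE_I2 mult_right_mono divide_right_mono_ennreal ennreal_leI powr_mono2) auto
      show "AE p in R. (\<lambda>n. ennreal (cmod (u n p) powr q) / vol p * \<kappa> x p) \<longlonglongrightarrow> 0"
      proof (rule AE_I2)
        fix p assume "p \<in> space R"
        then have p: "p \<in> D" by simp
        have "(\<lambda>n. cmod (u n p) powr q) \<longlonglongrightarrow> 0"
          using q tendsto_norm_zero[OF lim[OF p]] by (intro tendsto_zero_powrI[where b = q]) auto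
        then have "(\<lambda>n. ennreal (cmod (u n p) powr q)) \<longlonglongrightarrow> 0"
          using tendsto_ennrealI by fastforce
        moreover have "\<kappa> x p / vol p < top"
          using vol_pos[OF p] by (auto simp: \<kappa>_def ennreal_divide_eq_top_iff less_top[symmetric])
        ultimately have "(\<lambda>n. \<kappa> x p / vol p * ennreal (cmod (u n p) powr q)) \<longlonglongrightarrow> \<kappa> x p / vol p * 0"
          by (intro tendsto_mult_ennreal tendsto_const) auto
        then show "(\<lambda>n. ennreal (cmod (u n p) powr q) / vol p * \<kappa> x p) \<longlonglongrightarrow> 0"
          by (simp add: divide_ennreal_def mult_ac)
      qed
      show "(\<integral>\<^sup>+p. ennreal (cmod (h p) powr q) / vol p * \<kappa> x p \<partial>R) < \<infinity>"
        using power_finite by (simp add: cone_int_def)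
    qed measurable
    then have "(\<lambda>n. area_power q (u n) x) \<longlonglongrightarrow> ennreal 0" by simp
    then have "(\<lambda>n. enn2real (area_power q (u n) x)) \<longlonglongrightarrow> 0"
      by (rule tendsto_enn2real) simp
    then have "(\<lambda>n. enn2real (area_power q (u n) x) powr (1 / q)) \<longlonglongrightarrow> 0"
      using q by (intro tendsto_zero_powrI[where b = "1 / q"]) auto
    then have "(\<lambda>n. ennreal (enn2real (area_power q (u n) x) powr (1 / q))) \<longlonglongrightarrow> 0"
      using tendsto_ennrealI by fastforce
    moreover have "area_functional \<gamma> m q (u n) x = ennreal (enn2real (area_power q (u n) x) powr (1 / q))" for n
      using le_less_trans[OF power_le power_finite, THEN less_imp_neq]
      by (simp add: area_functional_eq ennreal_powr_def)
    ultimately show "(\<lambda>n. area_functional \<gamma> m q (u n) x) \<longlonglongrightarrow> 0" by simp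
  qed
  have "(\<lambda>n. tent_norm_1 \<gamma> m q (u n)) \<longlonglongrightarrow> (\<integral>\<^sup>+x. 0 \<partial>\<gamma>)"
    unfolding tent_norm_1_def
  proof (rule nn_integral_dominated_convergence[where w = "area_functional \<gamma> m q h"])
    show "AE x in \<gamma>. area_functional \<gamma> m q (u j) x \<le> area_functional \<gamma> m q h x" for j
      unfolding area_functional_eq using dominated q
      by (intro AE_I2 ennreal_powr_mono cone_int_mono ennreal_leI powr_mono2) auto
  qed (use finite area_lim in \<open>auto simp: tent_norm_1_def\<close>)
  then show ?thesis by simp
qed

text \<open>
  Obtained by integrating the linear bound on \<open>a\<^bsup>1/q\<^esup>\<close> against the vertices. The weight \<open>v\<close> must be positive
  wherever the area functional is, which allows \<open>v\<close> to be localised when \<open>f\<close> is.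
\<close>

lemma tent_norm_1_le_weighted:
  fixes v :: "'a \<Rightarrow> real"
  assumes [measurable]: "f \<in> borel_measurable R" "v \<in> borel_measurable \<gamma>"
    and q: "1 \<le> q" and v: "\<And>x. 0 \<le> v x"
    and supp: "\<And>x p. p \<in> D \<Longrightarrow> f p \<noteq> 0 \<Longrightarrow> dist x (fst p) < snd p \<Longrightarrow> 0 < v x"
  shows "tent_norm_1 \<gamma> m q f \<le> (\<integral>\<^sup>+x. ennreal (v x) \<partial>\<gamma>) +
    (\<integral>\<^sup>+p. ennreal (cmod (f p) powr q) / vol p * (\<integral>\<^sup>+x. \<kappa> x p * ennreal (v x powr (1 - q)) \<partial>\<gamma>) \<partial>R)"
proof -
  have zero: "area_power q f x = 0" if "v x = 0" for x
  proof -
    have "(\<integral>\<^sup>+p. ennreal (cmod (f p) powr q) / vol p * \<kappa> x p \<partial>R) = (\<integral>\<^sup>+p. 0 \<partial>R)"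
    proof (rule nn_integral_cong)
      fix p assume "p \<in> space R"
      then show "ennreal (cmod (f p) powr q) / vol p * \<kappa> x p = 0"
        using supp[of p x] that by (cases "f p = 0") (auto simp: \<kappa>_def)
    qed
    then show ?thesis by (simp add: cone_int_def)
  qed
  have "tent_norm_1 \<gamma> m q f \<le> (\<integral>\<^sup>+x. ennreal (v x) + area_power q f x * ennreal (v x powr (1 - q)) \<partial>\<gamma>)"
    unfolding tent_norm_1_def area_functional_eq using zero v q
    by (intro nn_integral_mono ennreal_powr_le_linear) auto
  also have "\<dots> = (\<integral>\<^sup>+x. ennreal (v x) \<partial>\<gamma>) + (\<integral>\<^sup>+x. area_power q f x * ennreal (v x powr (1 - q)) \<partial>\<gamma>)"
    by (intro nn_integral_add) measurable
  also have "(\<integral>\<^sup>+x. area_power q f x * ennreal (v x powr (1 - q)) \<partial>\<gamma>)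
      = (\<integral>\<^sup>+x. \<integral>\<^sup>+p. ennreal (cmod (f p) powr q) / vol p * \<kappa> x p * ennreal (v x powr (1 - q)) \<partial>R \<partial>\<gamma>)"
    unfolding cone_int_def by (subst nn_integral_multc) auto
  also have "\<dots> = (\<integral>\<^sup>+p. ennreal (cmod (f p) powr q) / vol p *
                    (\<integral>\<^sup>+x. \<kappa> x p * ennreal (v x powr (1 - q)) \<partial>\<gamma>) \<partial>R)"
    by (rule nn_integral_cone_int_weighted) measurable
  finally show ?thesis .
qed

text \<open>
  The lower bound on balls makes the integrals of \<open>v\<^bsup>1-q\<^esup>\<close> over balls in the preceding bound finite. The
  weight is a sum of multiples of indicators of an increasing sequence of balls.
\<close>

lemma exists_integrable_weight:
  obtains v :: "'a \<Rightarrow> real" where "v \<in> borel_measurable \<gamma>" "\<And>x. 0 < v x"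
    "(\<integral>\<^sup>+x. ennreal (v x) \<partial>\<gamma>) < \<infinity>"
    "\<And>y r. \<exists>c>0. \<forall>x\<in>ball y r. c \<le> v x"
proof -
  fix x0 :: 'a
  define B where "B k = ball x0 (real (Suc k))" for k :: nat
  have B_sets [measurable]: "B k \<in> sets \<gamma>" for k by (simp add: B_def sets_\<gamma>)
  have B_fin: "emeasure \<gamma> (B k) = ennreal (measure \<gamma> (B k))" for k
    using ball_finite[of "real (Suc k)" x0] by (simp add: emeasure_eq_ennreal_measure B_def)
  \<comment> \<open>The denominator makes the \<open>k\<close>-th term of \<open>v\<close> have integral at most \<open>2\<^bsup>-k\<^esup>\<close>.\<close>
  define c where "c k = (1/2)^k / (1 + measure \<gamma> (B k))" for k :: nat
  have c_pos: "0 < c k" for k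
    using measure_nonneg[of \<gamma> "B k"] by (auto simp: c_def intro!: divide_pos_pos add_pos_nonneg)
  have c_le: "c k \<le> (1/2)^k" for k
    using measure_nonneg[of \<gamma> "B k"] by (simp add: c_def divide_le_eq add_pos_nonneg mult_le_cancel_left1)
  have c_meas: "c k * measure \<gamma> (B k) \<le> (1/2)^k" for k
  proof -
    have "measure \<gamma> (B k) / (1 + measure \<gamma> (B k)) \<le> 1"
      using measure_nonneg[of \<gamma> "B k"] by (simp add: divide_le_eq add_pos_nonneg)
    then have "(1/2)^k * (measure \<gamma> (B k) / (1 + measure \<gamma> (B k))) \<le> (1/2)^k * 1"
      by (intro mult_left_mono) auto
    then show ?thesis by (simp add: c_def)
  qed
  have geometric: "summable (\<lambda>k. (1/2 :: real)^k)" by (rule summable_geometric) simp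
  define v where "v x = (\<Sum>k. c k * indicator (B k) x)" for x
  have summable: "summable (\<lambda>k. c k * indicator (B k) x)" for x
    by (rule summable_comparison_test'[OF geometric, of 0])
      (use c_le c_pos in \<open>auto simp: indicator_def less_imp_le\<close>)
  have lower: "c k \<le> v x" if "x \<in> B k" for x k
  proof -
    have "(\<Sum>j\<in>{k}. c j * indicator (B j) x) \<le> v x"
      unfolding v_def using c_pos by (intro sum_le_suminf summable) (auto simp: less_imp_le)
    with that show ?thesis by simp
  qed
  have cover: "\<exists>k. ball y r \<subseteq> B k" for y r
  proof -
    obtain k where "dist x0 y + r < real k" using reals_Archimedean2 by blast
    then have "ball y r \<subseteq> B k"
      unfolding B_def using dist_triangle[of x0 _ y]
      by (intro subsetI) (force simp: mem_ball intro: le_less_trans)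
    then show ?thesis ..
  qed
  show thesis
  proof
    show "v \<in> borel_measurable \<gamma>" unfolding v_def[abs_def] by measurable
    show "0 < v x" for x
    proof -
      obtain k where "ball x 1 \<subseteq> B k" using cover by blast
      then have "x \<in> B k" by auto
      then show ?thesis using lower[of x k] c_pos[of k] by simp
    qed
    show "\<exists>c>0. \<forall>x\<in>ball y r. c \<le> v x" for y r
      using cover[of y r] lower c_pos by blast
    have "(\<integral>\<^sup>+x. ennreal (v x) \<partial>\<gamma>) = (\<integral>\<^sup>+x. (\<Sum>k. ennreal (c k * indicator (B k) x)) \<partial>\<gamma>)"
      unfolding v_def using c_pos
      by (intro nn_integral_cong suminf_ennreal2[symmetric] summable) (auto simp: less_imp_le)
    also have "\<dots> = (\<Sum>k. \<integral>\<^sup>+x. ennreal (c k * indicator (B k) x) \<partial>\<gamma>)"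
      by (intro nn_integral_suminf) measurable
    also have "\<dots> \<le> (\<Sum>k. ennreal ((1/2)^k))"
    proof (intro suminf_le summableI)
      fix k
      have "(\<integral>\<^sup>+x. ennreal (c k * indicator (B k) x) \<partial>\<gamma>) = (\<integral>\<^sup>+x. ennreal (c k) * indicator (B k) x \<partial>\<gamma>)"
        using c_pos[of k] by (intro nn_integral_cong) (simp add: ennreal_mult ennreal_indicator)
      also have "\<dots> = ennreal (c k * measure \<gamma> (B k))"
        using c_pos[of k] by (simp add: nn_integral_cmult_indicator B_fin ennreal_mult)
      also have "\<dots> \<le> ennreal ((1/2)^k)" using c_meas by (rule ennreal_leI)
      finally show "(\<integral>\<^sup>+x. ennreal (c k * indicator (B k) x) \<partial>\<gamma>) \<le> ennreal ((1/2)^k)" .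
    qed
    also have "\<dots> < \<infinity>"
      using geometric by (subst suminf_ennreal2) auto
    finally show "(\<integral>\<^sup>+x. ennreal (v x) \<partial>\<gamma>) < \<infinity>" .
  qed
qed

text \<open>
  Start from a positive function \<open>h\<close> integrable over \<open>D\<close> and let \<open>w\<^sup>q\<close> be \<open>h\<close> divided by one plus the
  average \<open>e\<close> of \<open>v\<^bsup>1-q\<^esup>\<close> over the ball of the point. This makes the second term of the weighted bound at most the
  integral of \<open>h\<close>.
\<close>

lemma exists_positive_tent_function:
  assumes q: "1 \<le> q"
  obtains w :: "'a \<times> real \<Rightarrow> real" where "w \<in> borel_measurable R" "\<And>p. 0 < w p"
    "(\<lambda>p. complex_of_real (w p)) \<in> tent_space_1 \<gamma> m q"
proof -
  interpret sigma_finite_measure R by (rule sigma_finite_R)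
  obtain h :: "'a \<times> real \<Rightarrow> real" where [measurable]: "h \<in> borel_measurable R"
    and h: "\<And>p. 0 < h p" "integrable R h"
    using obtain_positive_integrable_function by blast
  obtain v :: "'a \<Rightarrow> real" where [measurable]: "v \<in> borel_measurable \<gamma>" and v: "\<And>x. 0 < v x"
    "(\<integral>\<^sup>+x. ennreal (v x) \<partial>\<gamma>) < \<infinity>" "\<And>y r. \<exists>c>0. \<forall>x\<in>ball y r. c \<le> v x"
    using exists_integrable_weight by blast
  interpret \<gamma>: sigma_finite_measure \<gamma> by (rule sigma_finite_\<gamma>)
  define V where "V p = (\<integral>\<^sup>+x. \<kappa> x p * ennreal (v x powr (1 - q)) \<partial>\<gamma>)" for p
  have [measurable]: "V \<in> borel_measurable R" unfolding V_def[abs_def] by measurable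
  have V_finite: "V p / vol p < top" if "p \<in> D" for p
  proof -
    obtain c where c: "0 < c" "\<And>x. x \<in> ball (fst p) (snd p) \<Longrightarrow> c \<le> v x" using v(3) by blast
    have "V p \<le> (\<integral>\<^sup>+x. \<kappa> x p * ennreal (c powr (1 - q)) \<partial>\<gamma>)"
      unfolding V_def
    proof (rule nn_integral_mono)
      fix x
      show "\<kappa> x p * ennreal (v x powr (1 - q)) \<le> \<kappa> x p * ennreal (c powr (1 - q))"
      proof (cases "dist x (fst p) < snd p")
        case True
        then have "c \<le> v x" by (intro c) (simp add: dist_commute)
        then show ?thesis using c q by (intro mult_left_mono ennreal_leI powr_mono2') auto
      qed (simp add: \<kappa>_def)
    qed
    also have "\<dots> = vol p * ennreal (c powr (1 - q))"
      by (simp add: nn_integral_multc nn_integral_\<kappa>)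
    finally have "V p < top"
      using vol_finite[OF that] by (auto simp: ennreal_mult_less_top intro: le_less_trans)
    then show ?thesis
      using vol_pos[OF that] by (auto simp: ennreal_divide_eq_top_iff less_top[symmetric])
  qed
  define e where "e p = enn2real (V p / vol p)" for p
  have [measurable]: "e \<in> borel_measurable R" unfolding e_def[abs_def] by measurable
  have e: "0 \<le> e p" for p by (simp add: e_def)
  define w where "w p = (h p / (1 + e p)) powr (1 / q)" for p
  have [measurable]: "w \<in> borel_measurable R" unfolding w_def[abs_def] by measurable
  have w_pos: "0 < w p" for p
    unfolding w_def using h(1)[of p] e[of p] by simp
  have w_powr: "w p powr q = h p / (1 + e p)" for p
    unfolding w_def using h(1)[of p] e[of p] q by (simp add: powr_powr)
  show thesis
  proof
    have "tent_norm_1 \<gamma> m q (\<lambda>p. complex_of_real (w p)) \<le> (\<integral>\<^sup>+x. ennreal (v x) \<partial>\<gamma>) +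
      (\<integral>\<^sup>+p. ennreal (cmod (complex_of_real (w p)) powr q) / vol p * V p \<partial>R)"
      unfolding V_def by (rule tent_norm_1_le_weighted) (use q v in \<open>auto simp: less_imp_le\<close>)
    also have "(\<integral>\<^sup>+p. ennreal (cmod (complex_of_real (w p)) powr q) / vol p * V p \<partial>R) \<le> (\<integral>\<^sup>+p. ennreal (h p) \<partial>R)"
    proof (rule nn_integral_mono)
      fix p assume "p \<in> space R"
      then have "V p / vol p = ennreal (e p)" using V_finite[of p] by (simp add: e_def)
      then have "ennreal (cmod (complex_of_real (w p)) powr q) / vol p * V p = ennreal (h p / (1 + e p)) * ennreal (e p)"
        using w_pos[of p] by (simp add: w_powr ennreal_divide_times)
      also have "\<dots> \<le> ennreal (h p)"
        using h(1)[of p] e[of p] by (simp add: ennreal_leI divide_le_eq flip: ennreal_mult)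
      finally show "ennreal (cmod (complex_of_real (w p)) powr q) / vol p * V p \<le> ennreal (h p)" .
    qed
    also have "(\<integral>\<^sup>+p. ennreal (h p) \<partial>R) = ennreal (\<integral>p. h p \<partial>R)"
      using h by (intro nn_integral_eq_integral) (auto simp: less_imp_le)
    finally have "tent_norm_1 \<gamma> m q (\<lambda>p. complex_of_real (w p)) < \<infinity>"
      using v(2) by (auto simp: add_mono intro: le_less_trans)
    then show "(\<lambda>p. complex_of_real (w p)) \<in> tent_space_1 \<gamma> m q"
      by (simp add: tent_space_1_def)
  qed (use w_pos in auto)
qed

text \<open>
  The cone at \<open>x\<close> contains \<open>p = (y,t)\<close> iff \<open>x \<in> B(y,t)\<close>, so avoiding all cones with vertex outside a ball
  means that \<open>B(y,t)\<close> is contained in it.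
\<close>

lemma tent_iff:
  "p \<in> admissible_tent m (ball c r) \<longleftrightarrow> p \<in> D \<and> ball (fst p) (snd p) \<subseteq> ball c r"
  by (cases p) (auto simp: admissible_tent_def admissible_cone_def dist_commute subset_eq)

text \<open>
  The tent removes uncountably many cones from \<open>D\<close>; it is measurable since it is described by the
  distance to the complement.
\<close>

lemma sets_admissible_tent [measurable]: "admissible_tent m O' \<in> sets R"
proof -
  have "admissible_tent m O' = {p \<in> space R. - O' = {} \<or> snd p \<le> infdist (fst p) (- O')}"
  proof (cases "- O' = {}")
    case False
    have "(\<forall>x\<in>-O'. \<not> dist x y < t) \<longleftrightarrow> t \<le> infdist y (- O')" for y :: 'a and t :: real
    proof
      assume "\<forall>x\<in>-O'. \<not> dist x y < t"
      then show "t \<le> infdist y (- O')"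
        unfolding infdist_notempty[OF False] using False
        by (intro cINF_greatest) (auto simp: dist_commute not_less)
    next
      assume t: "t \<le> infdist y (- O')"
      show "\<forall>x\<in>-O'. \<not> dist x y < t"
        using t infdist_le[of _ "- O'" y] by (force simp: dist_commute)
    qed
    moreover have "p \<in> admissible_tent m O' \<longleftrightarrow> p \<in> D \<and> (\<forall>x\<in>-O'. \<not> dist x (fst p) < snd p)" for p
      by (cases p) (auto simp: admissible_tent_def admissible_cone_def)
    ultimately show ?thesis using False by auto
  qed (auto simp: admissible_tent_def)
  also have "\<dots> \<in> sets R"
  proof -
    have [measurable]: "(\<lambda>y. infdist y (- O')) \<in> borel_measurable borel"
      by (intro borel_measurable_continuous_onI continuous_intros)
    show ?thesis by measurable
  qed
  finally show ?thesis .
qed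

text \<open>
  The weighted bound for the weight \<open>s 1\<^sub>B\<close>. Optimising over \<open>s\<close> would give a constant times \<open>\<gamma>(B)\<^bsup>1/q'\<^esup>\<close> times the
  \<open>L\<^sup>q\<close> norm, but keeping \<open>s\<close> free is more convenient for the lower bound on functionals.
\<close>

lemma tent_norm_1_supported_in_tent:
  assumes [measurable]: "f \<in> borel_measurable R" and q: "1 \<le> q" and s: "0 < s"
    and supp: "\<And>p. p \<in> D \<Longrightarrow> f p \<noteq> 0 \<Longrightarrow> p \<in> admissible_tent m (ball c r)"
  shows "tent_norm_1 \<gamma> m q f \<le> ennreal s * emeasure \<gamma> (ball c r) +
           ennreal (s powr (1 - q)) * (\<integral>\<^sup>+p. ennreal (cmod (f p) powr q) \<partial>R)"
proof -
  define v where "v x = s * indicator (ball c r) x" for x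
  have [measurable]: "v \<in> borel_measurable \<gamma>"
  proof -
    have [measurable]: "ball c r \<in> sets \<gamma>" by (simp add: sets_\<gamma>)
    show ?thesis unfolding v_def[abs_def] by measurable
  qed
  have "tent_norm_1 \<gamma> m q f \<le> (\<integral>\<^sup>+x. ennreal (v x) \<partial>\<gamma>) +
    (\<integral>\<^sup>+p. ennreal (cmod (f p) powr q) / vol p * (\<integral>\<^sup>+x. \<kappa> x p * ennreal (v x powr (1 - q)) \<partial>\<gamma>) \<partial>R)"
  proof (rule tent_norm_1_le_weighted)
    show "0 < v x" if "p \<in> D" "f p \<noteq> 0" "dist x (fst p) < snd p" for x p
    proof -
      have "x \<in> ball (fst p) (snd p)" using that(3) by (simp add: dist_commute)
      then have "x \<in> ball c r" using supp[OF that(1,2)] by (auto simp: tent_iff)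
      then show ?thesis using s by (simp add: v_def)
    qed
  qed (measurable, use q s in \<open>auto simp: v_def\<close>)
  also have "(\<integral>\<^sup>+x. ennreal (v x) \<partial>\<gamma>) = (\<integral>\<^sup>+x. ennreal s * indicator (ball c r) x \<partial>\<gamma>)"
    using s by (intro nn_integral_cong) (simp add: v_def ennreal_mult ennreal_indicator)
  also have "\<dots> = ennreal s * emeasure \<gamma> (ball c r)"
    by (rule nn_integral_cmult_indicator) (simp add: sets_\<gamma>)
  also have "(\<integral>\<^sup>+p. ennreal (cmod (f p) powr q) / vol p * (\<integral>\<^sup>+x. \<kappa> x p * ennreal (v x powr (1 - q)) \<partial>\<gamma>) \<partial>R)
      = (\<integral>\<^sup>+p. ennreal (s powr (1 - q)) * ennreal (cmod (f p) powr q) \<partial>R)"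
  proof (rule nn_integral_cong)
    fix p assume "p \<in> space R"
    then have p: "p \<in> D" by simp
    show "ennreal (cmod (f p) powr q) / vol p * (\<integral>\<^sup>+x. \<kappa> x p * ennreal (v x powr (1 - q)) \<partial>\<gamma>)
      = ennreal (s powr (1 - q)) * ennreal (cmod (f p) powr q)"
    proof (cases "f p = 0")
      case False
      have "(\<integral>\<^sup>+x. \<kappa> x p * ennreal (v x powr (1 - q)) \<partial>\<gamma>) = (\<integral>\<^sup>+x. \<kappa> x p * ennreal (s powr (1 - q)) \<partial>\<gamma>)"
        using supp[OF p False]
        by (intro nn_integral_cong) (auto simp: tent_iff v_def subset_eq dist_commute \<kappa>_def)
      also have "\<dots> = vol p * ennreal (s powr (1 - q))"
        by (simp add: nn_integral_multc nn_integral_\<kappa>)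
      finally have "ennreal (cmod (f p) powr q) / vol p * (\<integral>\<^sup>+x. \<kappa> x p * ennreal (v x powr (1 - q)) \<partial>\<gamma>)
          = ennreal (cmod (f p) powr q) / vol p * vol p * ennreal (s powr (1 - q))"
        by (simp add: mult.assoc)
      then show ?thesis by (simp only: vol_cancel[OF p]) (rule mult.commute)
    qed simp
  qed
  also have "\<dots> = ennreal (s powr (1 - q)) * (\<integral>\<^sup>+p. ennreal (cmod (f p) powr q) \<partial>R)"
    by (intro nn_integral_cmult) measurable
  finally show ?thesis by (simp add: add_left_mono)
qed

section \<open>The stopping-time argument\<close>

text \<open>
  The height \<open>t\<close> itself is included so that truncating at the greatest element of a down-closed set of
  heights keeps all of that set.
\<close>

definition trunc_int :: "('a \<times> real \<Rightarrow> ennreal) \<Rightarrow> 'a \<Rightarrow> real \<Rightarrow> ennreal" where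
  "trunc_int F x t = (\<integral>\<^sup>+p. (if snd p \<le> t then F p / vol p * \<kappa> x p else 0) \<partial>R)"

lemma measurable_trunc_int [measurable (raw)]:
  assumes [measurable]: "F \<in> borel_measurable R" "f \<in> measurable M borel" "h \<in> borel_measurable M"
  shows "(\<lambda>z. trunc_int F (f z) (h z)) \<in> borel_measurable M"
proof -
  interpret sigma_finite_measure R by (rule sigma_finite_R)
  show ?thesis unfolding trunc_int_def by measurable
qed

text \<open>
  The heights \<open>t\<close> with truncated integral at most \<open>K\<close> form a down-closed set. Cutting the cone at these
  heights is the increasing limit of truncations along a cofinal sequence, each at most \<open>K\<close>.
\<close>

lemma trunc_int_sublevel:
  assumes [measurable]: "F \<in> borel_measurable R"
  shows "(\<integral>\<^sup>+p. (if trunc_int F x (snd p) \<le> K then F p / vol p * \<kappa> x p else 0) \<partial>R) \<le> K"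
proof -
  define T where "T = {t. trunc_int F x t \<le> K}"
  have mono: "trunc_int F x s \<le> trunc_int F x t" if "s \<le> t" for s t
    unfolding trunc_int_def using that by (intro nn_integral_mono) auto
  show ?thesis
  proof (cases "T = {}")
    case True
    then have "\<not> trunc_int F x t \<le> K" for t by (auto simp: T_def)
    then show ?thesis by simp
  next
    case False
    then obtain t :: "nat \<Rightarrow> real" where t: "incseq t" "\<And>n. t n \<in> T" "\<And>s. s \<in> T \<Longrightarrow> \<exists>n. s \<le> t n"
      using exists_cofinal_sequence by blast
    have "(\<integral>\<^sup>+p. (if trunc_int F x (snd p) \<le> K then F p / vol p * \<kappa> x p else 0) \<partial>R)
        \<le> (\<integral>\<^sup>+p. (SUP n. if snd p \<le> t n then F p / vol p * \<kappa> x p else 0) \<partial>R)"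
    proof (rule nn_integral_mono)
      fix p
      show "(if trunc_int F x (snd p) \<le> K then F p / vol p * \<kappa> x p else 0)
          \<le> (SUP n. if snd p \<le> t n then F p / vol p * \<kappa> x p else 0)"
      proof (cases "snd p \<in> T")
        case True
        then obtain n where "snd p \<le> t n" using t by blast
        then show ?thesis by (intro SUP_upper2[of n]) auto
      qed (simp add: T_def)
    qed
    also have "\<dots> = (SUP n. trunc_int F x (t n))"
      unfolding trunc_int_def
    proof (rule nn_integral_monotone_convergence_SUP)
      show "incseq (\<lambda>n p. if snd p \<le> t n then F p / vol p * \<kappa> x p else 0)"
      proof (intro monoI le_funI)
        fix i j :: nat and p :: "'a \<times> real" assume "i \<le> j"
        then have "t i \<le> t j" using t(1) by (auto simp: incseq_def)
        then show "(if snd p \<le> t i then F p / vol p * \<kappa> x p else 0)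
            \<le> (if snd p \<le> t j then F p / vol p * \<kappa> x p else 0)" by auto
      qed
    qed measurable
    also have "\<dots> \<le> K" using t(2) by (intro SUP_least) (simp add: T_def)
    finally show ?thesis .
  qed
qed

text \<open>
  If \<open>x\<close> lies in both \<open>B(y,t)\<close> and \<open>B(z,s)\<close> with \<open>s \<le> t\<close>, then \<open>B(z,s) \<subseteq> B(y,3t)\<close>. So only the tent over
  \<open>B(y,3t)\<close> contributes, and there the integral over \<open>x \<in> B(z,s)\<close> cancels the division by the volume.
\<close>

lemma trunc_int_average:
  assumes [measurable]: "F \<in> borel_measurable R" and p: "p \<in> D"
  shows "(\<integral>\<^sup>+x. \<kappa> x p * trunc_int F x (snd p) \<partial>\<gamma>)
    \<le> (\<integral>\<^sup>+p'\<in>admissible_tent m (ball (fst p) (3 * snd p)). F p' \<partial>R)"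
proof -
  define k where "k x p' = (if snd p' \<le> snd p then \<kappa> x p * (F p' / vol p' * \<kappa> x p') else 0)" for x p'
  have "\<kappa> x p * trunc_int F x (snd p) = (\<integral>\<^sup>+p'. k x p' \<partial>R)" for x
    unfolding trunc_int_def k_def
    by (subst nn_integral_cmult[symmetric]) (auto intro!: nn_integral_cong)
  then have "(\<integral>\<^sup>+x. \<kappa> x p * trunc_int F x (snd p) \<partial>\<gamma>) = (\<integral>\<^sup>+x. \<integral>\<^sup>+p'. k x p' \<partial>R \<partial>\<gamma>)"
    by simp
  also have "\<dots> = (\<integral>\<^sup>+p'. \<integral>\<^sup>+x. k x p' \<partial>\<gamma> \<partial>R)"
    by (rule tonelli_\<gamma>_R) (unfold k_def, measurable)
  also have "\<dots> \<le> (\<integral>\<^sup>+p'. F p' * indicator (admissible_tent m (ball (fst p) (3 * snd p))) p' \<partial>R)"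
  proof (rule nn_integral_mono)
    fix p' assume "p' \<in> space R"
    then have p': "p' \<in> D" by simp
    show "(\<integral>\<^sup>+x. k x p' \<partial>\<gamma>) \<le> F p' * indicator (admissible_tent m (ball (fst p) (3 * snd p))) p'"
    proof (cases "p' \<in> admissible_tent m (ball (fst p) (3 * snd p))")
      case True
      have "(\<integral>\<^sup>+x. k x p' \<partial>\<gamma>) \<le> (\<integral>\<^sup>+x. F p' / vol p' * \<kappa> x p' \<partial>\<gamma>)"
        by (intro nn_integral_mono) (auto simp: k_def \<kappa>_def)
      also have "\<dots> = F p' / vol p' * vol p'"
        by (simp add: nn_integral_cmult nn_integral_\<kappa>)
      finally show ?thesis using True vol_cancel[OF p'] by simp
    next
      case False
      have "k x p' = 0" for x
      proof (rule ccontr)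
        assume "k x p' \<noteq> 0"
        then have near: "snd p' \<le> snd p" "dist x (fst p) < snd p" "dist x (fst p') < snd p'"
          by (auto simp: k_def \<kappa>_def split: if_splits)
        have "ball (fst p') (snd p') \<subseteq> ball (fst p) (3 * snd p)"
        proof
          fix z assume "z \<in> ball (fst p') (snd p')"
          then have "dist (fst p') z < snd p'" by simp
          then show "z \<in> ball (fst p) (3 * snd p)"
            using near dist_triangle[of "fst p" z x] dist_triangle[of x z "fst p'"]
            by (simp add: dist_commute)
        qed
        with False p' show False by (simp add: tent_iff)
      qed
      then show ?thesis by simp
    qed
  qed
  finally show ?thesis .
qed

text \<open>
  Markov's inequality: a function with average at most \<open>A\<close> exceeds \<open>2A\<close> on at most half of the ball.
\<close>

lemma vol_le_twice_sublevel_part: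
  assumes [measurable]: "F \<in> borel_measurable R" and p: "p \<in> D" and A: "0 < A"
    and average: "(\<integral>\<^sup>+x. \<kappa> x p * trunc_int F x (snd p) \<partial>\<gamma>) \<le> ennreal A * vol p"
  shows "vol p \<le> 2 * (\<integral>\<^sup>+x. \<kappa> x p * (if trunc_int F x (snd p) \<le> ennreal (2 * A) then 1 else 0) \<partial>\<gamma>)"
proof -
  define I where "I = (\<integral>\<^sup>+x. \<kappa> x p * (if trunc_int F x (snd p) \<le> ennreal (2 * A) then 1 else 0) \<partial>\<gamma>)"
  have "vol p = (\<integral>\<^sup>+x. \<kappa> x p \<partial>\<gamma>)" by (simp add: nn_integral_\<kappa>)
  also have "\<dots> \<le> (\<integral>\<^sup>+x. \<kappa> x p * (if trunc_int F x (snd p) \<le> ennreal (2 * A) then 1 else 0) +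
                   ennreal (1 / (2 * A)) * (\<kappa> x p * trunc_int F x (snd p)) \<partial>\<gamma>)"
  proof (rule nn_integral_mono)
    fix x
    have "1 \<le> ennreal (1 / (2 * A)) * trunc_int F x (snd p)" if "\<not> trunc_int F x (snd p) \<le> ennreal (2 * A)"
    proof -
      have "1 = ennreal (1 / (2 * A)) * ennreal (2 * A)" using A by (simp flip: ennreal_mult)
      also have "\<dots> \<le> ennreal (1 / (2 * A)) * trunc_int F x (snd p)"
        using that by (intro mult_left_mono) auto
      finally show ?thesis .
    qed
    then show "\<kappa> x p \<le> \<kappa> x p * (if trunc_int F x (snd p) \<le> ennreal (2 * A) then 1 else 0) +
                   ennreal (1 / (2 * A)) * (\<kappa> x p * trunc_int F x (snd p))"
      by (auto simp: \<kappa>_def)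
  qed
  also have "\<dots> = I + ennreal (1 / (2 * A)) * (\<integral>\<^sup>+x. \<kappa> x p * trunc_int F x (snd p) \<partial>\<gamma>)"
    unfolding I_def by (subst nn_integral_add) (auto simp: nn_integral_cmult)
  also have "\<dots> \<le> I + ennreal (1 / (2 * A)) * (ennreal A * vol p)"
    using average by (intro add_left_mono mult_left_mono) auto
  also have "ennreal (1 / (2 * A)) * (ennreal A * vol p) = ennreal (1 / 2) * vol p"
    using A by (simp flip: mult.assoc ennreal_mult)
  finally have *: "vol p \<le> I + ennreal (1 / 2) * vol p" .
  have "I \<le> (\<integral>\<^sup>+x. \<kappa> x p \<partial>\<gamma>)"
    unfolding I_def by (intro nn_integral_mono) auto
  then have "I < top" using vol_finite[OF p] by (simp add: nn_integral_\<kappa>)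
  then obtain i where i: "I = ennreal i" "0 \<le> i" by (cases I) auto
  obtain v where v: "vol p = ennreal v" "0 \<le> v" using vol_finite[OF p] by (cases "vol p") auto
  have "ennreal (i + 1 / 2 * v) = I + ennreal (1 / 2) * vol p"
    unfolding i(1) v(1) using i v
    by (subst ennreal_plus) (simp_all only: ennreal_mult zero_le_divide_1_iff zero_le_numeral mult_nonneg_nonneg)
  with * i v have "v \<le> i + 1 / 2 * v"
    by (metis ennreal_le_iff add_nonneg_nonneg mult_nonneg_nonneg zero_le_divide_1_iff zero_le_numeral)
  then have "ennreal v \<le> 2 * ennreal i"
    using i v by (simp add: ennreal_le_iff flip: ennreal_numeral ennreal_mult)
  then show ?thesis using i v by (simp add: I_def)
qed

text \<open>
  Hoelder's inequality in a single cone, in the form of Young's inequality \<open>ab \<le> a\<^sup>q + b\<^sup>s\<close> with \<open>f\<close> normalised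
  by its area functional \<open>r\<^bsup>1/q\<^esup>\<close>. The indicator keeps the contribution of \<open>u\<close> below \<open>K\<close>.
\<close>

lemma cone_duality_pointwise:
  assumes [measurable]: "f \<in> borel_measurable R" "u \<in> borel_measurable R"
    and q: "1 < q" and s: "s = q / (q - 1)" and u: "\<And>p. 0 \<le> u p" and K: "0 \<le> K"
  shows "(\<integral>\<^sup>+p. ennreal (cmod (f p) * u p) / vol p * \<kappa> x p *
            (if trunc_int (\<lambda>p. ennreal (u p powr s)) x (snd p) \<le> ennreal K then 1 else 0) \<partial>R)
         \<le> ennreal (1 + K) * area_functional \<gamma> m q f x"
    (is "(\<integral>\<^sup>+p. _ * ?\<chi> p \<partial>R) \<le> _")
proof (cases "area_power q f x")
  case top
  then have "area_functional \<gamma> m q f x = top" by (simp add: area_functional_eq)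
  then show ?thesis using K by (simp add: ennreal_mult_top)
next
  case (real r)
  show ?thesis
  proof (cases "r = 0")
    case True
    then have "(\<integral>\<^sup>+p. ennreal (cmod (f p) powr q) / vol p * \<kappa> x p \<partial>R) = 0"
      using real by (simp add: cone_int_def)
    then have "AE p in R. ennreal (cmod (f p) powr q) / vol p * \<kappa> x p = 0"
      by (subst (asm) nn_integral_0_iff_AE) auto
    then have "AE p in R. ennreal (cmod (f p) * u p) / vol p * \<kappa> x p * ?\<chi> p = 0"
      using AE_space
    proof eventually_elim
      fix p assume zero: "ennreal (cmod (f p) powr q) / vol p * \<kappa> x p = 0" and "p \<in> space R"
      then have "vol p < top" using vol_finite by simp
      with zero have "f p = 0 \<or> \<kappa> x p = 0" by (auto simp: ennreal_divide_eq_0_iff)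
      then show "ennreal (cmod (f p) * u p) / vol p * \<kappa> x p * ?\<chi> p = 0" by auto
    qed
    then have "(\<integral>\<^sup>+p. ennreal (cmod (f p) * u p) / vol p * \<kappa> x p * ?\<chi> p \<partial>R) = 0"
      by (subst nn_integral_0_iff_AE) auto
    then show ?thesis by simp
  next
    case False
    with real have r: "0 < r" by simp
    have s1: "1 < s" "1 / q + 1 / s = 1" using q by (auto simp: s field_simps)
    have young: "a * b \<le> r powr (1 / q) * (a powr q / r + b powr s)" if "0 \<le> a" "0 \<le> b" for a b
    proof -
      define a' where "a' = a / r powr (1 / q)"
      have "a' * b \<le> a' powr q / q + b powr s / s"
        using q s1 that r by (intro Youngs_inequality) (auto simp: a'_def)
      also have "\<dots> \<le> a' powr q + b powr s"
        using q s1 by (intro add_mono) (auto simp: divide_le_eq mult_le_cancel_left1)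
      also have "a' powr q = a powr q / r"
        using that r q by (simp add: a'_def powr_divide powr_powr)
      finally have "r powr (1 / q) * (a' * b) \<le> r powr (1 / q) * (a powr q / r + b powr s)"
        by (intro mult_left_mono) auto
      then show ?thesis using r by (simp add: a'_def)
    qed
    have "(\<integral>\<^sup>+p. ennreal (cmod (f p) * u p) / vol p * \<kappa> x p * ?\<chi> p \<partial>R)
       \<le> (\<integral>\<^sup>+p. ennreal (r powr (1 / q)) *
             (ennreal (1 / r) * (ennreal (cmod (f p) powr q) / vol p * \<kappa> x p) +
              ennreal (u p powr s) / vol p * \<kappa> x p * ?\<chi> p) \<partial>R)"
    proof (rule nn_integral_mono)
      fix p
      have "ennreal (cmod (f p) * u p)
          \<le> ennreal (r powr (1 / q) * (cmod (f p) powr q / r + u p powr s))"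
        using u by (intro ennreal_leI young) auto
      also have "\<dots> = ennreal (r powr (1 / q)) * (ennreal (1 / r) * ennreal (cmod (f p) powr q) + ennreal (u p powr s))"
        using r by (simp flip: ennreal_mult ennreal_plus)
      finally have "ennreal (cmod (f p) * u p) * (inverse (vol p) * \<kappa> x p * ?\<chi> p)
          \<le> (ennreal (r powr (1 / q)) * (ennreal (1 / r) * ennreal (cmod (f p) powr q) + ennreal (u p powr s)))
              * (inverse (vol p) * \<kappa> x p * ?\<chi> p)"
        by (rule mult_right_mono) simp
      also have "\<dots> \<le> ennreal (r powr (1 / q)) *
             (ennreal (1 / r) * (ennreal (cmod (f p) powr q) / vol p * \<kappa> x p) +
              ennreal (u p powr s) / vol p * \<kappa> x p * ?\<chi> p)"
        by (auto simp: divide_ennreal_def distrib_left distrib_right mult_ac)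
      finally show "ennreal (cmod (f p) * u p) / vol p * \<kappa> x p * ?\<chi> p
          \<le> ennreal (r powr (1 / q)) *
             (ennreal (1 / r) * (ennreal (cmod (f p) powr q) / vol p * \<kappa> x p) +
              ennreal (u p powr s) / vol p * \<kappa> x p * ?\<chi> p)"
        by (simp add: divide_ennreal_def mult_ac)
    qed
    also have "\<dots> = ennreal (r powr (1 / q)) * (ennreal (1 / r) * area_power q f x +
        (\<integral>\<^sup>+p. ennreal (u p powr s) / vol p * \<kappa> x p * ?\<chi> p \<partial>R))"
      by (simp add: nn_integral_cmult nn_integral_add cone_int_def)
    also have "\<dots> \<le> ennreal (r powr (1 / q)) * (1 + ennreal K)"
    proof (intro mult_left_mono add_mono)
      show "ennreal (1 / r) * area_power q f x \<le> 1" using real r by (simp flip: ennreal_mult)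
      have "(\<integral>\<^sup>+p. ennreal (u p powr s) / vol p * \<kappa> x p * ?\<chi> p \<partial>R) =
        (\<integral>\<^sup>+p. (if trunc_int (\<lambda>p. ennreal (u p powr s)) x (snd p) \<le> ennreal K
                 then ennreal (u p powr s) / vol p * \<kappa> x p else 0) \<partial>R)"
        by (intro nn_integral_cong) auto
      also have "\<dots> \<le> ennreal K" by (rule trunc_int_sublevel) measurable
      finally show "(\<integral>\<^sup>+p. ennreal (u p powr s) / vol p * \<kappa> x p * ?\<chi> p \<partial>R) \<le> ennreal K" .
    qed auto
    also have "\<dots> = ennreal (1 + K) * area_functional \<gamma> m q f x"
      using real K by (simp add: area_functional_eq ennreal_powr_ennreal mult.commute)
    finally show ?thesis .
  qed
qed

text \<open>
  Each point \<open>p\<close> is charged only to those vertices in its ball at which the truncated integral of \<open>u\<^sup>s\<close>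
  is small; these fill half of the ball, which is the factor \<open>2\<close>.
\<close>

lemma duality_inequality_normalised:
  assumes [measurable]: "f \<in> borel_measurable R" "u \<in> borel_measurable R"
    and q: "1 < q" and s: "s = q / (q - 1)" and u: "\<And>p. 0 \<le> u p" and A: "0 < A"
    and doubling: "\<And>y t. 0 < t \<Longrightarrow> t < m y \<Longrightarrow> emeasure \<gamma> (ball y (3 * t)) \<le> ennreal A * emeasure \<gamma> (ball y t)"
    and carleson: "\<And>c r. (c, r) \<in> admissible_balls m 5 \<Longrightarrow>
        (\<integral>\<^sup>+p\<in>admissible_tent m (ball c r). ennreal (u p powr s) \<partial>R) \<le> emeasure \<gamma> (ball c r)"
  shows "(\<integral>\<^sup>+p. ennreal (cmod (f p) * u p) \<partial>R) \<le> ennreal (2 * (1 + 2 * A)) * tent_norm_1 \<gamma> m q f"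
proof -
  define F where "F p = ennreal (u p powr s)" for p
  have [measurable]: "F \<in> borel_measurable R" unfolding F_def[abs_def] by measurable
  define \<sigma> :: "'a \<Rightarrow> 'a \<times> real \<Rightarrow> ennreal"
    where "\<sigma> x p = (if trunc_int F x (snd p) \<le> ennreal (2 * A) then 1 else 0)" for x p
  have \<sigma>_measurable [measurable]: "(\<lambda>(x, p). \<sigma> x p) \<in> borel_measurable (\<gamma> \<Otimes>\<^sub>M R)"
    unfolding \<sigma>_def by measurable
  have good: "vol p \<le> 2 * (\<integral>\<^sup>+x. \<kappa> x p * \<sigma> x p \<partial>\<gamma>)" if p: "p \<in> D" for p
    unfolding \<sigma>_def
  proof (rule vol_le_twice_sublevel_part[OF _ p A])
    have adm: "(fst p, 3 * snd p) \<in> admissible_balls m 5"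
      using p by (auto simp: D_iff admissible_balls_def)
    have "(\<integral>\<^sup>+x. \<kappa> x p * trunc_int F x (snd p) \<partial>\<gamma>)
        \<le> (\<integral>\<^sup>+p'\<in>admissible_tent m (ball (fst p) (3 * snd p)). F p' \<partial>R)"
      by (rule trunc_int_average[OF _ p]) measurable
    also have "\<dots> \<le> emeasure \<gamma> (ball (fst p) (3 * snd p))"
      unfolding F_def by (rule carleson[OF adm])
    also have "\<dots> \<le> ennreal A * vol p"
      unfolding vol_def using p by (intro doubling) (auto simp: D_iff)
    finally show "(\<integral>\<^sup>+x. \<kappa> x p * trunc_int F x (snd p) \<partial>\<gamma>) \<le> ennreal A * vol p" .
  qed measurable
  have "(\<integral>\<^sup>+p. ennreal (cmod (f p) * u p) \<partial>R)
      \<le> (\<integral>\<^sup>+p. 2 * (ennreal (cmod (f p) * u p) / vol p * (\<integral>\<^sup>+x. \<kappa> x p * \<sigma> x p \<partial>\<gamma>)) \<partial>R)"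
  proof (rule nn_integral_mono)
    fix p assume "p \<in> space R"
    then have p: "p \<in> D" by simp
    have "ennreal (cmod (f p) * u p) = ennreal (cmod (f p) * u p) / vol p * vol p"
      by (simp add: vol_cancel[OF p])
    also have "\<dots> \<le> ennreal (cmod (f p) * u p) / vol p * (2 * (\<integral>\<^sup>+x. \<kappa> x p * \<sigma> x p \<partial>\<gamma>))"
      by (intro mult_left_mono good p) simp
    finally show "ennreal (cmod (f p) * u p)
        \<le> 2 * (ennreal (cmod (f p) * u p) / vol p * (\<integral>\<^sup>+x. \<kappa> x p * \<sigma> x p \<partial>\<gamma>))"
      by (simp add: mult_ac)
  qed
  also have "\<dots> = 2 * (\<integral>\<^sup>+p. ennreal (cmod (f p) * u p) / vol p * (\<integral>\<^sup>+x. \<kappa> x p * \<sigma> x p \<partial>\<gamma>) \<partial>R)"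
  proof (rule nn_integral_cmult)
    interpret sigma_finite_measure \<gamma> by (rule sigma_finite_\<gamma>)
    show "(\<lambda>p. ennreal (cmod (f p) * u p) / vol p * (\<integral>\<^sup>+x. \<kappa> x p * \<sigma> x p \<partial>\<gamma>)) \<in> borel_measurable R"
      unfolding \<sigma>_def by measurable
  qed
  also have "(\<integral>\<^sup>+p. ennreal (cmod (f p) * u p) / vol p * (\<integral>\<^sup>+x. \<kappa> x p * \<sigma> x p \<partial>\<gamma>) \<partial>R)
      = (\<integral>\<^sup>+x. \<integral>\<^sup>+p. ennreal (cmod (f p) * u p) / vol p * \<kappa> x p * \<sigma> x p \<partial>R \<partial>\<gamma>)"
    by (rule nn_integral_cone_int_weighted[symmetric]) measurable
  also have "\<dots> \<le> (\<integral>\<^sup>+x. ennreal (1 + 2 * A) * area_functional \<gamma> m q f x \<partial>\<gamma>)"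
    unfolding \<sigma>_def F_def using A
    by (intro nn_integral_mono cone_duality_pointwise[OF _ _ q s u]) auto
  also have "\<dots> = ennreal (1 + 2 * A) * tent_norm_1 \<gamma> m q f"
    unfolding tent_norm_1_def by (rule nn_integral_cmult) measurable
  finally have "(\<integral>\<^sup>+p. ennreal (cmod (f p) * u p) \<partial>R)
      \<le> 2 * (ennreal (1 + 2 * A) * tent_norm_1 \<gamma> m q f)"
    by (simp add: mult_left_mono)
  also have "\<dots> = ennreal (2 * (1 + 2 * A)) * tent_norm_1 \<gamma> m q f"
  proof -
    have "ennreal (2 * (1 + 2 * A)) = 2 * ennreal (1 + 2 * A)"
      using A by (subst ennreal_mult) auto
    then show ?thesis by (simp add: mult.assoc)
  qed
  finally show ?thesis .
qed

text \<open>
  The values of \<open>m\<close> at nearby points may differ greatly, so the centres are chosen separately in each dyadic layer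
  \<open>2\<^sup>k < m \<le> 2\<^bsup>k+1\<^esup>\<close>. There \<open>t < 2\<^bsup>k+1\<^esup>\<close>, and a centre within \<open>2\<^sup>k\<close> of \<open>y\<close> gives \<open>B(y,t) \<subseteq> B(c, 3 2\<^sup>k)\<close>, a ball
  whose radius is below \<open>3 m(c)\<close>.
\<close>

lemma exists_countable_tent_cover:
  obtains S where "countable S" "S \<subseteq> admissible_balls m 5"
    "D \<subseteq> (\<Union>(c, r)\<in>S. admissible_tent m (ball c r))"
proof -
  define E where "E k = {y. 2 powr real_of_int k < m y \<and> m y \<le> 2 * 2 powr real_of_int k}" for k :: int
  have "\<forall>k. \<exists>S\<subseteq>E k. countable S \<and> (\<forall>x\<in>E k. \<exists>c\<in>S. dist x c < 2 powr real_of_int k)"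
    using exists_countable_net by simp
  then obtain S where S: "\<And>k. S k \<subseteq> E k" "\<And>k. countable (S k)"
    "\<And>k x. x \<in> E k \<Longrightarrow> \<exists>c\<in>S k. dist x c < 2 powr real_of_int k"
    by metis
  show thesis
  proof
    show "countable (\<Union>k. (\<lambda>c. (c, 3 * 2 powr real_of_int k)) ` S k)"
      using S(2) by blast
    show "(\<Union>k. (\<lambda>c. (c, 3 * 2 powr real_of_int k)) ` S k) \<subseteq> admissible_balls m 5"
    proof (rule UN_least, rule image_subsetI)
      fix k c assume "c \<in> S k"
      then have "2 powr real_of_int k < m c" using S(1) by (auto simp: E_def)
      then show "(c, 3 * 2 powr real_of_int k) \<in> admissible_balls m 5"
        using m_pos[of c] unfolding admissible_balls_def by simp
    qed
    show "D \<subseteq> (\<Union>(c, r)\<in>(\<Union>k. (\<lambda>c. (c, 3 * 2 powr real_of_int k)) ` S k). admissible_tent m (ball c r))"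
    proof
      fix p assume p: "p \<in> D"
      define k where "k = \<lceil>log 2 (m (fst p))\<rceil> - 1"
      have "fst p \<in> E k"
      proof -
        have "real_of_int k < log 2 (m (fst p))" "log 2 (m (fst p)) \<le> 1 + real_of_int k"
          unfolding k_def by linarith+
        moreover have "m (fst p) = 2 powr log 2 (m (fst p))" using m_pos[of "fst p"] by simp
        ultimately show ?thesis
          unfolding E_def by (metis (no_types, lifting) mem_Collect_eq powr_add powr_le_cancel_iff powr_less_cancel_iff
            powr_one one_less_numeral_iff semiring_norm(76) zero_le_numeral)
      qed
      moreover from this obtain c where c: "c \<in> S k" "dist (fst p) c < 2 powr real_of_int k"
        using S(3) by blast
      ultimately have "ball (fst p) (snd p) \<subseteq> ball c (3 * 2 powr real_of_int k)"
      proof (intro subsetI)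
        fix z assume "fst p \<in> E k" "z \<in> ball (fst p) (snd p)"
        then show "z \<in> ball c (3 * 2 powr real_of_int k)"
          using c p dist_triangle[of c z "fst p"] by (simp add: D_iff E_def dist_commute)
      qed
      then have "p \<in> admissible_tent m (ball c (3 * 2 powr real_of_int k))"
        using p by (simp add: tent_iff)
      then show "p \<in> (\<Union>(c, r)\<in>(\<Union>k. (\<lambda>c. (c, 3 * 2 powr real_of_int k)) ` S k). admissible_tent m (ball c r))"
        using c(1) by blast
    qed
  qed
qed

lemma tent_norm_inf_le_iff:
  assumes s: "0 < s" and N: "0 \<le> N"
  shows "tent_norm_inf \<gamma> m (ennreal s) g \<le> ennreal N \<longleftrightarrow>
    (\<forall>c r. (c, r) \<in> admissible_balls m 5 \<longrightarrow>
       (\<integral>\<^sup>+p\<in>admissible_tent m (ball c r). ennreal (cmod (g p) powr s) \<partial>R) \<le> ennreal (N powr s) * emeasure \<gamma> (ball c r))"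
proof -
  have "ennreal_powr (1 / emeasure \<gamma> (ball c r) * I) (1 / s) \<le> ennreal N \<longleftrightarrow>
      I \<le> ennreal (N powr s) * emeasure \<gamma> (ball c r)" if "(c, r) \<in> admissible_balls m 5" for c r I
  proof -
    have "0 < r" using that by (auto simp: admissible_balls_def)
    then have "emeasure \<gamma> (ball c r) < top" "0 < emeasure \<gamma> (ball c r)"
      using ball_pos ball_finite by auto
    then obtain v where v: "emeasure \<gamma> (ball c r) = ennreal v" "0 < v"
      by (cases "emeasure \<gamma> (ball c r)") auto
    have "1 / ennreal v * I = ennreal (1 / v) * I"
      using v divide_ennreal[of 1 v] by simp
    moreover have "ennreal (1 / v) * I \<le> ennreal (N powr s) \<longleftrightarrow> I \<le> ennreal (N powr s) * ennreal v"
    proof (cases I)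
      case (real i)
      have "ennreal (1 / v) * I = ennreal (i / v)" "ennreal (N powr s) * ennreal v = ennreal (N powr s * v)"
        using v real by (simp_all flip: ennreal_mult)
      then show ?thesis using v real by (simp add: divide_le_eq)
    next
      case top
      then show ?thesis
        using v by (simp add: ennreal_mult_top top_unique ennreal_mult_eq_top_iff)
    qed
    ultimately show ?thesis
      using s N by (simp add: ennreal_powr_le_iff v)
  qed
  then show ?thesis
    unfolding tent_norm_inf_def using s by (auto simp: SUP_le_iff)
qed

text \<open>
  Essential boundedness on every tent is essential boundedness on \<open>D\<close>, by the countable cover.
\<close>

lemma tent_norm_inf_top_le_iff:
  assumes [measurable]: "g \<in> borel_measurable R" and N: "0 \<le> N"
  shows "tent_norm_inf \<gamma> m \<infinity> g \<le> ennreal N \<longleftrightarrow> (AE p in R. cmod (g p) \<le> N)"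
proof
  assume le: "tent_norm_inf \<gamma> m \<infinity> g \<le> ennreal N"
  obtain S where S: "countable S" "S \<subseteq> admissible_balls m 5"
    "D \<subseteq> (\<Union>(c, r)\<in>S. admissible_tent m (ball c r))"
    using exists_countable_tent_cover by blast
  have "AE p in R. p \<in> admissible_tent m (ball (fst B) (snd B)) \<longrightarrow> cmod (g p) \<le> N" if "B \<in> S" for B
  proof -
    let ?T = "admissible_tent m (ball (fst B) (snd B))"
    have "esssup (restrict_space R ?T) (\<lambda>p. ennreal (cmod (g p))) \<le> tent_norm_inf \<gamma> m \<infinity> g"
      unfolding tent_norm_inf_def using that S(2) by (intro SUP_upper2[of B]) (auto simp: case_prod_beta)
    with le have "esssup (restrict_space R ?T) (\<lambda>p. ennreal (cmod (g p))) \<le> ennreal N" by simp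
    moreover have "AE p in restrict_space R ?T. ennreal (cmod (g p)) \<le> esssup (restrict_space R ?T) (\<lambda>p. ennreal (cmod (g p)))"
      by (rule esssup_AE)
    ultimately have "AE p in restrict_space R ?T. ennreal (cmod (g p)) \<le> ennreal N"
      by (elim eventually_mono) simp
    then show ?thesis
      using N by (subst (asm) AE_restrict_space_iff[OF sets.Int[OF sets_admissible_tent sets.top]]) auto
  qed
  then have "AE p in R. \<forall>B\<in>S. p \<in> admissible_tent m (ball (fst B) (snd B)) \<longrightarrow> cmod (g p) \<le> N"
    by (subst AE_ball_countable[OF S(1)]) blast
  then show "AE p in R. cmod (g p) \<le> N"
    using AE_space
  proof eventually_elim
    case (elim p)
    then have "p \<in> D" by simp
    with S(3) obtain c r where "(c, r) \<in> S" "p \<in> admissible_tent m (ball c r)" by blast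
    with elim(1) show ?case by force
  qed
next
  assume ae: "AE p in R. cmod (g p) \<le> N"
  show "tent_norm_inf \<gamma> m \<infinity> g \<le> ennreal N"
    unfolding tent_norm_inf_def
  proof (rule SUP_least, clarsimp)
    fix c r
    show "esssup (restrict_space R (admissible_tent m (ball c r))) (\<lambda>p. ennreal (cmod (g p))) \<le> ennreal N"
    proof (rule esssup_I)
      show "(\<lambda>p. ennreal (cmod (g p))) \<in> borel_measurable (restrict_space R (admissible_tent m (ball c r)))"
        by (rule measurable_restrict_space1) measurable
      show "AE p in restrict_space R (admissible_tent m (ball c r)). ennreal (cmod (g p)) \<le> ennreal N"
        using ae N by (subst AE_restrict_space_iff[OF sets.Int[OF sets_admissible_tent sets.top]]) (auto elim: eventually_mono)
    qed
  qed
qed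

section \<open>Pairing and representation\<close>

lemma duality_inequality:
  assumes [measurable]: "f \<in> borel_measurable R" "g \<in> borel_measurable R"
    and q: "1 \<le> q" "1 / ennreal q + 1 / q' = 1" and A: "0 < A"
    and doubling: "\<And>y t. 0 < t \<Longrightarrow> t < m y \<Longrightarrow> emeasure \<gamma> (ball y (3 * t)) \<le> ennreal A * emeasure \<gamma> (ball y t)"
    and N: "0 < N" "tent_norm_inf \<gamma> m q' g \<le> ennreal N"
  shows "(\<integral>\<^sup>+p. ennreal (cmod (f p * cnj (g p))) \<partial>R) \<le> ennreal (2 * (1 + 2 * A) * N) * tent_norm_1 \<gamma> m q f"
  using q
proof (cases rule: conjugate_exponent_cases)
  case 1
  then have "AE p in R. cmod (g p) \<le> N"
    using N tent_norm_inf_top_le_iff[of g N] by simp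
  then have "(\<integral>\<^sup>+p. ennreal (cmod (f p * cnj (g p))) \<partial>R) \<le> (\<integral>\<^sup>+p. ennreal N * ennreal (cmod (f p) powr q) \<partial>R)"
  proof (intro nn_integral_mono_AE, elim eventually_mono)
    fix p assume "cmod (g p) \<le> N"
    then have "cmod (f p) * cmod (g p) \<le> cmod (f p) * N" by (rule mult_left_mono) simp
    then have "ennreal (cmod (f p * cnj (g p))) \<le> ennreal (N * cmod (f p))"
      by (intro ennreal_leI) (simp add: norm_mult mult.commute)
    then show "ennreal (cmod (f p * cnj (g p))) \<le> ennreal N * ennreal (cmod (f p) powr q)"
      using 1 N(1) by (simp add: ennreal_mult)
  qed
  also have "\<dots> = ennreal N * (\<integral>\<^sup>+x. area_power q f x \<partial>\<gamma>)"
    by (simp add: nn_integral_cmult nn_integral_cone_int)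
  also have "(\<integral>\<^sup>+x. area_power q f x \<partial>\<gamma>) = tent_norm_1 \<gamma> m q f"
    using 1 by (simp add: tent_norm_1_def area_functional_eq)
  also have "ennreal N * tent_norm_1 \<gamma> m q f \<le> ennreal (2 * (1 + 2 * A) * N) * tent_norm_1 \<gamma> m q f"
    using N(1) A by (intro mult_right_mono ennreal_leI) auto
  finally show ?thesis .
next
  case (2 s)
  have s: "0 < s" using 2 by simp
  have "(\<integral>\<^sup>+p. ennreal (cmod (f p) * (cmod (g p) / N)) \<partial>R) \<le> ennreal (2 * (1 + 2 * A)) * tent_norm_1 \<gamma> m q f"
  proof (rule duality_inequality_normalised[OF _ _ 2(1,2) _ A doubling])
    fix c r assume B: "(c, r) \<in> admissible_balls m 5"
    let ?I = "\<integral>\<^sup>+p\<in>admissible_tent m (ball c r). ennreal (cmod (g p) powr s) \<partial>R"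
    have "(\<integral>\<^sup>+p\<in>admissible_tent m (ball c r). ennreal ((cmod (g p) / N) powr s) \<partial>R)
        = (\<integral>\<^sup>+p. ennreal (1 / N powr s) * (ennreal (cmod (g p) powr s) * indicator (admissible_tent m (ball c r)) p) \<partial>R)"
      using N(1) by (intro nn_integral_cong) (simp add: powr_divide flip: ennreal_mult mult.assoc)
    also have "\<dots> = ennreal (1 / N powr s) * ?I"
      by (rule nn_integral_cmult) measurable
    also have "\<dots> \<le> ennreal (1 / N powr s) * (ennreal (N powr s) * emeasure \<gamma> (ball c r))"
      using B N 2 s tent_norm_inf_le_iff[of s N g] by (intro mult_left_mono) auto
    also have "\<dots> = emeasure \<gamma> (ball c r)"
      using N(1) by (simp flip: mult.assoc ennreal_mult)
    finally show "(\<integral>\<^sup>+p\<in>admissible_tent m (ball c r). ennreal ((cmod (g p) / N) powr s) \<partial>R)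
        \<le> emeasure \<gamma> (ball c r)" .
  qed (use N in auto)
  then have "ennreal N * (\<integral>\<^sup>+p. ennreal (cmod (f p) * (cmod (g p) / N)) \<partial>R)
      \<le> ennreal N * (ennreal (2 * (1 + 2 * A)) * tent_norm_1 \<gamma> m q f)"
    by (rule mult_left_mono) simp
  moreover have "ennreal N * (\<integral>\<^sup>+p. ennreal (cmod (f p) * (cmod (g p) / N)) \<partial>R)
      = (\<integral>\<^sup>+p. ennreal (cmod (f p * cnj (g p))) \<partial>R)"
    using N(1)
    by (subst nn_integral_cmult[symmetric]) (auto simp: norm_mult intro!: nn_integral_cong simp flip: ennreal_mult)
  moreover have "ennreal N * (ennreal (2 * (1 + 2 * A)) * tent_norm_1 \<gamma> m q f)
      = ennreal (2 * (1 + 2 * A) * N) * tent_norm_1 \<gamma> m q f"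
  proof -
    have "ennreal (2 * (1 + 2 * A) * N) = ennreal N * ennreal (2 * (1 + 2 * A))"
      using N(1) A by (subst ennreal_mult[symmetric]) (auto simp: mult.commute)
    then show ?thesis by (simp add: mult.assoc)
  qed
  ultimately show ?thesis by simp
qed

text \<open>
  Pairs the test functions \<open>|g|\<^sup>a g\<close> with \<open>g\<close>. The case \<open>z = 0\<close> holds because \<open>0 powr a = 0\<close>.
\<close>

lemma mult_powr_cnj:
  fixes z :: complex
  shows "of_real (cmod z powr a) * z * cnj z = of_real (cmod z powr (a + 2))"
proof (cases "z = 0")
  case False
  have "of_real (cmod z powr a) * z * cnj z = of_real (cmod z powr a * (cmod z)\<^sup>2)"
    by (simp add: mult.assoc complex_norm_square[symmetric])
  also have "cmod z powr a * (cmod z)\<^sup>2 = cmod z powr (a + 2)"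
    using False by (simp add: powr_add powr_numeral)
  finally show ?thesis .
qed simp

lemma exists_bounded_exhaustion:
  assumes [measurable]: "g \<in> borel_measurable R"
  obtains E :: "nat \<Rightarrow> ('a \<times> real) set" where "\<And>n. E n \<in> sets R" "incseq E" "(\<Union>n. E n) = D"
    "\<And>n. emeasure R (E n) < \<infinity>" "\<And>n p. p \<in> E n \<Longrightarrow> cmod (g p) \<le> real n"
proof -
  interpret sigma_finite_measure R by (rule sigma_finite_R)
  obtain B :: "nat \<Rightarrow> ('a \<times> real) set" where B: "range B \<subseteq> sets R" "(\<Union>i. B i) = space R"
    "\<And>i. emeasure R (B i) \<noteq> \<infinity>" "incseq B"
    using sigma_finite_incseq by metis
  have B_sets [measurable]: "B n \<in> sets R" for n using B(1) by blast
  define E where "E n = B n \<inter> {p \<in> space R. cmod (g p) \<le> real n}" for n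
  show thesis
  proof
    show [measurable]: "E n \<in> sets R" for n unfolding E_def by measurable
    show "incseq E"
    proof (rule incseq_SucI)
      fix n show "E n \<subseteq> E (Suc n)"
        using incseq_SucD[OF B(4), of n] by (auto simp: E_def)
    qed
    show "emeasure R (E n) < \<infinity>" for n
    proof -
      have "emeasure R (E n) \<le> emeasure R (B n)" by (intro emeasure_mono) (auto simp: E_def)
      also have "\<dots> < \<infinity>" using B(3)[of n] by (simp add: less_top)
      finally show ?thesis .
    qed
    show "cmod (g p) \<le> real n" if "p \<in> E n" for n p using that by (simp add: E_def)
    show "(\<Union>n. E n) = D"
    proof
      show "(\<Union>n. E n) \<subseteq> D" by (auto simp: E_def)
      show "D \<subseteq> (\<Union>n. E n)"
      proof
        fix p assume p: "p \<in> D"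
        then obtain i where i: "p \<in> B i" using B(2) by auto
        obtain j where j: "cmod (g p) \<le> real j" using real_arch_simple by blast
        have "B i \<subseteq> B (max i j)" using B(4) by (auto simp: incseq_def)
        then have "p \<in> E (max i j)" using i j p by (auto simp: E_def)
        then show "p \<in> (\<Union>n. E n)" by blast
      qed
    qed
  qed
qed

text \<open>
  For \<open>q = 1\<close> the test function is the phase of \<open>g\<close> on a set where \<open>|g| > 2\<Lambda>\<close>. For \<open>q > 1\<close> it is \<open>|g|\<^bsup>s-2\<^esup> g\<close> on a
  truncated tent, where \<open>I\<close>, the integral of \<open>|g|\<^sup>s\<close>, is finite. The bound on tent norms gives
  \<open>I \<le> \<Lambda> (t \<gamma>(B) + t\<^bsup>1-q\<^esup> I)\<close> for all \<open>t > 0\<close>, and the choice \<open>\<Lambda> t\<^bsup>1-q\<^esup> = 1/2\<close> absorbs \<open>I\<close> into the left-hand side.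
\<close>

lemma tent_norm_inf_le_of_pairing_bound:
  assumes [measurable]: "g \<in> borel_measurable R"
    and q: "1 \<le> q" "1 / ennreal q + 1 / q' = 1" and \<Lambda>: "0 < \<Lambda>"
    and bound: "\<And>f. f \<in> tent_space_1 \<gamma> m q \<Longrightarrow>
       ennreal (cmod (tent_pairing \<gamma> m f g)) \<le> ennreal \<Lambda> * tent_norm_1 \<gamma> m q f"
  shows "tent_norm_inf \<gamma> m q' g \<le> ennreal (2 * \<Lambda>)"
proof -
  obtain E :: "nat \<Rightarrow> ('a \<times> real) set" where E [measurable]: "\<And>n. E n \<in> sets R" and
    E': "incseq E" "(\<Union>n. E n) = D" "\<And>n. emeasure R (E n) < \<infinity>" "\<And>n p. p \<in> E n \<Longrightarrow> cmod (g p) \<le> real n"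
    using exists_bounded_exhaustion[of g] by auto
  have pairing: "tent_pairing \<gamma> m (\<lambda>p. indicator S p * (of_real (cmod (g p) powr a) * g p)) g = of_real I"
    if "0 \<le> I" "(\<integral>\<^sup>+p\<in>S. ennreal (cmod (g p) powr (a + 2)) \<partial>R) = ennreal I" "S \<in> sets R" for S a I
  proof -
    note [measurable] = that(3)
    have "has_bochner_integral R (\<lambda>p. indicator S p * cmod (g p) powr (a + 2)) I"
      by (rule has_bochner_integral_nn_integral)
        (use that in \<open>auto simp: ennreal_mult' ennreal_indicator mult.commute\<close>)
    then have "has_bochner_integral R (\<lambda>p. complex_of_real (indicator S p * cmod (g p) powr (a + 2))) (of_real I)"
      by (rule has_bochner_integral_of_real)
    moreover have "complex_of_real (indicator S p * cmod (g p) powr (a + 2))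
        = indicator S p * (of_real (cmod (g p) powr a) * g p) * cnj (g p)" for p
      using mult_powr_cnj[of "g p" a] by (simp add: indicator_def)
    ultimately show ?thesis
      unfolding tent_pairing_def by (simp add: has_bochner_integral_iff)
  qed
  have finite: "(\<integral>\<^sup>+p\<in>S. ennreal (cmod (g p) powr a) \<partial>R) < \<infinity>"
    if "S \<subseteq> E n" "S \<in> sets R" "0 \<le> a" for S n a
  proof -
    have "(\<integral>\<^sup>+p\<in>S. ennreal (cmod (g p) powr a) \<partial>R) \<le> (\<integral>\<^sup>+p. ennreal (real n powr a) * indicator (E n) p \<partial>R)"
      using that E'(4) by (intro nn_integral_mono) (auto simp: indicator_def intro!: ennreal_leI powr_mono2)
    also have "\<dots> = ennreal (real n powr a) * emeasure R (E n)"
      by (rule nn_integral_cmult_indicator) measurable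
    also have "\<dots> < \<infinity>" using E'(3)[of n] by (simp add: ennreal_mult_less_top)
    finally show ?thesis .
  qed
  show ?thesis
    using q
  proof (cases rule: conjugate_exponent_cases)
    case 1
    have null: "AE p in R. p \<in> E n \<longrightarrow> cmod (g p) \<le> 2 * \<Lambda>" for n
    proof -
      define S where "S = E n \<inter> {p \<in> space R. 2 * \<Lambda> < cmod (g p)}"
      have S [measurable]: "S \<in> sets R" unfolding S_def by measurable
      have S_E: "S \<subseteq> E n" by (auto simp: S_def)
      have S_finite: "emeasure R S < \<infinity>"
        by (rule le_less_trans[OF emeasure_mono[OF S_E E] E'(3)])
      define f where "f p = indicator S p * (complex_of_real (cmod (g p) powr (-1)) * g p)" for p
      have [measurable]: "f \<in> borel_measurable R" unfolding f_def[abs_def] by measurable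
      have f_abs: "ennreal (cmod (f p) powr q) = indicator S p" for p
      proof (cases "p \<in> S")
        case True
        then have "0 < cmod (g p)" using \<Lambda> by (auto simp: S_def)
        moreover have "cmod (f p) = \<bar>cmod (g p) powr (-1)\<bar> * cmod (g p)"
          unfolding f_def norm_mult norm_of_real using True by simp
        ultimately have "cmod (f p) = 1" by (simp add: powr_minus)
        with True show ?thesis by simp
      next
        case False
        then have "f p = 0" by (simp add: f_def)
        with False show ?thesis by simp
      qed
      have norm_f: "tent_norm_1 \<gamma> m q f = emeasure R S"
      proof -
        have "tent_norm_1 \<gamma> m q f = (\<integral>\<^sup>+x. area_power q f x \<partial>\<gamma>)"
          using 1 by (simp add: tent_norm_1_def area_functional_eq)
        also have "\<dots> = emeasure R S" by (simp add: nn_integral_cone_int f_abs)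
        finally show ?thesis .
      qed
      then have f: "f \<in> tent_space_1 \<gamma> m q" using S_finite by (simp add: tent_space_1_def)
      define X where "X = (\<integral>\<^sup>+p\<in>S. ennreal (cmod (g p) powr (-1 + 2)) \<partial>R)"
      have "X < \<infinity>" unfolding X_def by (rule finite[OF S_E S]) simp
      then obtain I where "0 \<le> I" "X = ennreal I" by (cases X) auto
      then have I: "0 \<le> I" "(\<integral>\<^sup>+p\<in>S. ennreal (cmod (g p) powr (-1 + 2)) \<partial>R) = ennreal I"
        by (simp_all only: X_def)
      have "tent_pairing \<gamma> m f g = of_real I"
        using pairing[OF I S] by (simp add: f_def[abs_def])
      with bound[OF f] I(1) norm_f have "ennreal I \<le> ennreal \<Lambda> * emeasure R S" by simp
      moreover have "ennreal (2 * \<Lambda>) * emeasure R S \<le> ennreal I"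
      proof -
        have "ennreal (2 * \<Lambda>) * emeasure R S = (\<integral>\<^sup>+p. ennreal (2 * \<Lambda>) * indicator S p \<partial>R)"
          by (rule nn_integral_cmult_indicator[symmetric]) measurable
        also have "\<dots> \<le> (\<integral>\<^sup>+p\<in>S. ennreal (cmod (g p) powr (-1 + 2)) \<partial>R)"
          by (intro nn_integral_mono) (auto simp: indicator_def S_def intro!: ennreal_leI)
        finally show ?thesis by (simp only: I(2))
      qed
      ultimately have le: "ennreal (2 * \<Lambda>) * emeasure R S \<le> ennreal \<Lambda> * emeasure R S" by simp
      obtain z where z: "emeasure R S = ennreal z" "0 \<le> z" using S_finite by (cases "emeasure R S") auto
      have "2 * \<Lambda> * z \<le> \<Lambda> * z" using le z \<Lambda> by (simp flip: ennreal_mult)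
      then have "z = 0" using \<Lambda> z by (simp add: mult_le_0_iff)
      then have "S \<in> null_sets R" using z S by (auto simp: null_sets_def)
      then have "AE p in R. p \<notin> S" by (rule AE_not_in)
      then show ?thesis using AE_space by eventually_elim (auto simp: S_def)
    qed
    then have "AE p in R. \<forall>n. p \<in> E n \<longrightarrow> cmod (g p) \<le> 2 * \<Lambda>"
      by (subst AE_all_countable) (rule allI, rule null)
    then have "AE p in R. cmod (g p) \<le> 2 * \<Lambda>"
      using AE_space by eventually_elim (use E'(2) in auto)
    then have "tent_norm_inf \<gamma> m \<infinity> g \<le> ennreal (2 * \<Lambda>)"
      using \<Lambda> by (subst tent_norm_inf_top_le_iff) auto
    then show ?thesis by (simp only: 1(2))
  next
    case (2 s)
    have s: "1 < s" "(s - 1) * q = s" "s = 1 + 1 / (q - 1)"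
      unfolding 2(2) using 2(1) by (simp_all add: less_divide_eq divide_simps algebra_simps)
    show ?thesis
      unfolding 2(3)
    proof (subst tent_norm_inf_le_iff)
      show "\<forall>c r. (c, r) \<in> admissible_balls m 5 \<longrightarrow>
        (\<integral>\<^sup>+p\<in>admissible_tent m (ball c r). ennreal (cmod (g p) powr s) \<partial>R)
          \<le> ennreal ((2 * \<Lambda>) powr s) * emeasure \<gamma> (ball c r)"
      proof (intro allI impI)
        fix c r assume "(c, r) \<in> admissible_balls m 5"
        then have "emeasure \<gamma> (ball c r) < top" by (intro ball_finite[simplified]) (auto simp: admissible_balls_def)
        then obtain z where z: "emeasure \<gamma> (ball c r) = ennreal z" "0 \<le> z"
          by (cases "emeasure \<gamma> (ball c r)") auto
        let ?T = "admissible_tent m (ball c r)"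
        have le: "(\<integral>\<^sup>+p\<in>(E n \<inter> ?T). ennreal (cmod (g p) powr s) \<partial>R) \<le> ennreal ((2 * \<Lambda>) powr s) * ennreal z" for n
        proof -
          define S where "S = E n \<inter> ?T"
          have S [measurable]: "S \<in> sets R" unfolding S_def by measurable
          have S_E: "S \<subseteq> E n" by (auto simp: S_def)
          obtain I where I: "0 \<le> I" "(\<integral>\<^sup>+p\<in>S. ennreal (cmod (g p) powr s) \<partial>R) = ennreal I"
            using finite[OF S_E S, of s] s(1)
            by (cases "\<integral>\<^sup>+p\<in>S. ennreal (cmod (g p) powr s) \<partial>R") auto
          define f where "f p = indicator S p * (complex_of_real (cmod (g p) powr (s - 2)) * g p)" for p
          have [measurable]: "f \<in> borel_measurable R" unfolding f_def[abs_def] by measurable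
          have f_abs: "ennreal (cmod (f p) powr q) = ennreal (cmod (g p) powr s) * indicator S p" for p
          proof (cases "p \<in> S \<and> g p \<noteq> 0")
            case True
            then have "cmod (f p) = cmod (g p) powr (s - 2) * cmod (g p) powr 1"
              by (simp add: f_def norm_mult)
            also have "\<dots> = cmod (g p) powr (s - 2 + 1)"
              by (rule powr_add[symmetric])
            also have "s - 2 + 1 = s - 1" by simp
            finally have "cmod (f p) powr q = cmod (g p) powr s"
              by (simp add: powr_powr s(2))
            with True show ?thesis by simp
          qed (auto simp: f_def)
          \<comment> \<open>The solution of \<open>\<Lambda> t\<^bsup>1-q\<^esup> = 1/2\<close>; finiteness of \<open>I\<close> is what allows absorbing \<open>I/2\<close> below.\<close>
          define t where "t = (2 * \<Lambda>) powr (1 / (q - 1))"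
          have t: "0 < t" "t powr (1 - q) = 1 / (2 * \<Lambda>)" "2 * \<Lambda> * t = (2 * \<Lambda>) powr s"
          proof -
            show "0 < t" using \<Lambda> by (simp add: t_def)
            have "1 / (q - 1) * (1 - q) = -1" using 2(1) by (simp add: field_simps)
            then have "t powr (1 - q) = (2 * \<Lambda>) powr (-1)" by (simp only: t_def powr_powr)
            then show "t powr (1 - q) = 1 / (2 * \<Lambda>)" using \<Lambda> by (simp add: powr_minus divide_simps)
            have "(2 * \<Lambda>) powr s = (2 * \<Lambda>) powr 1 * t" unfolding t_def s(3) by (rule powr_add)
            then show "2 * \<Lambda> * t = (2 * \<Lambda>) powr s" using \<Lambda> by simp
          qed
          have norm_f: "tent_norm_1 \<gamma> m q f \<le> ennreal (t * z + I / (2 * \<Lambda>))"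
          proof -
            have "tent_norm_1 \<gamma> m q f \<le> ennreal t * emeasure \<gamma> (ball c r) +
               ennreal (t powr (1 - q)) * (\<integral>\<^sup>+p. ennreal (cmod (f p) powr q) \<partial>R)"
              using t(1) q(1)
              by (intro tent_norm_1_supported_in_tent) (auto simp: f_def S_def indicator_def split: if_splits)
            also have "\<dots> = ennreal t * ennreal z + ennreal (1 / (2 * \<Lambda>)) * ennreal I"
              by (simp only: f_abs I(2) t(2) z(1))
            also have "\<dots> = ennreal (t * z + I / (2 * \<Lambda>))"
              using t(1) z(2) I(1) \<Lambda> by (simp add: ennreal_plus ennreal_mult flip: ennreal_mult)
            finally show ?thesis .
          qed
          then have f: "f \<in> tent_space_1 \<gamma> m q"
            by (auto simp: tent_space_1_def intro: le_less_trans)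
          have "tent_pairing \<gamma> m f g = of_real I"
            using pairing[where S = S and a = "s - 2" and I = I] I S by (simp add: f_def[abs_def])
          with bound[OF f] I(1) have "ennreal I \<le> ennreal \<Lambda> * tent_norm_1 \<gamma> m q f" by simp
          also have "\<dots> \<le> ennreal \<Lambda> * ennreal (t * z + I / (2 * \<Lambda>))"
            by (intro mult_left_mono norm_f) simp
          also have "\<dots> = ennreal (\<Lambda> * (t * z + I / (2 * \<Lambda>)))"
            using \<Lambda> t(1) z(2) I(1) by (subst ennreal_mult) auto
          finally have "I \<le> \<Lambda> * (t * z + I / (2 * \<Lambda>))"
            using \<Lambda> t(1) z(2) I(1) by (subst (asm) ennreal_le_iff) auto
          also have "\<Lambda> * (t * z + I / (2 * \<Lambda>)) = \<Lambda> * t * z + I / 2"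
            using \<Lambda> by (simp add: field_simps)
          finally have "I \<le> (2 * \<Lambda> * t) * z" by simp
          then have "ennreal I \<le> ennreal ((2 * \<Lambda>) powr s * z)" unfolding t(3) by (rule ennreal_leI)
          then show ?thesis
            using I(2) z(2) by (simp add: S_def ennreal_mult)
        qed
        have "(\<integral>\<^sup>+p\<in>?T. ennreal (cmod (g p) powr s) \<partial>R)
            \<le> (\<integral>\<^sup>+p. (SUP n. ennreal (cmod (g p) powr s) * indicator (E n \<inter> ?T) p) \<partial>R)"
        proof (rule nn_integral_mono)
          fix p assume "p \<in> space R"
          then obtain n where "p \<in> E n" using E'(2) by auto
          then show "ennreal (cmod (g p) powr s) * indicator ?T p
              \<le> (SUP n. ennreal (cmod (g p) powr s) * indicator (E n \<inter> ?T) p)"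
            by (intro SUP_upper2[of n]) (auto simp: indicator_def)
        qed
        also have "\<dots> = (SUP n. \<integral>\<^sup>+p\<in>(E n \<inter> ?T). ennreal (cmod (g p) powr s) \<partial>R)"
        proof (rule nn_integral_monotone_convergence_SUP)
          show "incseq (\<lambda>n p. ennreal (cmod (g p) powr s) * indicator (E n \<inter> ?T) p)"
            using E'(1) by (auto simp: incseq_def le_fun_def indicator_def)
        qed measurable
        also have "\<dots> \<le> ennreal ((2 * \<Lambda>) powr s) * ennreal z"
          by (intro SUP_least le)
        finally show "(\<integral>\<^sup>+p\<in>?T. ennreal (cmod (g p) powr s) \<partial>R)
            \<le> ennreal ((2 * \<Lambda>) powr s) * emeasure \<gamma> (ball c r)"
          by (simp only: z(1))
      qed
    qed (use s(1) \<Lambda> in linarith)+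
  qed
qed

text \<open>
  Complex-linear functionals are determined by their real and imaginary parts on real functions,
  each of which is a bounded real functional on the ideal of real tent functions.
\<close>

lemma tent_functional_representation:
  assumes q: "1 \<le> q" and l: "tent_functional \<gamma> m q l"
  obtains g where "g \<in> borel_measurable R"
    "\<And>f. f \<in> tent_space_1 \<gamma> m q \<Longrightarrow> integrable R (\<lambda>p. f p * cnj (g p)) \<and> l f = tent_pairing \<gamma> m f g"
proof -
  obtain C0 :: real where C0: "\<And>f. f \<in> tent_space_1 \<gamma> m q \<Longrightarrow>
      ennreal (cmod (l f)) \<le> ennreal C0 * tent_norm_1 \<gamma> m q f"
    and l_add: "\<And>f h. f \<in> tent_space_1 \<gamma> m q \<Longrightarrow> h \<in> tent_space_1 \<gamma> m q \<Longrightarrow> l (\<lambda>p. f p + h p) = l f + l h"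
    and l_scale: "\<And>a f. f \<in> tent_space_1 \<gamma> m q \<Longrightarrow> l (\<lambda>p. a * f p) = a * l f"
    using l unfolding tent_functional_def by blast
  define T where "T = {f. (\<lambda>p. complex_of_real (f p)) \<in> tent_space_1 \<gamma> m q \<and> f \<in> borel_measurable R}"
  define N where "N f = max 0 C0 * enn2real (tent_norm_1 \<gamma> m q (\<lambda>p. complex_of_real (f p)))" for f :: "'a \<times> real \<Rightarrow> real"
  obtain w :: "'a \<times> real \<Rightarrow> real" where w: "w \<in> borel_measurable R" "\<And>p. 0 < w p"
    "(\<lambda>p. complex_of_real (w p)) \<in> tent_space_1 \<gamma> m q"
    using exists_positive_tent_function[OF q] by metis
  interpret order_continuous_ideal R T N w
  proof (intro order_continuous_ideal.intro sigma_finite_R order_continuous_ideal_axioms.intro)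
    show "f \<in> borel_measurable R" if "f \<in> T" for f using that by (simp add: T_def)
    show "(\<lambda>p. f p + h p) \<in> T" if "f \<in> T" "h \<in> T" for f h
      using that q tent_space_1_add[of q "\<lambda>p. complex_of_real (f p)" "\<lambda>p. complex_of_real (h p)"]
      by (auto simp: T_def)
    show "(\<lambda>p. c * f p) \<in> T" if "f \<in> T" for f c
      using that q tent_space_1_cmult[of q "\<lambda>p. complex_of_real (f p)" "complex_of_real c"]
      by (auto simp: T_def)
    show "f \<in> T" if "h \<in> T" "f \<in> borel_measurable R" "\<And>p. p \<in> space R \<Longrightarrow> \<bar>f p\<bar> \<le> \<bar>h p\<bar>" for f h
    proof -
      have "(\<lambda>p. complex_of_real (f p)) \<in> tent_space_1 \<gamma> m q"
        by (rule tent_space_1_ideal[OF q, of "\<lambda>p. complex_of_real (h p)"]) (use that in \<open>auto simp: T_def\<close>)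
      with that show ?thesis by (simp add: T_def)
    qed
    show "N f \<le> N h" if "h \<in> T" "f \<in> borel_measurable R" "\<And>p. p \<in> space R \<Longrightarrow> \<bar>f p\<bar> \<le> \<bar>h p\<bar>" for f h
    proof -
      have "tent_norm_1 \<gamma> m q (\<lambda>p. complex_of_real (f p)) \<le> tent_norm_1 \<gamma> m q (\<lambda>p. complex_of_real (h p))"
        using q that by (intro tent_norm_1_mono) auto
      then show ?thesis
        using that(1) unfolding N_def by (intro mult_left_mono enn2real_mono) (auto simp: T_def tent_space_1_def)
    qed
    show "N f = 0" if "f \<in> borel_measurable R" "AE p in R. f p = 0" for f
    proof -
      have "tent_norm_1 \<gamma> m q (\<lambda>p. complex_of_real (f p)) = 0"
        using that by (intro tent_norm_1_AE_0) auto
      then show ?thesis by (simp add: N_def)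
    qed
    show "(\<lambda>n. N (u n)) \<longlonglongrightarrow> 0"
      if "h \<in> T" "\<And>n. u n \<in> borel_measurable R" "\<And>n p. p \<in> space R \<Longrightarrow> \<bar>u n p\<bar> \<le> \<bar>h p\<bar>"
        "\<And>p. p \<in> space R \<Longrightarrow> (\<lambda>n. u n p) \<longlonglongrightarrow> 0" for h u
    proof -
      have "(\<lambda>n. tent_norm_1 \<gamma> m q (\<lambda>p. complex_of_real (u n p))) \<longlonglongrightarrow> ennreal 0"
        unfolding ennreal_0
      proof (rule tent_norm_1_tendsto_0[OF q])
        show "(\<lambda>p. complex_of_real (h p)) \<in> tent_space_1 \<gamma> m q" using that(1) by (simp add: T_def)
        show "(\<lambda>n. complex_of_real (u n p)) \<longlonglongrightarrow> 0" if "p \<in> D" for p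
          using tendsto_of_real[OF \<open>\<And>p. p \<in> space R \<Longrightarrow> (\<lambda>n. u n p) \<longlonglongrightarrow> 0\<close>[of p]] that by simp
      qed (use that in auto)
      then have "(\<lambda>n. enn2real (tent_norm_1 \<gamma> m q (\<lambda>p. complex_of_real (u n p)))) \<longlonglongrightarrow> 0"
        by (rule tendsto_enn2real) simp
      then show ?thesis
        unfolding N_def by (rule tendsto_mult_right_zero)
    qed
  qed (use w in \<open>auto simp: T_def\<close>)
  have T_tent: "(\<lambda>p. complex_of_real (f p)) \<in> tent_space_1 \<gamma> m q" if "f \<in> T" for f
    using that by (simp add: T_def)
  have l_bound: "cmod (l (\<lambda>p. complex_of_real (f p))) \<le> N f" if "f \<in> T" for f
  proof -
    let ?n = "tent_norm_1 \<gamma> m q (\<lambda>p. complex_of_real (f p))"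
    have "?n < top" using T_tent[OF that] by (simp add: tent_space_1_def)
    then have n: "?n = ennreal (enn2real ?n)" by simp
    have "ennreal (cmod (l (\<lambda>p. complex_of_real (f p)))) \<le> ennreal C0 * ?n"
      by (rule C0[OF T_tent[OF that]])
    also have "\<dots> \<le> ennreal (max 0 C0) * ?n" by (intro mult_right_mono ennreal_leI) auto
    also have "\<dots> = ennreal (N f)"
      by (subst n) (simp add: N_def ennreal_mult del: ennreal_enn2real)
    finally show ?thesis by (subst (asm) ennreal_le_iff) (auto simp: N_def)
  qed
  have re_add: "l (\<lambda>p. complex_of_real (f p + h p)) = l (\<lambda>p. complex_of_real (f p)) + l (\<lambda>p. complex_of_real (h p))"
    if "f \<in> T" "h \<in> T" for f h
    using l_add[OF T_tent[OF that(1)] T_tent[OF that(2)]] by simp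
  have re_scale: "l (\<lambda>p. complex_of_real (c * f p)) = complex_of_real c * l (\<lambda>p. complex_of_real (f p))"
    if "f \<in> T" for f c
    using l_scale[OF T_tent[OF that], of "complex_of_real c"] by simp
  obtain G1 where [measurable]: "G1 \<in> borel_measurable R" and G1: "\<And>f. f \<in> T \<Longrightarrow>
      integrable R (\<lambda>p. f p * G1 p) \<and> Re (l (\<lambda>p. complex_of_real (f p))) = (\<integral>p. f p * G1 p \<partial>R)"
  proof (rule functional_integral[of "\<lambda>f. Re (l (\<lambda>p. complex_of_real (f p)))"])
    show "\<bar>Re (l (\<lambda>p. complex_of_real (f p)))\<bar> \<le> N f" if "f \<in> T" for f
      using l_bound[OF that] abs_Re_le_cmod[of "l (\<lambda>p. complex_of_real (f p))"] by linarith
  qed (use re_add re_scale in auto)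
  obtain G2 where [measurable]: "G2 \<in> borel_measurable R" and G2: "\<And>f. f \<in> T \<Longrightarrow>
      integrable R (\<lambda>p. f p * G2 p) \<and> Im (l (\<lambda>p. complex_of_real (f p))) = (\<integral>p. f p * G2 p \<partial>R)"
  proof (rule functional_integral[of "\<lambda>f. Im (l (\<lambda>p. complex_of_real (f p)))"])
    show "\<bar>Im (l (\<lambda>p. complex_of_real (f p)))\<bar> \<le> N f" if "f \<in> T" for f
      using l_bound[OF that] abs_Im_le_cmod[of "l (\<lambda>p. complex_of_real (f p))"] by linarith
  qed (use re_add re_scale in auto)
  \<comment> \<open>The pairing conjugates \<open>g\<close>, hence the minus sign.\<close>
  define g where "g p = Complex (G1 p) (- G2 p)" for p
  have g_eq: "g p = complex_of_real (G1 p) - \<i> * complex_of_real (G2 p)" for p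
    by (simp add: g_def complex_eq_iff)
  have real_case: "has_bochner_integral R (\<lambda>p. complex_of_real (f p) * cnj (g p)) (l (\<lambda>p. complex_of_real (f p)))"
    if f: "f \<in> T" for f
  proof -
    let ?l = "l (\<lambda>p. complex_of_real (f p))"
    have 1: "has_bochner_integral R (\<lambda>p. complex_of_real (f p * G1 p)) (complex_of_real (Re ?l))"
      using G1[OF f] by (intro has_bochner_integral_of_real) (auto simp: has_bochner_integral_iff)
    have 2: "has_bochner_integral R (\<lambda>p. complex_of_real (f p * G2 p)) (complex_of_real (Im ?l))"
      using G2[OF f] by (intro has_bochner_integral_of_real) (auto simp: has_bochner_integral_iff)
    have "has_bochner_integral R (\<lambda>p. complex_of_real (f p * G1 p) + \<i> * complex_of_real (f p * G2 p))
        (complex_of_real (Re ?l) + \<i> * complex_of_real (Im ?l))"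
      by (intro has_bochner_integral_add 1 has_bochner_integral_mult_right 2)
    moreover have "complex_of_real (f p * G1 p) + \<i> * complex_of_real (f p * G2 p)
        = complex_of_real (f p) * cnj (g p)" for p
      by (simp add: g_eq distrib_left mult.left_commute)
    ultimately show ?thesis by (simp only: complex_eq[symmetric])
  qed
  show thesis
  proof
    show "g \<in> borel_measurable R" unfolding g_eq[abs_def] by measurable
    fix f assume f: "f \<in> tent_space_1 \<gamma> m q"
    then have [measurable]: "f \<in> borel_measurable R" by (simp add: tent_space_1_def)
    have Re_T: "(\<lambda>p. Re (f p)) \<in> T" and Im_T: "(\<lambda>p. Im (f p)) \<in> T"
      unfolding T_def
      by (auto intro!: tent_space_1_ideal[OF q f] abs_Re_le_cmod abs_Im_le_cmod)
    have f_eq: "f = (\<lambda>p. complex_of_real (Re (f p)) + \<i> * complex_of_real (Im (f p)))"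
      by (rule ext) (rule complex_eq)
    have "l f = l (\<lambda>p. complex_of_real (Re (f p)) + \<i> * complex_of_real (Im (f p)))"
      by (rule arg_cong[OF f_eq])
    also have "\<dots> = l (\<lambda>p. complex_of_real (Re (f p))) + \<i> * l (\<lambda>p. complex_of_real (Im (f p)))"
      using l_add[OF T_tent[OF Re_T] tent_space_1_cmult[OF q T_tent[OF Im_T]]] l_scale[OF T_tent[OF Im_T]]
      by simp
    finally have lf: "l f = l (\<lambda>p. complex_of_real (Re (f p))) + \<i> * l (\<lambda>p. complex_of_real (Im (f p)))" .
    have "has_bochner_integral R
        (\<lambda>p. complex_of_real (Re (f p)) * cnj (g p) + \<i> * (complex_of_real (Im (f p)) * cnj (g p))) (l f)"
      unfolding lf
      by (intro has_bochner_integral_add has_bochner_integral_mult_right real_case Re_T Im_T)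
    moreover have "complex_of_real (Re (f p)) * cnj (g p) + \<i> * (complex_of_real (Im (f p)) * cnj (g p))
        = f p * cnj (g p)" for p
    proof -
      have "f p * cnj (g p) = (complex_of_real (Re (f p)) + \<i> * complex_of_real (Im (f p))) * cnj (g p)"
        by (rule arg_cong[OF complex_eq])
      then show ?thesis by (simp only: distrib_right mult.assoc)
    qed
    ultimately have "has_bochner_integral R (\<lambda>p. f p * cnj (g p)) (l f)" by (simp only:)
    then show "integrable R (\<lambda>p. f p * cnj (g p)) \<and> l f = tent_pairing \<gamma> m f g"
      by (auto simp: has_bochner_integral_iff tent_pairing_def)
  qed
qed

text \<open>
  Rescaling a function to the unit ball. When \<open>tent_norm_1\<close> of \<open>f\<close> is \<open>0\<close>, all multiples of \<open>f\<close> lie in the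
  unit ball, so \<open>l f = 0\<close>.
\<close>

lemma pairing_le_functional_norm:
  assumes q: "1 \<le> q" and f: "f \<in> tent_space_1 \<gamma> m q"
    and \<Lambda>: "0 \<le> \<Lambda>" "tent_functional_norm \<gamma> m q l \<le> ennreal \<Lambda>"
    and l_scale: "\<And>a f. f \<in> tent_space_1 \<gamma> m q \<Longrightarrow> l (\<lambda>p. a * f p) = a * l f"
  shows "ennreal (cmod (l f)) \<le> ennreal \<Lambda> * tent_norm_1 \<gamma> m q f"
proof -
  have f_meas: "f \<in> borel_measurable R" using f by (simp add: tent_space_1_def)
  obtain r where r: "tent_norm_1 \<gamma> m q f = ennreal r" "0 \<le> r"
    using f by (cases "tent_norm_1 \<gamma> m q f") (auto simp: tent_space_1_def)
  have le: "a * cmod (l f) \<le> \<Lambda>" if "0 \<le> a" "a * r \<le> 1" for a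
  proof -
    have "tent_norm_1 \<gamma> m q (\<lambda>p. complex_of_real a * f p) = ennreal (a * r)"
      using q that r f_meas by (simp add: tent_norm_1_cmult ennreal_mult)
    then have "tent_norm_1 \<gamma> m q (\<lambda>p. complex_of_real a * f p) \<le> 1"
      using that by simp
    then have "ennreal (cmod (l (\<lambda>p. complex_of_real a * f p))) \<le> tent_functional_norm \<gamma> m q l"
      unfolding tent_functional_norm_def using tent_space_1_cmult[OF q f] by (intro SUP_upper) auto
    also note \<Lambda>(2)
    finally show ?thesis
      using \<Lambda>(1) that(1) l_scale[OF f, of "complex_of_real a"] by (simp add: norm_mult)
  qed
  have "cmod (l f) \<le> \<Lambda> * r"
  proof (cases "r = 0")
    case True
    have "cmod (l f) = 0"
    proof (rule ccontr)
      assume "cmod (l f) \<noteq> 0"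
      then show False
        using le[of "(\<Lambda> + 1) / cmod (l f)"] True \<Lambda>(1) by simp
    qed
    with True show ?thesis by simp
  next
    case False
    with r le[of "1 / r"] show ?thesis by (simp add: divide_le_eq mult.commute)
  qed
  then show ?thesis using r \<Lambda>(1) by (simp add: ennreal_leI flip: ennreal_mult)
qed

end

section \<open>Duality of the local tent spaces\<close>

theorem corollary4p7:
  fixes \<mu> :: "'a::metric_space measure"
    and \<phi> m :: "'a \<Rightarrow> real"
    and q :: real
    and q' :: ennreal
  defines "\<gamma> \<equiv> weighted_measure \<mu> \<phi>"
  assumes "complete (UNIV :: 'a set)"
    and "geometrically_doubling TYPE('a)"
    and "sets \<mu> = sets borel"
    and "\<And>x r. 0 < r \<Longrightarrow> 0 < emeasure \<mu> (ball x r) \<and> emeasure \<mu> (ball x r) < \<infinity>"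
    and "\<phi> \<in> borel_measurable borel"
    and "m \<in> borel_measurable borel"
    and "\<And>x. 0 < m x"
    and "\<And>x r. 0 < r \<Longrightarrow> emeasure \<gamma> (ball x r) < \<infinity>"
    and "locally_doubling \<gamma> m"
    and "1 \<le> q"
    and "1 / ennreal q + 1 / q' = 1"
  shows "(\<forall>g\<in>tent_space_inf \<gamma> m q'.
            (\<forall>f\<in>tent_space_1 \<gamma> m q. integrable (region_measure \<gamma> m) (\<lambda>p. f p * cnj (g p))) \<and>
            tent_functional \<gamma> m q (\<lambda>f. tent_pairing \<gamma> m f g)) \<and>
         (\<forall>l. tent_functional \<gamma> m q l \<longrightarrow>
            (\<exists>g\<in>tent_space_inf \<gamma> m q'. \<forall>f\<in>tent_space_1 \<gamma> m q. l f = tent_pairing \<gamma> m f g)) \<and>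
         (\<exists>c C::real. 0 < c \<and> 0 < C \<and>
            (\<forall>g\<in>tent_space_inf \<gamma> m q'.
               ennreal c * tent_norm_inf \<gamma> m q' g
                 \<le> tent_functional_norm \<gamma> m q (\<lambda>f. tent_pairing \<gamma> m f g) \<and>
               tent_functional_norm \<gamma> m q (\<lambda>f. tent_pairing \<gamma> m f g)
                 \<le> ennreal C * tent_norm_inf \<gamma> m q' g))"
proof -
  note q = \<open>1 \<le> q\<close> \<open>1 / ennreal q + 1 / q' = 1\<close>
  have sets_\<mu> [measurable_cong]: "sets \<mu> = sets borel" by fact
  have \<phi> [measurable]: "\<phi> \<in> borel_measurable \<mu>"
    using \<open>\<phi> \<in> borel_measurable borel\<close> by (subst measurable_cong_sets[OF sets_\<mu> refl])
  interpret local_tent_setting \<gamma> m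
  proof
    show "sets \<gamma> = sets borel" by (simp add: \<gamma>_def weighted_measure_def sets_\<mu>)
    fix x :: 'a and r :: real assume r: "0 < r"
    show "0 < emeasure \<gamma> (ball x r)"
    proof (rule ccontr)
      assume "\<not> ?thesis"
      then have "ball x r \<in> null_sets \<gamma>" by (auto simp: null_sets_def \<gamma>_def weighted_measure_def sets_\<mu>)
      then have "AE y in \<mu>. y \<in> ball x r \<longrightarrow> ennreal (exp (- \<phi> y)) = 0"
        unfolding \<gamma>_def weighted_measure_def by (subst (asm) null_sets_density_iff) auto
      then have "AE y in \<mu>. y \<notin> ball x r" by simp
      then have "emeasure \<mu> (ball x r) = 0"
        by (subst (asm) AE_iff_measurable[of "ball x r"]) (auto simp: sets_\<mu> sets_eq_imp_space_eq[OF sets_\<mu>])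
      with assms(5)[OF r, of x] show False by simp
    qed
    show "emeasure \<gamma> (ball x r) < \<infinity>" by (rule assms(9)[OF r])
  next
    show "m \<in> borel_measurable borel" "0 < m x" for x by fact+
  qed
  obtain A where A: "0 < A" "\<And>y t. 0 < t \<Longrightarrow> t < m y \<Longrightarrow>
      emeasure \<gamma> (ball y (3 * t)) \<le> ennreal A * emeasure \<gamma> (ball y t)"
  proof -
    have "\<exists>C::real. C \<ge> 1 \<and> (\<forall>(c, r)\<in>admissible_balls m 2.
           emeasure \<gamma> (ball c (2 * r)) \<le> ennreal C * emeasure \<gamma> (ball c r))"
      using \<open>locally_doubling \<gamma> m\<close> unfolding locally_doubling_def by simp
    then obtain C :: real where C: "1 \<le> C" "\<And>c r. 0 < r \<Longrightarrow> r \<le> 2 * m c \<Longrightarrow>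
           emeasure \<gamma> (ball c (2 * r)) \<le> ennreal C * emeasure \<gamma> (ball c r)"
      unfolding admissible_balls_def by blast
    show thesis
    \<comment> \<open>Doubling twice passes from \<open>t\<close> to \<open>4t\<close>; the ball of radius \<open>2t\<close> is admissible with parameter \<open>2\<close>.\<close>
    proof (rule that[of "C * C"])
      fix y t assume t: "0 < t" "t < m y"
      have "emeasure \<gamma> (ball y (3 * t)) \<le> emeasure \<gamma> (ball y (2 * (2 * t)))"
        using t by (intro emeasure_mono) (auto simp: sets_\<gamma>)
      also have "\<dots> \<le> ennreal C * emeasure \<gamma> (ball y (2 * t))"
        using t by (intro C) auto
      also have "\<dots> \<le> ennreal C * (ennreal C * emeasure \<gamma> (ball y t))"
        using t by (intro mult_left_mono C) auto
      finally show "emeasure \<gamma> (ball y (3 * t)) \<le> ennreal (C * C) * emeasure \<gamma> (ball y t)"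
        using C(1) by (simp add: ennreal_mult mult.assoc)
    qed (use C(1) in auto)
  qed
  define K where "K = 2 * (1 + 2 * A)"
  have K: "0 < K" using A(1) by (simp add: K_def)
  have upper: "integrable R (\<lambda>p. f p * cnj (g p)) \<and>
      ennreal (cmod (tent_pairing \<gamma> m f g)) \<le> ennreal (K * N) * tent_norm_1 \<gamma> m q f"
    if f: "f \<in> tent_space_1 \<gamma> m q" and g: "g \<in> borel_measurable R"
      and N: "0 < N" "tent_norm_inf \<gamma> m q' g \<le> ennreal N" for f g N
  proof -
    have [measurable]: "(\<lambda>p. cnj (g p)) \<in> borel_measurable R"
      by (rule measurable_compose[OF g]) (intro borel_measurable_continuous_onI continuous_intros)
    note [measurable] = g
    have [measurable]: "f \<in> borel_measurable R" and f_finite: "tent_norm_1 \<gamma> m q f < \<infinity>"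
      using f by (auto simp: tent_space_1_def)
    have le: "(\<integral>\<^sup>+p. ennreal (cmod (f p * cnj (g p))) \<partial>R) \<le> ennreal (K * N) * tent_norm_1 \<gamma> m q f"
      unfolding K_def by (rule duality_inequality[OF _ _ q A N]) measurable
    also have "\<dots> < \<infinity>" using f_finite by (simp add: ennreal_mult_less_top)
    finally have int: "integrable R (\<lambda>p. f p * cnj (g p))"
      by (intro integrableI_bounded) measurable
    have "ennreal (cmod (tent_pairing \<gamma> m f g)) \<le> (\<integral>\<^sup>+p. ennreal (cmod (f p * cnj (g p))) \<partial>R)"
      unfolding tent_pairing_def by (rule integral_norm_bound_ennreal[OF int])
    with le int show ?thesis by (meson order_trans)
  qed
  have inf_D: "g \<in> borel_measurable R" "\<exists>n\<ge>0. tent_norm_inf \<gamma> m q' g = ennreal n"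
    if "g \<in> tent_space_inf \<gamma> m q'" for g
    using that by (cases "tent_norm_inf \<gamma> m q' g"; auto simp: tent_space_inf_def)+
  have functional: "(\<forall>f\<in>tent_space_1 \<gamma> m q. integrable R (\<lambda>p. f p * cnj (g p))) \<and>
      tent_functional \<gamma> m q (\<lambda>f. tent_pairing \<gamma> m f g)"
    if g: "g \<in> tent_space_inf \<gamma> m q'" for g
  proof -
    obtain n where n: "0 \<le> n" "tent_norm_inf \<gamma> m q' g = ennreal n" using inf_D[OF g] by blast
    have *: "integrable R (\<lambda>p. f p * cnj (g p)) \<and>
      ennreal (cmod (tent_pairing \<gamma> m f g)) \<le> ennreal (K * (n + 1)) * tent_norm_1 \<gamma> m q f"
      if "f \<in> tent_space_1 \<gamma> m q" for f
      by (rule upper[OF that inf_D(1)[OF g]]) (use n in \<open>auto intro: ennreal_leI\<close>)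
    then show ?thesis
      unfolding tent_functional_def tent_pairing_def
      by (auto simp: distrib_right mult.assoc)
  qed
  have lower: "tent_norm_inf \<gamma> m q' g \<le> 2 * tent_functional_norm \<gamma> m q (\<lambda>f. tent_pairing \<gamma> m f g)"
    if g: "g \<in> borel_measurable R" for g
  proof (cases "tent_functional_norm \<gamma> m q (\<lambda>f. tent_pairing \<gamma> m f g)")
    case (real \<Lambda>)
    have "tent_norm_inf \<gamma> m q' g \<le> ennreal (2 * \<Lambda>)"
    proof (rule ennreal_le_epsilon)
      fix e :: real assume e: "0 < e"
      have "tent_norm_inf \<gamma> m q' g \<le> ennreal (2 * (\<Lambda> + e / 2))"
      proof (rule tent_norm_inf_le_of_pairing_bound[OF g q])
        fix f assume f: "f \<in> tent_space_1 \<gamma> m q"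
        show "ennreal (cmod (tent_pairing \<gamma> m f g)) \<le> ennreal (\<Lambda> + e / 2) * tent_norm_1 \<gamma> m q f"
          by (rule pairing_le_functional_norm[OF q(1) f])
            (use real e in \<open>auto simp: tent_pairing_def mult.assoc intro: ennreal_leI\<close>)
      qed (use real e in auto)
      also have "\<dots> = ennreal (2 * \<Lambda>) + ennreal e"
        using real e by (subst ennreal_plus[symmetric]) auto
      finally show "tent_norm_inf \<gamma> m q' g \<le> ennreal (2 * \<Lambda>) + ennreal e" .
    qed
    with real show ?thesis by (simp add: ennreal_mult)
  qed (simp add: ennreal_mult_top)
  have representation: "\<exists>g\<in>tent_space_inf \<gamma> m q'. \<forall>f\<in>tent_space_1 \<gamma> m q. l f = tent_pairing \<gamma> m f g"
    if l: "tent_functional \<gamma> m q l" for l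
  proof -
    obtain g where g: "g \<in> borel_measurable R" "\<And>f. f \<in> tent_space_1 \<gamma> m q \<Longrightarrow>
        integrable R (\<lambda>p. f p * cnj (g p)) \<and> l f = tent_pairing \<gamma> m f g"
      using tent_functional_representation[OF q(1) l] by metis
    from l have "\<exists>C::real. \<forall>f\<in>tent_space_1 \<gamma> m q.
        ennreal (cmod (l f)) \<le> ennreal C * tent_norm_1 \<gamma> m q f"
      by (simp add: tent_functional_def)
    then obtain C :: real where C: "\<And>f. f \<in> tent_space_1 \<gamma> m q \<Longrightarrow>
        ennreal (cmod (l f)) \<le> ennreal C * tent_norm_1 \<gamma> m q f"
      by blast
    have "tent_norm_inf \<gamma> m q' g \<le> ennreal (2 * max 1 C)"
    proof (rule tent_norm_inf_le_of_pairing_bound[OF g(1) q])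
      fix f assume f: "f \<in> tent_space_1 \<gamma> m q"
      have "ennreal (cmod (l f)) \<le> ennreal C * tent_norm_1 \<gamma> m q f" by (rule C[OF f])
      also have "\<dots> \<le> ennreal (max 1 C) * tent_norm_1 \<gamma> m q f"
        by (intro mult_right_mono ennreal_leI) auto
      finally show "ennreal (cmod (tent_pairing \<gamma> m f g)) \<le> ennreal (max 1 C) * tent_norm_1 \<gamma> m q f"
        using g(2)[OF f] by simp
    qed simp
    also have "\<dots> < \<infinity>" by simp
    finally have "g \<in> tent_space_inf \<gamma> m q'"
      using g(1) by (simp add: tent_space_inf_def)
    then show ?thesis by (rule bexI[rotated]) (intro ballI, simp add: g(2))
  qed
  have norms: "ennreal (1 / 2) * tent_norm_inf \<gamma> m q' g
        \<le> tent_functional_norm \<gamma> m q (\<lambda>f. tent_pairing \<gamma> m f g) \<and>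
      tent_functional_norm \<gamma> m q (\<lambda>f. tent_pairing \<gamma> m f g) \<le> ennreal K * tent_norm_inf \<gamma> m q' g"
    if g: "g \<in> tent_space_inf \<gamma> m q'" for g
  proof
    have "ennreal (1 / 2) * tent_norm_inf \<gamma> m q' g
        \<le> ennreal (1 / 2) * (2 * tent_functional_norm \<gamma> m q (\<lambda>f. tent_pairing \<gamma> m f g))"
      by (intro mult_left_mono lower inf_D(1) g) simp
    also have "ennreal (1 / 2) * (2 * tent_functional_norm \<gamma> m q (\<lambda>f. tent_pairing \<gamma> m f g))
        = tent_functional_norm \<gamma> m q (\<lambda>f. tent_pairing \<gamma> m f g)"
    proof -
      have "ennreal (1 / 2) * 2 = ennreal (1 / 2 * 2)" by (subst ennreal_mult) auto
      then show ?thesis by (simp only: mult.assoc[symmetric]) simp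
    qed
    finally show "ennreal (1 / 2) * tent_norm_inf \<gamma> m q' g
        \<le> tent_functional_norm \<gamma> m q (\<lambda>f. tent_pairing \<gamma> m f g)" .
    obtain n where n: "0 \<le> n" "tent_norm_inf \<gamma> m q' g = ennreal n" using inf_D[OF g] by blast
    have "tent_functional_norm \<gamma> m q (\<lambda>f. tent_pairing \<gamma> m f g) \<le> ennreal (K * n)"
    proof (rule ennreal_le_epsilon)
      fix e :: real assume e: "0 < e"
      have "ennreal (cmod (tent_pairing \<gamma> m f g)) \<le> ennreal (K * n + e)"
        if f: "f \<in> tent_space_1 \<gamma> m q" "tent_norm_1 \<gamma> m q f \<le> 1" for f
      proof -
        have "ennreal (cmod (tent_pairing \<gamma> m f g)) \<le> ennreal (K * (n + e / K)) * tent_norm_1 \<gamma> m q f"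
        proof -
          have "0 < n + e / K" using n(1) e K by (simp add: add_nonneg_pos)
          moreover have "tent_norm_inf \<gamma> m q' g \<le> ennreal (n + e / K)"
            unfolding n(2) using e K by (intro ennreal_leI) simp
          ultimately show ?thesis using upper[OF f(1) inf_D(1)[OF g]] by blast
        qed
        also have "\<dots> \<le> ennreal (K * (n + e / K)) * 1"
          by (intro mult_left_mono f) simp
        also have "ennreal (K * (n + e / K)) * 1 = ennreal (K * n + e)"
          using K by (simp add: distrib_left)
        finally show ?thesis .
      qed
      then have "tent_functional_norm \<gamma> m q (\<lambda>f. tent_pairing \<gamma> m f g) \<le> ennreal (K * n + e)"
        unfolding tent_functional_norm_def by (intro SUP_least) auto
      then show "tent_functional_norm \<gamma> m q (\<lambda>f. tent_pairing \<gamma> m f g) \<le> ennreal (K * n) + ennreal e"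
        using K n e by simp
    qed
    then show "tent_functional_norm \<gamma> m q (\<lambda>f. tent_pairing \<gamma> m f g) \<le> ennreal K * tent_norm_inf \<gamma> m q' g"
      using n K by (simp add: ennreal_mult)
  qed
  show ?thesis
  proof (intro conjI)
    show "\<exists>c C::real. 0 < c \<and> 0 < C \<and> (\<forall>g\<in>tent_space_inf \<gamma> m q'.
        ennreal c * tent_norm_inf \<gamma> m q' g \<le> tent_functional_norm \<gamma> m q (\<lambda>f. tent_pairing \<gamma> m f g) \<and>
        tent_functional_norm \<gamma> m q (\<lambda>f. tent_pairing \<gamma> m f g) \<le> ennreal C * tent_norm_inf \<gamma> m q' g)"
      by (rule exI[of _ "1 / 2"], rule exI[of _ K], intro conjI ballI norms) (use K in simp_all)
  qed (use functional representation in blast)+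
qed

end
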